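(* Let $N$ be a positive integer and $0<p<\infty$ with $Np>1$. Then the class $\mathfrak{R}_N(i,i,\dots,i)$ is dense in $H^p(T_\Gamma)$.
   Context: $\Gamma=\{y\in\mathbb{R}^n:y_j>0\ \forall j\}$, $T_\Gamma=\{x+iy:x\in\mathbb{R}^n,y\in\Gamma\}$, and $H^p(T_\Gamma)$ is the space of holomorphic $F$ on $T_\Gamma$ with $\|F\|_{H^p}=\sup_{y\in\Gamma}\left(\int_{\mathbb{R}^n}|F(x+iy)|^p\,dx\right)^{1/p}<\infty$. For $\alpha=(\alpha_1,\dots,\alpha_n)\in\mathbb{C}^n$, $\mathfrak{R}_N(\alpha)$ is the family of rational functions $f(z)=(z_1+\alpha_1)^{-N-1}\cdots(z_n+\alpha_n)^{-N-1}P\!\left(\frac{1}{z_1+\alpha_1},\dots,\frac{1}{z_n+\alpha_n}\right)$ with $P$ a polynomial in $n$ variables. *)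

theory Defs
  imports "HOL-Analysis.Analysis"
begin

definition tube_pt :: "real^'n \<Rightarrow> real^'n \<Rightarrow> complex^'n" where
  "tube_pt x y = (\<chi> j. Complex (x $ j) (y $ j))"

definition Gamma_cone :: "(real^'n) set" where
  "Gamma_cone = {y. \<forall>j. 0 < y $ j}"

definition tube_dom :: "(complex^'n) set" where
  "tube_dom = {z. \<forall>j. 0 < Im (z $ j)}"

definition holo_on :: "(complex^'n \<Rightarrow> complex) \<Rightarrow> (complex^'n) set \<Rightarrow> bool" where
  "holo_on F S \<longleftrightarrow> (\<forall>z\<in>S. \<exists>L. (F has_derivative L) (at z) \<and>
       (\<forall>c v. L (c *s v) = c * L v))"

text \<open>p-th power of the H^p quasi-norm: sup over y of the integral of |F(x+iy)|^p.\<close>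
definition Hp_pow :: "real \<Rightarrow> (complex^'n \<Rightarrow> complex) \<Rightarrow> ennreal" where
  "Hp_pow p F = (SUP y\<in>Gamma_cone.
      \<integral>\<^sup>+ x. ennreal (norm (F (tube_pt x y)) powr p) \<partial>lborel)"

definition Hp_space :: "real \<Rightarrow> (complex^'n \<Rightarrow> complex) set" where
  "Hp_space p = {F. holo_on F tube_dom \<and> Hp_pow p F < \<infinity>}"

text \<open>The family R_N(alpha): (prod_j (z_j+alpha_j)^{-N-1}) * P(1/(z_1+alpha_1),...),
  with P a polynomial in n variables, written as a finitely supported
  coefficient function on multi-indices k :: 'n => nat.\<close>
definition RN :: "nat \<Rightarrow> complex^'n \<Rightarrow> (complex^'n \<Rightarrow> complex) set" where
  "RN N \<alpha> = {f. \<exists>c :: ('n \<Rightarrow> nat) \<Rightarrow> complex. finite {k. c k \<noteq> 0} \<and>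
      f = (\<lambda>z. (\<Prod>j\<in>UNIV. inverse (z $ j + \<alpha> $ j) ^ (N + 1)) *
               (\<Sum>k\<in>{k. c k \<noteq> 0}. c k * (\<Prod>j\<in>UNIV. inverse (z $ j + \<alpha> $ j) ^ k j)))}"

end

theory Submission
  imports Defs "HOL-Complex_Analysis.Cauchy_Integral_Formula"
    "HOL-Computational_Algebra.Fundamental_Theorem_Algebra"
begin

text \<open>
  Write \<open>F\<^sub>\<delta> = F (\<cdot> + i\<delta>(1,\<dots>,1))\<close> and \<open>m\<^sub>F(y) = \<integral> |F(x + iy)|\<^sup>p dx\<close>. Since \<open>|F|\<^sup>p\<close> satisfies the mean value
  inequality on complex circles and Lebesgue measure is invariant under real translations,
  \<open>t \<mapsto> m\<^sub>F(y + tw)\<close> satisfies a symmetric mean value inequality; being continuous and bounded, it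
  is nonincreasing for \<open>w \<in> \<Gamma>\<close>. Thus norms are read off at low heights, and this monotonicity,
  applied also to \<open>F F\<^sub>\<delta>\<close> and \<open>F + F\<^sub>\<delta>\<close>, replaces boundary values and yields \<open>F\<^sub>\<delta> \<rightarrow> F\<close> in \<open>H\<^sup>p\<close>
  for every \<open>p > 0\<close>. A shifted function is bounded; after damping at infinity by
  \<open>\<Prod>(1 - i\<epsilon>z\<^sub>j)\<^bsup>-N-1\<^esup>\<close> it equals \<open>\<Prod>(z\<^sub>j + i)\<^bsup>-N-1\<^esup>\<close> times a bounded function \<open>g\<close>, and contracting the Cayley
  coordinates \<open>w\<^sub>j = (z\<^sub>j - i)/(z\<^sub>j + i)\<close> makes \<open>g\<close> holomorphic on a larger polydisc, where it is
  a uniform limit of polynomials in \<open>w\<close>, that is, in \<open>1/(z\<^sub>j + i)\<close>.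
\<close>

section \<open>Circle means of holomorphic functions\<close>

text \<open>For p < 1 a function in H^p need not be the Poisson integral of boundary values, so
  everything rests on the submean inequality for |f|^q with arbitrary q > 0. It is proved by
  removing zeros: each root of a polynomial inside the disc is traded for a factor of equal modulus
  on the circle, after which a q-th power of f makes sense; Taylor polynomials carry this over to
  general f. Exponents other than p do occur, since the product of F with its shift is measured with
  p/2.

  The quasi-norm is a supremum over all heights, which pointwise limits do not control. Damping and
  contraction are therefore carried out on functions that extend a little below the boundary. After
  shifting back up, monotonicity bounds the supremum by the integral over one horizontal plane,
  where dominated convergence applies. For this reason the shift is split into two halves at the
  end: one makes F bounded, the other is the room below the boundary. The condition on N and p
  enters through the integrability of |weight N|^p along horizontal planes.\<close>

lemma holomorphic_mean_value:
  fixes k :: "complex \<Rightarrow> complex"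
  assumes hol: "k holomorphic_on cball 0 r" and r: "0 < r"
  shows "((\<lambda>t. k (r * cis (2 * pi * t))) has_integral k 0) {0..1}"
proof -
  have "((\<lambda>u. k u / (u - 0)) has_contour_integral (2 * of_real pi * \<i> * k 0)) (circlepath 0 r)"
    using Cauchy_integral_circlepath_simple[OF hol, of 0] r by simp
  then have "((\<lambda>t. k (circlepath 0 r t) / circlepath 0 r t *
      vector_derivative (circlepath 0 r) (at t within {0..1})) has_integral 2 * of_real pi * \<i> * k 0) {0..1}"
    by (simp add: has_contour_integral_def)
  then have "((\<lambda>t. 2 * of_real pi * \<i> * k (r * cis (2 * pi * t))) has_integral 2 * of_real pi * \<i> * k 0) {0..1}"
  proof (rule has_integral_eq[rotated])
    fix t :: real assume "t \<in> {0..1}"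
    then have "vector_derivative (circlepath 0 r) (at t within {0..1})
        = 2 * pi * \<i> * circlepath 0 r t"
      by (subst vector_derivative_circlepath01) (auto simp: circlepath)
    moreover have "circlepath 0 r t = r * cis (2 * pi * t)" "circlepath 0 r t \<noteq> 0"
      using r by (simp_all add: circlepath cis_conv_exp mult_ac)
    ultimately show "k (circlepath 0 r t) / circlepath 0 r t *
        vector_derivative (circlepath 0 r) (at t within {0..1})
        = 2 * of_real pi * \<i> * k (r * cis (2 * pi * t))"
      by simp
  qed
  from has_integral_mult_right[OF this, of "inverse (2 * of_real pi * \<i>)"]
  show ?thesis by (simp add: field_simps)
qed

definition circle_mean :: "real \<Rightarrow> (complex \<Rightarrow> complex) \<Rightarrow> real" where
  "circle_mean q f = integral {0..1} (\<lambda>t. norm (f (cis (2 * pi * t))) powr q)"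

lemma circle_mean_integrable:
  assumes "continuous_on (sphere 0 1) f" and "q > 0"
  shows "(\<lambda>t. norm (f (cis (2 * pi * t))) powr q) integrable_on {0..1}"
proof (rule integrable_continuous_real)
  have "continuous_on {0..1} (\<lambda>t. f (cis (2 * pi * t)))"
    by (rule continuous_on_compose2[OF assms(1)]) (auto intro!: continuous_intros)
  then show "continuous_on {0..1} (\<lambda>t. norm (f (cis (2 * pi * t))) powr q)"
    using assms(2) by (intro continuous_on_powr' continuous_intros) auto
qed

text \<open>A zero-free f has a holomorphic logarithm g on the disc, so |f|^q is the modulus of the
  holomorphic function exp (q g), which has the mean value property. On the boundary circle f is
  merely continuous and may vanish; hence the circles of radius \<open>r n\<close> < 1 and the
  passage to the limit.\<close>

lemma submean_zero_free:
  fixes f :: "complex \<Rightarrow> complex"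
  assumes hol: "f holomorphic_on ball 0 1" and cont: "continuous_on (cball 0 1) f"
    and nz: "\<And>z. z \<in> ball 0 1 \<Longrightarrow> f z \<noteq> 0" and q: "q > 0"
  shows "norm (f 0) powr q \<le> circle_mean q f"
proof -
  have "contractible (ball (0::complex) 1)" by (simp add: convex_imp_contractible)
  from contractible_imp_holomorphic_log[OF hol this nz]
  obtain g where g: "g holomorphic_on ball 0 1" "\<And>z. z \<in> ball 0 1 \<Longrightarrow> f z = exp (g z)"
    by metis
  define r where "r n = 1 - 1 / (real n + 2)" for n
  have r01: "0 < r n" "r n < 1" for n by (auto simp: r_def field_simps)
  have rlim: "r \<longlonglongrightarrow> 1" unfolding r_def by real_asymp
  define h where "h n t = norm (f (r n * cis (2 * pi * t))) powr q" for n t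
  have cf: "continuous_on {0..1} (\<lambda>t. f (c * cis (2 * pi * t)))" if "0 \<le> c" "c \<le> 1" for c :: real
    by (rule continuous_on_compose2[OF cont]) (use that in \<open>auto intro!: continuous_intros simp: norm_mult\<close>)
  have hint: "h n integrable_on {0..1}" for n
    unfolding h_def using q r01[of n]
    by (intro integrable_continuous_real continuous_on_powr' continuous_intros cf) auto
  have le: "norm (f 0) powr q \<le> integral {0..1} (h n)" for n
  proof -
    define k where "k z = exp (q * g z)" for z
    have sub: "cball 0 (r n) \<subseteq> ball (0::complex) 1" using r01[of n] by auto
    have "k holomorphic_on cball 0 (r n)"
      unfolding k_def by (intro holomorphic_intros holomorphic_on_subset[OF g(1) sub])
    from holomorphic_mean_value[OF this r01(1)]
    have k: "((\<lambda>t. k (r n * cis (2 * pi * t))) has_integral k 0) {0..1}" .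
    have nk: "norm (k z) = norm (f z) powr q" if "z \<in> ball 0 1" for z
      using that q by (simp add: k_def g(2) powr_def)
    have "norm (k 0) \<le> integral {0..1} (h n)"
      unfolding integral_unique[OF k, symmetric]
    proof (rule integral_norm_bound_integral)
      show "norm (k (r n * cis (2 * pi * t))) \<le> h n t" for t
        using r01[of n] by (subst nk) (auto simp: h_def norm_mult)
    qed (use k hint in auto)
    then show ?thesis by (simp add: nk)
  qed
  from cont have "compact (f ` cball 0 1)" by (simp add: compact_continuous_image)
  then obtain B where B: "\<And>z. z \<in> cball 0 1 \<Longrightarrow> norm (f z) \<le> B"
    by (meson compact_imp_bounded bounded_iff imageI)
  have "(\<lambda>n. integral {0..1} (h n)) \<longlonglongrightarrow> circle_mean q f"
    unfolding circle_mean_def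
  proof (rule dominated_convergence(2)[where h="\<lambda>_. B powr q"])
    show "norm (h n t) \<le> B powr q" for n t
      using r01[of n] q by (auto simp: h_def norm_mult intro!: powr_mono2 B)
    show "(\<lambda>n. h n t) \<longlonglongrightarrow> norm (f (cis (2 * pi * t))) powr q" for t
    proof -
      have "((\<lambda>c. f (of_real c * cis (2 * pi * t))) \<circ> r) \<longlonglongrightarrow> f (of_real 1 * cis (2 * pi * t))"
      proof (rule continuous_on_tendsto_compose[where s="{0..1}", unfolded o_def[symmetric]])
        show "continuous_on {0..1} (\<lambda>c. f (of_real c * cis (2 * pi * t)))"
          by (rule continuous_on_compose2[OF cont]) (auto intro!: continuous_intros simp: norm_mult)
        show "\<forall>\<^sub>F n in sequentially. r n \<in> {0..1}"
          using r01 by (intro always_eventually) (auto intro: less_imp_le)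
      qed (use rlim in auto)
      then show ?thesis
        unfolding h_def o_def using q by (intro tendsto_powr' tendsto_intros) auto
    qed
  qed (use hint in auto)
  then show ?thesis
    by (rule LIMSEQ_le_const) (use le in auto)
qed

text \<open>Induction over the roots absorbs the linear factors into f, which must therefore vary. A
  root with |a| >= 1 gives a factor without zeros in the open disc. A root inside is replaced by its
  reflection 1 - cnj a * z: this has no zero in the disc, the same modulus as z - a on the circle,
  and the value 1 >= |a| at the centre, so the inequality can only have become stronger.\<close>

lemma submean_times_linear_factors:
  fixes f :: "complex \<Rightarrow> complex" and A :: "complex multiset"
  assumes "f holomorphic_on ball 0 1" "continuous_on (cball 0 1) f"
    and "\<And>z. z \<in> ball 0 1 \<Longrightarrow> f z \<noteq> 0" and q: "q > 0"
  shows "norm (f 0 * (\<Prod>a\<in>#A. 0 - a)) powr q \<le> circle_mean q (\<lambda>z. f z * (\<Prod>a\<in>#A. z - a))"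
  using assms(1-3)
proof (induction A arbitrary: f)
  case empty
  then show ?case using submean_zero_free[OF empty q] by simp
next
  case (add a A)
  show ?case
  proof (cases "norm a < 1")
    case False
    have "norm ((f 0 * (0 - a)) * (\<Prod>a\<in>#A. 0 - a)) powr q
        \<le> circle_mean q (\<lambda>z. (f z * (z - a)) * (\<Prod>a\<in>#A. z - a))"
      using False add.prems by (intro add.IH holomorphic_intros continuous_intros) auto
    then show ?thesis by (simp add: mult_ac)
  next
    case True
    have nz: "1 - cnj a * z \<noteq> 0" if "z \<in> ball 0 1" for z
    proof
      assume "1 - cnj a * z = 0"
      then have "norm (cnj a * z) = 1" by (metis eq_iff_diff_eq_0 norm_one)
      moreover have "norm a * norm z \<le> 1 * norm z" using True by (intro mult_right_mono) auto
      ultimately show False using that by (simp add: norm_mult)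
    qed
    have eq: "norm (1 - cnj a * z) = norm (z - a)" if "norm z = 1" for z
    proof -
      have "z * cnj z = 1" using that complex_norm_square[of z] by simp
      then have "z * cnj (1 - cnj a * z) = z - a" by (simp add: algebra_simps)
      then have "norm (z - a) = norm z * norm (1 - cnj a * z)"
        by (metis norm_mult complex_mod_cnj)
      then show ?thesis using that by simp
    qed
    have IH: "norm ((f 0 * (1 - cnj a * 0)) * (\<Prod>a\<in>#A. 0 - a)) powr q
        \<le> circle_mean q (\<lambda>z. (f z * (1 - cnj a * z)) * (\<Prod>a\<in>#A. z - a))"
      using nz add.prems by (intro add.IH holomorphic_intros continuous_intros) auto
    have "norm (f 0 * (\<Prod>a\<in>#add_mset a A. 0 - a)) = norm a * norm (f 0 * (\<Prod>a\<in>#A. 0 - a))"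
      by (simp add: norm_mult)
    also have "\<dots> \<le> 1 * norm (f 0 * (\<Prod>a\<in>#A. 0 - a))"
      using True by (intro mult_right_mono) auto
    finally have "norm (f 0 * (\<Prod>a\<in>#add_mset a A. 0 - a)) powr q \<le> norm (f 0 * (\<Prod>a\<in>#A. 0 - a)) powr q"
      using q by (intro powr_mono2) auto
    also have "\<dots> \<le> circle_mean q (\<lambda>z. (f z * (1 - cnj a * z)) * (\<Prod>a\<in>#A. z - a))"
      using IH by simp
    also have "\<dots> = circle_mean q (\<lambda>z. f z * (\<Prod>a\<in>#add_mset a A. z - a))"
      unfolding circle_mean_def by (simp add: norm_mult eq mult_ac)
    finally show ?thesis .
  qed
qed

lemma submean_poly:
  fixes P :: "complex poly"
  assumes q: "q > 0"
  shows "norm (poly P 0) powr q \<le> circle_mean q (poly P)"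
proof (cases "P = 0")
  case True
  then show ?thesis by (simp add: circle_mean_def)
next
  case False
  from alg_closed_imp_factorization[OF this]
  obtain A where P: "P = smult (lead_coeff P) (\<Prod>x\<in>#A. [:-x, 1:])" by blast
  have "poly P = (\<lambda>z. lead_coeff P * (\<Prod>x\<in>#A. z - x))"
    by (subst P) (simp add: poly_prod_mset fun_eq_iff)
  moreover have "norm (lead_coeff P * (\<Prod>x\<in>#A. 0 - x)) powr q
      \<le> circle_mean q (\<lambda>z. lead_coeff P * (\<Prod>x\<in>#A. z - x))"
    using False q by (intro submean_times_linear_factors) auto
  ultimately show ?thesis by metis
qed

text \<open>Approximation by Taylor polynomials, whose zeros are available as a finite multiset.
  Convergence at a radius \<rho> > 1 makes the coefficients absolutely summable, and their sum is
  the constant bound for dominated convergence on the unit circle.\<close>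

lemma submean_holomorphic:
  fixes f :: "complex \<Rightarrow> complex"
  assumes hol: "f holomorphic_on ball 0 R" and R: "R > 1" and q: "q > 0"
  shows "norm (f 0) powr q \<le> circle_mean q f"
proof -
  define c where "c n = (deriv ^^ n) f 0 / fact n" for n
  have sums: "(\<lambda>n. c n * z ^ n) sums f z" if "z \<in> ball 0 R" for z
    using holomorphic_power_series[OF hol that] by (simp add: c_def)
  obtain \<rho> where \<rho>: "1 < \<rho>" "\<rho> < R" using dense[OF R] by blast
  have "summable (\<lambda>n. c n * of_real \<rho> ^ n)"
    using sums[of "of_real \<rho>"] \<rho> by (auto simp: sums_iff)
  from powser_insidea[OF this, of 1] \<rho> have summ: "summable (\<lambda>n. norm (c n))" by simp
  define P where "P n = (\<Sum>i<n. monom (c i) i)" for n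
  have P: "poly (P n) z = (\<Sum>i<n. c i * z ^ i)" for n z
    by (simp add: P_def poly_sum poly_monom)
  have lim: "(\<lambda>n. poly (P n) z) \<longlonglongrightarrow> f z" if "z \<in> ball 0 R" for z
    using sums[OF that] unfolding sums_def P .
  have bd: "norm (poly (P n) z) \<le> (\<Sum>n. norm (c n))" if "norm z = 1" for n z
  proof -
    have "norm (poly (P n) z) \<le> (\<Sum>i<n. norm (c i))"
      unfolding P using norm_sum[of "\<lambda>i. c i * z ^ i"] that by (simp add: norm_mult norm_power)
    also have "\<dots> \<le> (\<Sum>n. norm (c n))" by (rule sum_le_suminf[OF summ]) auto
    finally show ?thesis .
  qed
  have "(\<lambda>n. circle_mean q (poly (P n))) \<longlonglongrightarrow> circle_mean q f"
    unfolding circle_mean_def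
  proof (rule dominated_convergence(2)[where h="\<lambda>_. (\<Sum>n. norm (c n)) powr q"])
    show "(\<lambda>n. norm (poly (P n) (cis (2 * pi * t))) powr q) \<longlonglongrightarrow> norm (f (cis (2 * pi * t))) powr q" for t
      using q R by (intro tendsto_powr' tendsto_intros lim) auto
    show "norm (norm (poly (P n) (cis (2 * pi * t))) powr q) \<le> (\<Sum>n. norm (c n)) powr q" for n t
      using q by (auto intro!: powr_mono2 bd)
  qed (use q in \<open>auto intro!: circle_mean_integrable continuous_intros\<close>)
  moreover have "(\<lambda>n. norm (poly (P n) 0) powr q) \<longlonglongrightarrow> norm (f 0) powr q"
    using q R by (intro tendsto_powr' tendsto_intros lim) auto
  ultimately show ?thesis
    using submean_poly[OF q] by (blast intro: LIMSEQ_le)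
qed

lemma submean_holomorphic_nn:
  fixes f :: "complex \<Rightarrow> complex"
  assumes hol: "f holomorphic_on ball 0 R" and R: "R > 1" and q: "q > 0"
  shows "ennreal (norm (f 0) powr q)
    \<le> (\<integral>\<^sup>+ t. indicator {0..1} t * ennreal (norm (f (cis (2 * pi * t))) powr q) \<partial>lborel)"
proof -
  have "continuous_on (sphere 0 1) f"
    using holomorphic_on_imp_continuous_on[OF hol] R by (auto intro: continuous_on_subset)
  then have "((\<lambda>t. norm (f (cis (2 * pi * t))) powr q) has_integral circle_mean q f) {0..1}"
    unfolding circle_mean_def using circle_mean_integrable[OF _ q] by blast
  from nn_integral_has_integral_lebesgue[OF _ this]
  have "(\<integral>\<^sup>+ t. ennreal (indicator {0..1} t * norm (f (cis (2 * pi * t))) powr q) \<partial>lborel) = circle_mean q f"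
    by simp
  then have "(\<integral>\<^sup>+ t. indicator {0..1} t * ennreal (norm (f (cis (2 * pi * t))) powr q) \<partial>lborel) = circle_mean q f"
    by (simp add: ennreal_mult' ennreal_indicator)
  then show ?thesis using submean_holomorphic[OF assms] by (simp add: ennreal_leI)
qed

section \<open>Polynomial approximation on the polydisc\<close>

text \<open>
  Interpolation at the roots of unity evaluates its argument only at finitely many points; applied
  in one variable it therefore preserves holomorphy in the others, with no need to differentiate
  under an integral sign.
\<close>

definition root_interp :: "nat \<Rightarrow> (complex \<Rightarrow> complex) \<Rightarrow> complex \<Rightarrow> complex" where
  "root_interp m f w = (\<Sum>k<m. w ^ k * (\<Sum>l<m. f (cis (2 * pi * real l / real m)) * cis (- 2 * pi * real k * real l / real m)) / m)"

lemma root_interp_add: "root_interp m (\<lambda>z. f z + g z) w = root_interp m f w + root_interp m g w"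
  by (simp add: root_interp_def algebra_simps sum.distrib add_divide_distrib)

lemma root_interp_cmult: "root_interp m (\<lambda>z. c * f z) w = c * root_interp m f w"
  by (simp add: root_interp_def sum_distrib_left mult_ac)

lemma root_interp_sum: "root_interp m (\<lambda>z. \<Sum>i\<in>I. f i z) w = (\<Sum>i\<in>I. root_interp m (f i) w)"
proof (induction I rule: infinite_finite_induct)
  case (insert i I)
  then show ?case by (simp add: root_interp_add)
qed (simp_all add: root_interp_def)

lemma sum_roots_unity:
  assumes "i < m" "k < m"
  shows "(\<Sum>l<m. cis (2 * pi * real l / m) ^ i * cis (- 2 * pi * real k * real l / m)) = (if i = k then of_nat m else 0)"
proof -
  have m: "m > 0" using assms by simp
  define x where "x = cis (2 * pi * (real i - real k) / m)"
  have eq: "cis (2 * pi * real l / m) ^ i * cis (- 2 * pi * real k * real l / m) = x ^ l" for l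
    unfolding x_def Complex.DeMoivre cis_mult
    by (rule arg_cong[where f=cis])
      (use m in \<open>simp add: divide_simps, simp add: algebra_simps\<close>)
  show ?thesis
  proof (cases "i = k")
    case True
    then show ?thesis unfolding eq by (simp add: x_def)
  next
    case False
    have xm: "x ^ m = 1"
    proof -
      have "x ^ m = cis (2 * pi * real i) * cis (- (2 * pi * real k))"
        unfolding x_def Complex.DeMoivre cis_mult using m by (intro arg_cong[where f=cis]) (simp add: field_simps)
      also have "\<dots> = 1"
        using cis_multiple_2pi[of "real i"] cis_multiple_2pi[of "- real k"] by (simp add: Ints_minus)
      finally show ?thesis .
    qed
    have x1: "x \<noteq> 1"
    proof
      assume "x = 1"
      then have "cis (2 * pi * real i / m) = cis (2 * pi * real k / m)"
        unfolding x_def by (metis cis_divide cis_neq_zero diff_divide_distrib divide_eq_1_iff right_diff_distrib)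
      with Complex.bij_betw_roots_unity[OF m] assms have "i = k"
        by (auto simp: bij_betw_def inj_on_def)
      with False show False by simp
    qed
    show ?thesis unfolding eq using False x1 xm by (simp add: geometric_sum)
  qed
qed

lemma root_interp_power:
  assumes "i < m"
  shows "root_interp m (\<lambda>z. z ^ i) w = w ^ i"
proof -
  have "root_interp m (\<lambda>z. z ^ i) w = (\<Sum>k<m. if i = k then w ^ k else 0)"
    unfolding root_interp_def
    by (intro sum.cong refl, subst sum_roots_unity) (use assms in auto)
  then show ?thesis using assms by simp
qed

text \<open>Each of the m coefficients is an average of values of f, hence at most B. The loss of a
  factor m is harmless because the bound is applied to a geometrically small remainder.\<close>

lemma root_interp_bound:
  assumes "\<And>z. norm z \<le> 1 \<Longrightarrow> norm (f z) \<le> B" and "norm w \<le> 1" and "B \<ge> 0"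
  shows "norm (root_interp m f w) \<le> m * B"
proof -
  have "norm (root_interp m f w) \<le> (\<Sum>k<m. B)"
    unfolding root_interp_def
  proof (rule sum_norm_le)
    fix k assume "k \<in> {..<m}"
    then have m: "m > 0" by auto
    have "norm (\<Sum>l<m. f (cis (2 * pi * real l / real m)) * cis (- 2 * pi * real k * real l / real m)) \<le> (\<Sum>l<m. B)"
      by (rule sum_norm_le) (use assms in \<open>auto simp: norm_mult\<close>)
    then have "norm (\<Sum>l<m. f (cis (2 * pi * real l / real m)) * cis (- 2 * pi * real k * real l / real m)) / m \<le> B"
      using m by (simp add: field_simps)
    moreover have "norm w ^ k \<le> 1" using assms by (simp add: power_le_one)
    ultimately have "norm w ^ k * (norm (\<Sum>l<m. f (cis (2 * pi * real l / real m)) * cis (- 2 * pi * real k * real l / real m)) / m) \<le> 1 * B"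
      by (intro mult_mono) auto
    then show "norm (w ^ k * (\<Sum>l<m. f (cis (2 * pi * real l / real m)) * cis (- 2 * pi * real k * real l / real m)) / m) \<le> B"
      by (simp add: norm_mult norm_divide norm_power)
  qed
  then show ?thesis by simp
qed

text \<open>Interpolation reproduces the Taylor polynomial T of degree below m exactly, so the error
  comes from the remainder E alone: E itself plus its interpolant, which is where the factor m + 1
  arises. Cauchy's estimates on the circle of radius \<rho> bound E on the unit disc by the
  geometric tail \<tau>.\<close>

lemma root_interp_error:
  fixes f :: "complex \<Rightarrow> complex"
  assumes hol: "f holomorphic_on ball 0 R" and bd: "\<And>z. z \<in> ball 0 R \<Longrightarrow> norm (f z) \<le> B"
    and \<rho>: "1 < \<rho>" "\<rho> < R" and w: "norm w \<le> 1"
  shows "norm (f w - root_interp m f w) \<le> (real m + 1) * (B / (1 - 1 / \<rho>) * (1 / \<rho>) ^ m)"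
proof -
  define c where "c n = (deriv ^^ n) f 0 / fact n" for n
  define T where "T z = (\<Sum>i<m. c i * z ^ i)" for z
  define E where "E z = f z - T z" for z
  define \<tau> where "\<tau> = B / (1 - 1 / \<rho>) * (1 / \<rho>) ^ m"
  have "norm (f 0) \<le> B" using bd \<rho> by simp
  then have B: "B \<ge> 0" by (rule order_trans[OF norm_ge_zero])
  have \<tau>0: "\<tau> \<ge> 0" unfolding \<tau>_def using B \<rho> by auto
  have cn: "norm (c n) \<le> B * (1 / \<rho>) ^ n" for n
  proof -
    have "norm ((deriv ^^ n) f 0) \<le> fact n * B / \<rho> ^ n"
    proof (rule Cauchy_inequality)
      show "f holomorphic_on ball 0 \<rho>" by (rule holomorphic_on_subset[OF hol]) (use \<rho> in auto)
      show "continuous_on (cball 0 \<rho>) f"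
        by (rule continuous_on_subset[OF holomorphic_on_imp_continuous_on[OF hol]]) (use \<rho> in auto)
    qed (use \<rho> bd in auto)
    then show ?thesis by (simp add: c_def norm_divide field_simps)
  qed
  have Ebd: "norm (E z) \<le> \<tau>" if z: "norm z \<le> 1" for z
  proof -
    have "(\<lambda>n. c n * z ^ n) sums f z"
      using holomorphic_power_series[OF hol, of z] z \<rho> by (simp add: c_def)
    from sums_split_initial_segment[OF this, of m]
    have s: "(\<lambda>n. c (n + m) * z ^ (n + m)) sums E z" by (simp add: E_def T_def)
    have geo: "(\<lambda>n. (B * (1 / \<rho>) ^ m) * (1 / \<rho>) ^ n) sums (B * (1 / \<rho>) ^ m * (1 / (1 - 1 / \<rho>)))"
      by (intro sums_mult geometric_sums) (use \<rho> in auto)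
    have "norm (c (n + m) * z ^ (n + m)) \<le> (B * (1 / \<rho>) ^ m) * (1 / \<rho>) ^ n" for n
    proof -
      have "norm (c (n + m) * z ^ (n + m)) \<le> (B * (1 / \<rho>) ^ (n + m)) * 1"
        unfolding norm_mult norm_power using z B \<rho>
        by (intro mult_mono cn power_le_one) auto
      then show ?thesis by (simp add: power_add mult_ac)
    qed
    then have "norm (\<Sum>n. c (n + m) * z ^ (n + m)) \<le> (\<Sum>n. (B * (1 / \<rho>) ^ m) * (1 / \<rho>) ^ n)"
      using geo by (intro norm_suminf_le) (auto simp: sums_iff)
    then show ?thesis using s geo by (simp add: sums_iff \<tau>_def)
  qed
  have "root_interp m f w = root_interp m (\<lambda>z. T z + E z) w" by (simp add: E_def)
  also have "\<dots> = T w + root_interp m E w"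
    unfolding root_interp_add by (simp add: T_def root_interp_sum root_interp_cmult root_interp_power)
  finally have "f w - root_interp m f w = E w - root_interp m E w" by (simp add: E_def)
  also have "norm \<dots> \<le> \<tau> + m * \<tau>"
    using norm_triangle_ineq4[of "E w" "root_interp m E w"] Ebd[OF w]
      root_interp_bound[of E \<tau> w m, OF Ebd w \<tau>0] by linarith
  finally show ?thesis unfolding \<tau>_def[symmetric] by (simp add: algebra_simps)
qed

text \<open>Polynomial functions on \<complex>^n. Generation by sums and multiplication by a single
  coordinate turns each later closure proof into a three-case induction without
  multi-indices.\<close>

inductive_set mpoly_fun :: "(('n \<Rightarrow> complex) \<Rightarrow> complex) set" where
  const: "(\<lambda>_. c) \<in> mpoly_fun"
| add: "P \<in> mpoly_fun \<Longrightarrow> Q \<in> mpoly_fun \<Longrightarrow> (\<lambda>w. P w + Q w) \<in> mpoly_fun"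
| coord: "P \<in> mpoly_fun \<Longrightarrow> (\<lambda>w. w j * P w) \<in> mpoly_fun"

lemma mpoly_fun_cmult: "P \<in> mpoly_fun \<Longrightarrow> (\<lambda>w. c * P w) \<in> mpoly_fun"
proof (induction rule: mpoly_fun.induct)
  case (const d)
  show ?case by (rule mpoly_fun.const)
next
  case (add P Q)
  then show ?case by (simp add: distrib_left mpoly_fun.add)
next
  case (coord P j)
  then show ?case using mpoly_fun.coord[of "\<lambda>w. c * P w" j] by (simp add: mult_ac)
qed

lemma mpoly_fun_sum: "(\<And>i. i \<in> I \<Longrightarrow> P i \<in> mpoly_fun) \<Longrightarrow> (\<lambda>w. \<Sum>i\<in>I. P i w) \<in> mpoly_fun"
  by (induction I rule: infinite_finite_induct) (auto intro: mpoly_fun.intros)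

lemma mpoly_fun_power: "P \<in> mpoly_fun \<Longrightarrow> (\<lambda>w. w j ^ k * P w) \<in> mpoly_fun"
proof (induction k)
  case (Suc k)
  then show ?case using mpoly_fun.coord[of "\<lambda>w. w j ^ k * P w" j] by (simp add: mult_ac)
qed simp

text \<open>The interpolation formula in coordinate j, with the nodal values replaced by polynomials
  \<open>P l\<close> and the roots of unity by arbitrary numbers \<open>d k l\<close>.\<close>

lemma mpoly_fun_root_interp:
  assumes "\<And>l. l < m \<Longrightarrow> P l \<in> mpoly_fun"
  shows "(\<lambda>w. \<Sum>k<m. w j ^ k * (\<Sum>l<m. P l w * d k l) / m) \<in> mpoly_fun"
proof (rule mpoly_fun_sum)
  fix k assume "k \<in> {..<m}"
  have "(\<lambda>w. \<Sum>l<m. d k l / m * P l w) \<in> mpoly_fun"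
    by (intro mpoly_fun_sum mpoly_fun_cmult assms) auto
  from mpoly_fun_power[OF this, of j k]
  have "(\<lambda>w. w j ^ k * (\<Sum>l<m. P l w * d k l / m)) \<in> mpoly_fun" by (simp add: mult_ac)
  then show "(\<lambda>w. w j ^ k * (\<Sum>l<m. P l w * d k l) / m) \<in> mpoly_fun"
    by (simp add: sum_divide_distrib sum_distrib_left)
qed

text \<open>Induction on the set J of coordinates on which h depends. Interpolating in coordinate j
  leaves m nodal functions that depend on the remaining coordinates. The nodes lie on the unit
  circle, inside radius R, so these functions are again separately holomorphic with the same bound B
  and the induction hypothesis applies to them.\<close>

lemma polydisc_approx_aux:
  fixes h :: "('n \<Rightarrow> complex) \<Rightarrow> complex"
  assumes "finite J" and R: "1 < R"
    and "\<And>w j. (\<And>i. norm (w i) < R) \<Longrightarrow> (\<lambda>t. h (w(j := t))) holomorphic_on ball 0 R"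
    and "\<And>w. (\<And>i. norm (w i) < R) \<Longrightarrow> norm (h w) \<le> B"
    and "\<And>w w'. (\<And>i. i \<in> J \<Longrightarrow> w i = w' i) \<Longrightarrow> h w = h w'"
    and "\<epsilon> > 0"
  shows "\<exists>P\<in>mpoly_fun. \<forall>w. (\<forall>i. norm (w i) \<le> 1) \<longrightarrow> norm (h w - P w) \<le> \<epsilon>"
  using assms(1,3-)
proof (induction J arbitrary: h \<epsilon> rule: finite_induct)
  case empty
  have "h w = h (\<lambda>_. 0)" for w by (rule empty.prems(3)) auto
  then have "norm (h w - h (\<lambda>_. 0)) \<le> \<epsilon>" for w using \<open>\<epsilon> > 0\<close> by (metis diff_self norm_zero less_imp_le)
  then show ?case by (intro bexI[of _ "\<lambda>_. h (\<lambda>_. 0)"] mpoly_fun.const) auto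
next
  case (insert j J)
  obtain \<rho> where \<rho>: "1 < \<rho>" "\<rho> < R" using dense[OF R] by blast
  have "(\<lambda>m. (real m + 1) * (B / (1 - 1 / \<rho>) * (1 / \<rho>) ^ m)) \<longlonglongrightarrow> 0"
  proof -
    have "norm (1 / \<rho>) < 1" using \<rho> by simp
    from tendsto_add[OF powser_times_n_limit_0[OF this] LIMSEQ_power_zero[OF this]]
    have "(\<lambda>m. real m * (1 / \<rho>) ^ m + (1 / \<rho>) ^ m) \<longlonglongrightarrow> 0" by simp
    from tendsto_mult_left[OF this, of "B / (1 - 1 / \<rho>)"] show ?thesis by (simp add: algebra_simps add_divide_distrib)
  qed
  then have "\<forall>\<^sub>F m in sequentially. (real m + 1) * (B / (1 - 1 / \<rho>) * (1 / \<rho>) ^ m) < \<epsilon> / 2"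
    by (rule order_tendstoD) (use insert.prems(4) in auto)
  then obtain M where M: "\<And>m. m \<ge> M \<Longrightarrow> (real m + 1) * (B / (1 - 1 / \<rho>) * (1 / \<rho>) ^ m) < \<epsilon> / 2"
    by (auto simp: eventually_sequentially)
  \<comment> \<open>The successor guarantees at least one node, so that division by m is
    legitimate.\<close>
  define m where "m = Suc M"
  have m: "m > 0" "(real m + 1) * (B / (1 - 1 / \<rho>) * (1 / \<rho>) ^ m) < \<epsilon> / 2"
    using M[of m] by (auto simp: m_def)
  define z where "z l = cis (2 * pi * real l / m)" for l
  \<comment> \<open>Replacing nodal values costs up to m times their error, hence the tolerance
    \<epsilon> / (2 * m); the other half of \<epsilon> pays for interpolation.\<close>
  have "\<exists>P\<in>mpoly_fun. \<forall>w. (\<forall>i. norm (w i) \<le> 1) \<longrightarrow> norm (h (w(j := z l)) - P w) \<le> \<epsilon> / (2 * m)" for l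
  proof (rule insert.IH)
    have upd: "norm ((w(j := z l)) i) < R" if "\<And>i. norm (w i) < R" for w i
      using that R by (simp add: z_def)
    fix w :: "'n \<Rightarrow> complex" assume w: "\<And>i. norm (w i) < R"
    show "norm (h (w(j := z l))) \<le> B" by (rule insert.prems(2)[OF upd]) (use w in auto)
    show "(\<lambda>t. h (w(i := t, j := z l))) holomorphic_on ball 0 R" for i
    proof (cases "i = j")
      case False
      then have eq: "(\<lambda>t. h (w(i := t, j := z l))) = (\<lambda>t. h ((w(j := z l))(i := t)))"
        by (simp add: fun_upd_twist)
      show ?thesis unfolding eq by (rule insert.prems(1), rule upd, rule w)
    qed auto
  next
    fix w w' :: "'n \<Rightarrow> complex" assume "\<And>i. i \<in> J \<Longrightarrow> w i = w' i"
    then show "h (w(j := z l)) = h (w'(j := z l))" by (intro insert.prems(3)) auto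
  qed (use insert.prems(4) m in auto)
  then obtain P where P: "\<And>l. P l \<in> mpoly_fun"
    "\<And>l w. (\<And>i. norm (w i) \<le> 1) \<Longrightarrow> norm (h (w(j := z l)) - P l w) \<le> \<epsilon> / (2 * m)"
    by metis
  define Q where "Q w = (\<Sum>k<m. w j ^ k * (\<Sum>l<m. P l w * cis (- 2 * pi * real k * real l / real m)) / m)" for w
  have "norm (h w - Q w) \<le> \<epsilon>" if w: "\<And>i. norm (w i) \<le> 1" for w
  proof -
    define f where "f t = h (w(j := t))" for t
    have wR: "norm (w i) < R" for i using w[of i] R by linarith
    have hol: "f holomorphic_on ball 0 R" unfolding f_def by (rule insert.prems(1)) (rule wR)
    have bd: "norm (f t) \<le> B" if "t \<in> ball 0 R" for t
      unfolding f_def by (rule insert.prems(2)) (use wR that in auto)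
    have e1: "norm (f (w j) - root_interp m f (w j)) < \<epsilon> / 2"
      by (rule le_less_trans[OF root_interp_error[OF hol bd \<rho> w] m(2)])
    have "root_interp m f (w j) - Q w
        = (\<Sum>k<m. w j ^ k * (\<Sum>l<m. (f (z l) - P l w) * cis (- 2 * pi * real k * real l / real m)) / m)"
      unfolding root_interp_def Q_def z_def
      by (simp add: sum_subtractf left_diff_distrib right_diff_distrib diff_divide_distrib)
    also have "norm \<dots> \<le> (\<Sum>k<m. \<epsilon> / (2 * m))"
    proof (rule sum_norm_le)
      fix k
      have "norm (\<Sum>l<m. (f (z l) - P l w) * cis (- 2 * pi * real k * real l / real m)) \<le> (\<Sum>l<m. \<epsilon> / (2 * m))"
        by (rule sum_norm_le) (use P(2)[OF w] in \<open>simp add: norm_mult f_def\<close>)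
      then have "norm (\<Sum>l<m. (f (z l) - P l w) * cis (- 2 * pi * real k * real l / real m)) / m \<le> \<epsilon> / (2 * m)"
        using m by (simp add: divide_simps mult_ac)
      moreover have "norm (w j) ^ k \<le> 1" using w by (simp add: power_le_one)
      ultimately have "norm (w j) ^ k * (norm (\<Sum>l<m. (f (z l) - P l w) * cis (- 2 * pi * real k * real l / real m)) / m)
          \<le> 1 * (\<epsilon> / (2 * m))"
        by (intro mult_mono) auto
      then show "norm (w j ^ k * (\<Sum>l<m. (f (z l) - P l w) * cis (- 2 * pi * real k * real l / real m)) / m) \<le> \<epsilon> / (2 * m)"
        by (simp add: norm_mult norm_divide norm_power)
    qed
    also have "\<dots> = \<epsilon> / 2" using m by simp
    finally have "norm ((f (w j) - root_interp m f (w j)) + (root_interp m f (w j) - Q w)) \<le> \<epsilon>"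
      using e1 norm_triangle_ineq[of "f (w j) - root_interp m f (w j)" "root_interp m f (w j) - Q w"] by linarith
    then show ?thesis by (simp add: f_def)
  qed
  moreover have "Q \<in> mpoly_fun" unfolding Q_def by (rule mpoly_fun_root_interp) (rule P)
  ultimately show ?case by blast
qed

lemma polydisc_approx:
  fixes h :: "('n :: finite \<Rightarrow> complex) \<Rightarrow> complex"
  assumes R: "1 < R"
    and "\<And>w j. (\<And>i. norm (w i) < R) \<Longrightarrow> (\<lambda>t. h (w(j := t))) holomorphic_on ball 0 R"
    and "\<And>w. (\<And>i. norm (w i) < R) \<Longrightarrow> norm (h w) \<le> B"
    and "\<epsilon> > 0"
  obtains P where "P \<in> mpoly_fun" "\<And>w. (\<And>i. norm (w i) \<le> 1) \<Longrightarrow> norm (h w - P w) \<le> \<epsilon>"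
proof -
  have "h w = h w'" if "\<And>i. i \<in> UNIV \<Longrightarrow> w i = w' i" for w w'
    using that by (intro arg_cong[where f=h]) auto
  then show ?thesis
    using polydisc_approx_aux[OF finite[of UNIV] assms(1-3) _ assms(4)] that by blast
qed

section \<open>Mean value inequalities on the tube\<close>

lemma tube_pt_in_tube_dom: "tube_pt x y \<in> tube_dom \<longleftrightarrow> y \<in> Gamma_cone"
  by (simp add: tube_pt_def tube_dom_def Gamma_cone_def)

lemma open_Gamma_cone: "open (Gamma_cone :: (real^'n) set)"
proof -
  have eq: "Gamma_cone = (\<Inter>j\<in>UNIV. {y :: real^'n. 0 < y $ j})" by (auto simp: Gamma_cone_def)
  show ?thesis
    unfolding eq by (intro open_INT ballI open_Collect_less continuous_intros) simp
qed

lemma continuous_on_tube_pt [continuous_intros]: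
  fixes f g :: "'a :: topological_space \<Rightarrow> real^'n"
  assumes "continuous_on S f" "continuous_on S g"
  shows "continuous_on S (\<lambda>x. tube_pt (f x) (g x))"
  unfolding tube_pt_def Complex_eq by (intro continuous_intros assms)

lemma holo_on_imp_continuous_on:
  assumes "holo_on F S"
  shows "continuous_on S F"
proof (rule continuous_at_imp_continuous_on, rule ballI)
  fix z assume "z \<in> S"
  then obtain L where "(F has_derivative L) (at z)" using assms unfolding holo_on_def by blast
  then show "isCont F z" by (rule has_derivative_continuous)
qed

lemma bounded_linear_smult_vec: "bounded_linear (\<lambda>l. l *s (w :: complex^'n))"
  unfolding linear_conv_bounded_linear[symmetric]
  by (rule linearI) (simp_all add: vec_eq_iff algebra_simps)

text \<open>Complex linearity of the derivative L reduces it, along a complex line, to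
  multiplication by the number \<open>L w\<close>.\<close>

lemma holo_on_line:
  fixes F :: "complex^'n \<Rightarrow> complex"
  assumes F: "holo_on F S" and sub: "\<And>l. l \<in> A \<Longrightarrow> z + l *s w \<in> S"
  shows "(\<lambda>l. F (z + l *s w)) holomorphic_on A"
  unfolding holomorphic_on_def field_differentiable_def
proof
  fix l assume "l \<in> A"
  then obtain L where L: "(F has_derivative L) (at (z + l *s w))" "\<And>c v. L (c *s v) = c * L v"
    using F sub unfolding holo_on_def by blast
  have "((\<lambda>l. z + l *s w) has_derivative (\<lambda>h. h *s w)) (at l within A)"
    using has_derivative_add[OF has_derivative_const
      bounded_linear_imp_has_derivative[OF bounded_linear_smult_vec]] by force
  from has_derivative_compose[OF this L(1)]
  have "((\<lambda>l. F (z + l *s w)) has_derivative (\<lambda>h. h * L w)) (at l within A)"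
    by (simp add: L(2))
  then have "((\<lambda>l. F (z + l *s w)) has_field_derivative L w) (at l within A)"
    by (simp add: has_field_derivative_def mult_commute_abs)
  then show "\<exists>f'. ((\<lambda>l. F (z + l *s w)) has_field_derivative f') (at l within A)" ..
qed

text \<open>Nothing is known about F off the tube; the cut-off by \<open>Gamma_cone\<close> yields a
  Borel function on the whole real product space, on which translations and rotations act and Fubini
  can be used freely.\<close>

definition hp_density :: "real \<Rightarrow> (complex^'n \<Rightarrow> complex) \<Rightarrow> (real^'n) \<times> (real^'n) \<Rightarrow> ennreal" where
  "hp_density q F = (\<lambda>(x, y). indicator Gamma_cone y * ennreal (norm (F (tube_pt x y)) powr q))"

definition hp_int :: "real \<Rightarrow> (complex^'n \<Rightarrow> complex) \<Rightarrow> real^'n \<Rightarrow> ennreal" where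
  "hp_int q F y = (\<integral>\<^sup>+ x. ennreal (norm (F (tube_pt x y)) powr q) \<partial>lborel)"

lemma Hp_pow_eq: "Hp_pow q F = (SUP y\<in>Gamma_cone. hp_int q F y)"
  by (simp add: Hp_pow_def hp_int_def)

lemma hp_int_le_Hp_pow: "y \<in> Gamma_cone \<Longrightarrow> hp_int q F y \<le> Hp_pow q F"
  unfolding Hp_pow_eq by (rule SUP_upper)

lemma borel_measurable_hp_density [measurable]:
  assumes F: "holo_on F tube_dom"
  shows "hp_density q F \<in> borel_measurable borel"
proof -
  have "(UNIV :: (real^'n) set) \<times> Gamma_cone \<in> sets borel"
    by (intro borel_open open_Times open_UNIV open_Gamma_cone)
  moreover have "continuous_on (UNIV \<times> Gamma_cone) (\<lambda>p. F (tube_pt (fst p) (snd p)))"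
    by (rule continuous_on_compose2[OF holo_on_imp_continuous_on[OF F]])
      (auto intro!: continuous_intros simp: tube_pt_in_tube_dom)
  ultimately have "(\<lambda>p. indicator (UNIV \<times> Gamma_cone) p *\<^sub>R F (tube_pt (fst p) (snd p))) \<in> borel_measurable borel"
    by (rule borel_measurable_continuous_on_indicator)
  then have "(\<lambda>p. ennreal (norm (indicator (UNIV \<times> Gamma_cone) p *\<^sub>R F (tube_pt (fst p) (snd p))) powr q))
      \<in> borel_measurable borel"
    by measurable
  also have "(\<lambda>p. ennreal (norm (indicator (UNIV \<times> Gamma_cone) p *\<^sub>R F (tube_pt (fst p) (snd p))) powr q))
     = hp_density q F"
    by (auto simp: hp_density_def fun_eq_iff indicator_def)
  finally show ?thesis .
qed

lemma borel_measurable_slice: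
  assumes F: "holo_on F tube_dom" and y: "y \<in> Gamma_cone"
  shows "(\<lambda>x. F (tube_pt x y)) \<in> borel_measurable borel"
  by (intro borel_measurable_continuous_onI continuous_on_compose2[OF holo_on_imp_continuous_on[OF F]])
     (use y in \<open>auto intro!: continuous_intros simp: tube_pt_in_tube_dom\<close>)

lemma hp_int_eq_density: "y \<in> Gamma_cone \<Longrightarrow> hp_int q F y = (\<integral>\<^sup>+ x. hp_density q F (x, y) \<partial>lborel)"
  by (simp add: hp_int_def hp_density_def)

lemma tube_pt_circle:
  "tube_pt x y + cis \<theta> *s tube_pt u v
    = tube_pt (x + (cos \<theta> *\<^sub>R u - sin \<theta> *\<^sub>R v)) (y + (sin \<theta> *\<^sub>R u + cos \<theta> *\<^sub>R v))"
  by (simp add: vec_eq_iff tube_pt_def complex_eq_iff algebra_simps)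

text \<open>Multiplication of u + iv by exp (2 pi i t), in all coordinates at once, written on pairs
  of real vectors.\<close>

definition rot :: "real \<Rightarrow> 'a::real_vector \<times> 'a \<Rightarrow> 'a \<times> 'a" where
  "rot t = (\<lambda>(u, v). (cos (2 * pi * t) *\<^sub>R u - sin (2 * pi * t) *\<^sub>R v,
                      sin (2 * pi * t) *\<^sub>R u + cos (2 * pi * t) *\<^sub>R v))"

lemma continuous_rot:
  "continuous_on UNIV (\<lambda>(t, p :: 'a \<times> 'a :: real_normed_vector). rot t p)"
  unfolding rot_def split_def by (intro continuous_intros)

text \<open>F is restricted to the complex line through x + iy in the direction u + iv. Since |Im (l
  (u_j + i v_j))| is at most |l| (|u_j| + |v_j|), the strict hypothesis leaves room for a disc of
  some radius R > 1 in the tube; one R serves all of the finitely many coordinates.\<close>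

lemma hp_density_circle_submean:
  fixes F :: "complex^'n \<Rightarrow> complex"
  assumes F: "holo_on F tube_dom" and q: "q > 0"
    and uv: "\<And>j. \<bar>u $ j\<bar> + \<bar>v $ j\<bar> < y $ j"
  shows "hp_density q F (x, y) \<le> (\<integral>\<^sup>+ t. indicator {0..1} t * hp_density q F ((x, y) + rot t (u, v)) \<partial>lborel)"
proof -
  define c where "c j = \<bar>u $ j\<bar> + \<bar>v $ j\<bar>" for j
  have "\<forall>\<^sub>F R in at_right 1. R * c j < y $ j" for j
  proof -
    have "((\<lambda>R. R * c j) \<longlongrightarrow> 1 * c j) (at_right 1)" by (intro tendsto_intros)
    then show ?thesis by (rule order_tendstoD) (use uv in \<open>simp add: c_def\<close>)
  qed
  then have "\<forall>\<^sub>F R in at_right 1. \<forall>j. R * c j < y $ j" by (simp add: eventually_all_finite)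
  moreover have "\<forall>\<^sub>F R in at_right (1::real). R > 1" by (simp add: eventually_at_right_less)
  ultimately have "\<forall>\<^sub>F R in at_right (1::real). R > 1 \<and> (\<forall>j. R * c j < y $ j)" by eventually_elim auto
  then obtain R where R: "R > 1" "\<And>j. R * c j < y $ j"
    using eventually_happens[of _ "at_right (1::real)"] by auto
  have in_dom: "tube_pt x y + l *s tube_pt u v \<in> tube_dom" if "l \<in> ball 0 R" for l
  proof -
    have "0 < y $ j + Im (l * Complex (u $ j) (v $ j))" for j
    proof -
      have "\<bar>Im (l * Complex (u $ j) (v $ j))\<bar> \<le> norm l * norm (Complex (u $ j) (v $ j))"
        using abs_Im_le_cmod norm_mult by metis
      also have "\<dots> \<le> R * c j"
        using that cmod_le[of "Complex (u $ j) (v $ j)"] R(1)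
        by (intro mult_mono) (auto simp: c_def)
      finally show ?thesis using R(2)[of j] by linarith
    qed
    then show ?thesis by (simp add: tube_dom_def tube_pt_def del: times_complex.sel)
  qed
  have y: "y \<in> Gamma_cone" using in_dom[of 0] R by (simp add: tube_pt_in_tube_dom)
  define f where "f l = F (tube_pt x y + l *s tube_pt u v)" for l
  have "f holomorphic_on ball 0 R" unfolding f_def by (rule holo_on_line[OF F in_dom])
  note submean = submean_holomorphic_nn[OF this R(1) q]
  have "ennreal (norm (f (cis (2 * pi * t))) powr q) = hp_density q F ((x, y) + rot t (u, v))" for t
  proof -
    have "tube_pt x y + cis (2 * pi * t) *s tube_pt u v \<in> tube_dom" using R by (intro in_dom) auto
    then show ?thesis
      unfolding f_def tube_pt_circle tube_pt_in_tube_dom by (simp add: hp_density_def rot_def)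
  qed
  moreover have "ennreal (norm (f 0) powr q) = hp_density q F (x, y)"
    using y by (simp add: f_def hp_density_def)
  ultimately show ?thesis using submean by simp
qed

section \<open>Invariance of Lebesgue integrals under translations, shears and rotations\<close>

lemma nn_integral_lborel_shift:
  fixes f :: "'a::euclidean_space \<Rightarrow> ennreal"
  assumes "f \<in> borel_measurable borel"
  shows "(\<integral>\<^sup>+ x. f (a + x) \<partial>lborel) = (\<integral>\<^sup>+ x. f x \<partial>lborel)"
proof -
  have "(\<integral>\<^sup>+ x. f x \<partial>lborel) = (\<integral>\<^sup>+ x. f x \<partial>distr lborel borel ((+) a))"
    by (simp add: lborel_distr_plus)
  also have "\<dots> = (\<integral>\<^sup>+ x. f (a + x) \<partial>lborel)"
    using assms by (subst nn_integral_distr) auto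
  finally show ?thesis by simp
qed

lemma nn_integral_lborel_pair_fst:
  fixes f :: "'a::euclidean_space \<times> 'b::euclidean_space \<Rightarrow> ennreal"
  assumes "f \<in> borel_measurable borel"
  shows "(\<integral>\<^sup>+ x. (\<integral>\<^sup>+ y. f (x, y) \<partial>lborel) \<partial>lborel) = (\<integral>\<^sup>+ p. f p \<partial>lborel)"
  using assms lborel.nn_integral_fst[of f lborel] by (simp add: lborel_prod)

lemma nn_integral_lborel_pair_snd:
  fixes f :: "'a::euclidean_space \<times> 'b::euclidean_space \<Rightarrow> ennreal"
  assumes "f \<in> borel_measurable borel"
  shows "(\<integral>\<^sup>+ y. (\<integral>\<^sup>+ x. f (x, y) \<partial>lborel) \<partial>lborel) = (\<integral>\<^sup>+ p. f p \<partial>lborel)"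
  using assms lborel_pair.nn_integral_snd[of f] by (simp add: lborel_prod)

lemma nn_integral_lborel_Fubini:
  fixes f :: "'a::euclidean_space \<times> 'b::euclidean_space \<Rightarrow> ennreal"
  assumes "f \<in> borel_measurable borel"
  shows "(\<integral>\<^sup>+ x. (\<integral>\<^sup>+ y. f (x, y) \<partial>lborel) \<partial>lborel) = (\<integral>\<^sup>+ y. (\<integral>\<^sup>+ x. f (x, y) \<partial>lborel) \<partial>lborel)"
  using assms by (simp add: nn_integral_lborel_pair_fst nn_integral_lborel_pair_snd)

lemma nn_integral_shear_fst:
  fixes f :: "'a::euclidean_space \<times> 'a \<Rightarrow> ennreal"
  assumes f [measurable]: "f \<in> borel_measurable borel"
  shows "(\<integral>\<^sup>+ p. f (fst p + a *\<^sub>R snd p, snd p) \<partial>lborel) = (\<integral>\<^sup>+ p. f p \<partial>lborel)"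
proof -
  have 1: "(\<lambda>p. f (fst p + a *\<^sub>R snd p, snd p)) \<in> borel_measurable borel"
    by (rule measurable_compose[OF _ f], rule borel_measurable_continuous_onI) (intro continuous_intros)
  have 2: "(\<lambda>x. f (x, y)) \<in> borel_measurable borel" for y
    by (rule measurable_compose[OF _ f], rule borel_measurable_continuous_onI) (intro continuous_intros)
  show ?thesis
    unfolding nn_integral_lborel_pair_snd[OF 1, symmetric] nn_integral_lborel_pair_snd[OF f, symmetric] fst_conv snd_conv
    by (subst add.commute, subst nn_integral_lborel_shift[OF 2]) simp
qed

lemma nn_integral_shear_snd:
  fixes f :: "'a::euclidean_space \<times> 'a \<Rightarrow> ennreal"
  assumes f [measurable]: "f \<in> borel_measurable borel"
  shows "(\<integral>\<^sup>+ p. f (fst p, snd p + a *\<^sub>R fst p) \<partial>lborel) = (\<integral>\<^sup>+ p. f p \<partial>lborel)"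
proof -
  have 1: "(\<lambda>p. f (fst p, snd p + a *\<^sub>R fst p)) \<in> borel_measurable borel"
    by (rule measurable_compose[OF _ f], rule borel_measurable_continuous_onI) (intro continuous_intros)
  have 2: "(\<lambda>y. f (x, y)) \<in> borel_measurable borel" for x
    by (rule measurable_compose[OF _ f], rule borel_measurable_continuous_onI) (intro continuous_intros)
  show ?thesis
    unfolding nn_integral_lborel_pair_fst[OF 1, symmetric] nn_integral_lborel_pair_fst[OF f, symmetric] fst_conv snd_conv
    by (subst add.commute, subst nn_integral_lborel_shift[OF 2]) simp
qed

text \<open>A rotation other than the half turn is a product of three shears.\<close>

lemma nn_integral_rotation_aux:
  fixes f :: "'a::euclidean_space \<times> 'a \<Rightarrow> ennreal"
  assumes f: "f \<in> borel_measurable borel" and cs: "c\<^sup>2 + s\<^sup>2 = (1::real)" and c: "c \<noteq> -1"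
  shows "(\<integral>\<^sup>+ p. f (c *\<^sub>R fst p - s *\<^sub>R snd p, s *\<^sub>R fst p + c *\<^sub>R snd p) \<partial>lborel) = (\<integral>\<^sup>+ p. f p \<partial>lborel)"
proof -
  \<comment> \<open>The tangent of half the rotation angle, the parameter of the two outer shears;
    it is undefined exactly at the half turn.\<close>
  define a where "a = s / (1 + c)"
  have "1 + c \<noteq> 0" using c by linarith
  then have as: "a * (1 + c) = s" by (simp add: a_def)
  then have "a * s * (1 + c) = s\<^sup>2" by (simp add: power2_eq_square)
  also have "\<dots> = (1 - c) * (1 + c)" using cs by (simp add: algebra_simps power2_eq_square)
  finally have as2: "a * s = 1 - c" using \<open>1 + c \<noteq> 0\<close> by simp
  define f1 where "f1 p = f (fst p + (- a) *\<^sub>R snd p, snd p)" for p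
  define f2 where "f2 p = f1 (fst p, snd p + s *\<^sub>R fst p)" for p
  have f1: "f1 \<in> borel_measurable borel" unfolding f1_def
    by (rule measurable_compose[OF _ f], rule borel_measurable_continuous_onI) (intro continuous_intros)
  have f2: "f2 \<in> borel_measurable borel" unfolding f2_def
    by (rule measurable_compose[OF _ f1], rule borel_measurable_continuous_onI) (intro continuous_intros)
  have "f (c *\<^sub>R u - s *\<^sub>R v, s *\<^sub>R u + c *\<^sub>R v) = f2 (u + (- a) *\<^sub>R v, v)" for u v
  proof -
    have e1: "v + s *\<^sub>R (u + (- a) *\<^sub>R v) = s *\<^sub>R u + (1 - a * s) *\<^sub>R v"
      by (simp add: algebra_simps)
    have "(u + (- a) *\<^sub>R v) + (- a) *\<^sub>R (s *\<^sub>R u + c *\<^sub>R v) = (1 - a * s) *\<^sub>R u - (a * (1 + c)) *\<^sub>R v"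
      by (simp add: algebra_simps)
    then show ?thesis unfolding f2_def f1_def fst_conv snd_conv e1 as2 as by simp
  qed
  then have "(\<integral>\<^sup>+ p. f (c *\<^sub>R fst p - s *\<^sub>R snd p, s *\<^sub>R fst p + c *\<^sub>R snd p) \<partial>lborel)
      = (\<integral>\<^sup>+ p. f2 (fst p + (- a) *\<^sub>R snd p, snd p) \<partial>lborel)" by simp
  also have "\<dots> = (\<integral>\<^sup>+ p. f2 p \<partial>lborel)" by (rule nn_integral_shear_fst[OF f2])
  also have "\<dots> = (\<integral>\<^sup>+ p. f1 p \<partial>lborel)" unfolding f2_def by (rule nn_integral_shear_snd[OF f1])
  also have "\<dots> = (\<integral>\<^sup>+ p. f p \<partial>lborel)" unfolding f1_def by (rule nn_integral_shear_fst[OF f])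
  finally show ?thesis .
qed

lemma nn_integral_rot:
  fixes f :: "'a::euclidean_space \<times> 'a \<Rightarrow> ennreal"
  assumes f: "f \<in> borel_measurable borel"
  shows "(\<integral>\<^sup>+ p. f (rot t p) \<partial>lborel) = (\<integral>\<^sup>+ p. f p \<partial>lborel)"
proof (cases "cos (2 * pi * t) = -1")
  case False
  then show ?thesis
    using nn_integral_rotation_aux[OF f _ False, of "sin (2 * pi * t)"]
    by (simp add: rot_def split_def)
next
  case True
  then have s: "sin (2 * pi * t) = 0"
    using sin_cos_squared_add[of "2 * pi * t"] by simp
  \<comment> \<open>The half turn is the square of the quarter turn c = 0, s = 1, to which the shear
    decomposition applies.\<close>
  define g where "g p = f (- snd p, fst p)" for p
  have g: "g \<in> borel_measurable borel" unfolding g_def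
    by (rule measurable_compose[OF _ f], rule borel_measurable_continuous_onI) (intro continuous_intros)
  have "(\<integral>\<^sup>+ p. f (rot t p) \<partial>lborel) = (\<integral>\<^sup>+ p. g (- snd p, fst p) \<partial>lborel)"
    by (simp add: rot_def split_def True s g_def)
  also have "\<dots> = (\<integral>\<^sup>+ p. g p \<partial>lborel)"
    using nn_integral_rotation_aux[OF g, of 0 1] by simp
  also have "\<dots> = (\<integral>\<^sup>+ p. f p \<partial>lborel)"
    unfolding g_def using nn_integral_rotation_aux[OF f, of 0 1] by simp
  finally show ?thesis .
qed

lemma norm_rot:
  fixes p :: "'a::real_inner \<times> 'a"
  shows "norm (rot t p) = norm p"
proof -
  obtain u v where p: "p = (u, v)" by fastforce
  define c s where "c = cos (2 * pi * t)" and "s = sin (2 * pi * t)"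
  have cs: "c\<^sup>2 + s\<^sup>2 = 1" by (simp add: c_def s_def)
  have "(norm (c *\<^sub>R u - s *\<^sub>R v))\<^sup>2 + (norm (s *\<^sub>R u + c *\<^sub>R v))\<^sup>2 = (c\<^sup>2 + s\<^sup>2) * ((norm u)\<^sup>2 + (norm v)\<^sup>2)"
    unfolding power2_norm_eq_inner
    by (simp add: inner_diff inner_add inner_commute[of v u]) (simp add: algebra_simps power2_eq_square)
  then show ?thesis by (simp add: p rot_def norm_Pair cs flip: c_def s_def)
qed

text \<open>The value at the centre is compared with the average over the circle through each p of
  the ball. The ball and Lebesgue measure are both invariant under \<open>rot t\<close>, so after
  Fubini the average over t disappears and a volume mean remains, without polar coordinates. For (u,
  v) in the ball |u_j| + |v_j| is at most 2r, whence the condition on y.\<close>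

lemma hp_density_ball_submean:
  fixes F :: "complex^'n \<Rightarrow> complex"
  assumes F: "holo_on F tube_dom" and q: "q > 0" and y: "\<And>j. 2 * r < y $ j"
  shows "emeasure lborel (cball 0 r :: ((real^'n) \<times> (real^'n)) set) * hp_density q F (x, y)
     \<le> (\<integral>\<^sup>+ p. indicator (cball 0 r) p * hp_density q F ((x, y) + p) \<partial>lborel)"
proof -
  let ?B = "cball 0 r :: ((real^'n) \<times> (real^'n)) set"
  let ?V = "hp_density q F"
  define K where "K p = indicator ?B p * ?V ((x, y) + p)" for p
  have V: "?V \<in> borel_measurable borel" by (rule borel_measurable_hp_density[OF F])
  have K: "K \<in> borel_measurable borel" unfolding K_def
    by (intro borel_measurable_times_ennreal borel_measurable_indicator measurable_compose[OF _ V]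
         borel_measurable_continuous_onI continuous_intros) auto
  have rotm: "(\<lambda>z. rot (fst z) (snd z)) \<in> borel_measurable (borel :: (real \<times> (real^'n) \<times> (real^'n)) measure)"
    using continuous_rot by (intro borel_measurable_continuous_onI) (simp add: split_def)
  have indK: "indicator ?B p * ?V ((x, y) + rot t p) = K (rot t p)" for t p
    by (simp add: K_def indicator_def norm_rot)
  have ind: "(indicator {0..1} :: real \<Rightarrow> ennreal) \<in> borel_measurable borel" by simp
  have m2: "(\<lambda>z. indicator {0..1} (fst z) * K (rot (fst z) (snd z))) \<in> borel_measurable borel"
    by (intro borel_measurable_times_ennreal measurable_compose[OF rotm K]
        measurable_compose[OF _ ind]
        borel_measurable_continuous_onI continuous_intros)
  have "emeasure lborel ?B * ?V (x, y) = (\<integral>\<^sup>+ p. ?V (x, y) * indicator ?B p \<partial>lborel)"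
    by (subst nn_integral_cmult_indicator) (auto simp: mult.commute)
  also have "\<dots> \<le> (\<integral>\<^sup>+ p. (\<integral>\<^sup>+ t. indicator {0..1} t * K (rot t p) \<partial>lborel) \<partial>lborel)"
  proof (rule nn_integral_mono)
    fix p :: "(real^'n) \<times> (real^'n)"
    obtain u v where p: "p = (u, v)" by fastforce
    show "?V (x, y) * indicator ?B p \<le> (\<integral>\<^sup>+ t. indicator {0..1} t * K (rot t p) \<partial>lborel)"
    proof (cases "p \<in> ?B")
      case True
      have "\<bar>u $ j\<bar> + \<bar>v $ j\<bar> < y $ j" for j
        using component_le_norm_cart[of u j] component_le_norm_cart[of v j] True
          norm_fst_le[of u v] norm_snd_le[of v u] y[of j] by (auto simp: p)
      from hp_density_circle_submean[OF F q this, of x]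
      show ?thesis using True by (simp add: indK[symmetric] p)
    qed simp
  qed
  also have "\<dots> = (\<integral>\<^sup>+ t. (\<integral>\<^sup>+ p. indicator {0..1} t * K (rot t p) \<partial>lborel) \<partial>lborel)"
    using nn_integral_lborel_Fubini[OF m2] by simp
  also have "\<dots> = (\<integral>\<^sup>+ t. indicator {0..1} t * (\<integral>\<^sup>+ p. K p \<partial>lborel) \<partial>(lborel :: real measure))"
  proof (intro nn_integral_cong)
    fix t :: real
    have "(\<lambda>p. K (rot t p)) \<in> borel_measurable borel"
      unfolding rot_def split_def
      by (intro measurable_compose[OF _ K] borel_measurable_continuous_onI continuous_intros)
    then show "(\<integral>\<^sup>+ p. indicator {0..1} t * K (rot t p) \<partial>lborel) = indicator {0..1} t * (\<integral>\<^sup>+ p. K p \<partial>lborel)"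
      by (simp add: nn_integral_cmult nn_integral_rot[OF K])
  qed
  also have "\<dots> = (\<integral>\<^sup>+ p. K p \<partial>lborel)" by (simp add: nn_integral_multc)
  finally show ?thesis by (simp add: K_def)
qed

lemma emeasure_lborel_cball_pos:
  assumes "r > 0"
  shows "0 < emeasure lborel (cball (a :: 'a :: euclidean_space) r)"
  using assms content_cball_pos[of r a] emeasure_lborel_cball_finite[of a r]
  by (simp add: emeasure_eq_ennreal_measure)

lemma hp_density_le:
  fixes F :: "complex^'n \<Rightarrow> complex"
  assumes F: "holo_on F tube_dom" and q: "q > 0" and y: "\<And>j. 2 * r < y $ j" and r: "r > 0"
  shows "hp_density q F (x, y)
     \<le> (\<integral>\<^sup>+ p. indicator (cball 0 r) p * hp_density q F ((x, y) + p) \<partial>lborel)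
        / emeasure lborel (cball 0 r :: ((real^'n) \<times> (real^'n)) set)"
proof -
  let ?c = "emeasure lborel (cball 0 r :: ((real^'n) \<times> (real^'n)) set)"
  have c: "?c \<noteq> 0" "?c \<noteq> \<infinity>"
    using emeasure_lborel_cball_pos[OF r, of "0 :: (real^'n) \<times> (real^'n)"]
      emeasure_lborel_cball_finite[of "0 :: (real^'n) \<times> (real^'n)" r] by auto
  have "hp_density q F (x, y) = ?c * hp_density q F (x, y) / ?c"
    using c by (simp add: mult_divide_eq_ennreal mult.commute[of ?c])
  also have "\<dots> \<le> (\<integral>\<^sup>+ p. indicator (cball 0 r) p * hp_density q F ((x, y) + p) \<partial>lborel) / ?c"
    by (intro divide_right_mono_ennreal hp_density_ball_submean F q y)
  finally show ?thesis .
qed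

lemma borel_measurable_hp_density_shift:
  fixes F :: "complex^'n \<Rightarrow> complex"
  assumes F: "holo_on F tube_dom"
  shows "(\<lambda>(x, p). indicator (cball 0 r) p * hp_density q F ((x, y) + p)) \<in> borel_measurable borel"
proof -
  have ind: "(indicator (cball 0 r) :: (real^'n) \<times> (real^'n) \<Rightarrow> ennreal) \<in> borel_measurable borel"
    by (intro borel_measurable_indicator borel_closed closed_cball)
  show ?thesis unfolding split_def
    by (intro borel_measurable_times_ennreal measurable_compose[OF _ borel_measurable_hp_density[OF F]]
        measurable_compose[OF _ ind] borel_measurable_continuous_onI continuous_intros)
qed

text \<open>With x integrated first, the horizontal part of p is absorbed by translation and its
  vertical part merely changes the height of an integral mean. This makes the local averages an
  integrable majorant in \<open>hp_int_tendsto\<close>.\<close>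

lemma nn_integral_hp_density_ball:
  fixes F :: "complex^'n \<Rightarrow> complex"
  assumes F: "holo_on F tube_dom" and y: "\<And>j. r < y $ j"
  shows "(\<integral>\<^sup>+ x. (\<integral>\<^sup>+ p. indicator (cball 0 r) p * hp_density q F ((x, y) + p) \<partial>lborel) \<partial>lborel)
    \<le> Hp_pow q F * emeasure lborel (cball 0 r :: ((real^'n) \<times> (real^'n)) set)"
proof -
  let ?B = "cball 0 r :: ((real^'n) \<times> (real^'n)) set"
  have V: "hp_density q F \<in> borel_measurable borel" by (rule borel_measurable_hp_density[OF F])
  have "(\<integral>\<^sup>+ x. (\<integral>\<^sup>+ p. indicator ?B p * hp_density q F ((x, y) + p) \<partial>lborel) \<partial>lborel)
     = (\<integral>\<^sup>+ p. (\<integral>\<^sup>+ x. indicator ?B p * hp_density q F ((x, y) + p) \<partial>lborel) \<partial>lborel)"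
    using nn_integral_lborel_Fubini[OF borel_measurable_hp_density_shift[OF F, of r q y]] by simp
  also have "\<dots> \<le> (\<integral>\<^sup>+ p. Hp_pow q F * indicator ?B p \<partial>lborel)"
  proof (rule nn_integral_mono)
    fix p :: "(real^'n) \<times> (real^'n)"
    obtain u v where p: "p = (u, v)" by fastforce
    show "(\<integral>\<^sup>+ x. indicator ?B p * hp_density q F ((x, y) + p) \<partial>lborel) \<le> Hp_pow q F * indicator ?B p"
    proof (cases "p \<in> ?B")
      case True
      have "0 < (y + v) $ j" for j
        using component_le_norm_cart[of v j] True norm_snd_le[of v u] y[of j] by (auto simp: p)
      then have yv: "y + v \<in> Gamma_cone" by (simp add: Gamma_cone_def)
      have m: "(\<lambda>x. hp_density q F (x, y + v)) \<in> borel_measurable borel"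
        by (intro measurable_compose[OF _ V] borel_measurable_continuous_onI continuous_intros)
      have "(\<integral>\<^sup>+ x. hp_density q F (u + x, y + v) \<partial>lborel) = hp_int q F (y + v)"
        unfolding nn_integral_lborel_shift[OF m] hp_int_eq_density[OF yv] ..
      then show ?thesis using True hp_int_le_Hp_pow[OF yv] by (simp add: p add.commute)
    qed simp
  qed
  also have "\<dots> = Hp_pow q F * emeasure lborel ?B" by (subst nn_integral_cmult_indicator) auto
  finally show ?thesis .
qed

text \<open>Here x is fixed and the horizontal slice of the ball is enlarged to the whole space; the
  heights still range over a ball, so its n-dimensional volume appears. Divided by the volume of the
  2n-dimensional ball, the bound is uniform in x.\<close>

lemma nn_integral_hp_density_ball_pt:
  fixes F :: "complex^'n \<Rightarrow> complex"
  assumes F: "holo_on F tube_dom" and y: "\<And>j. r < y $ j"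
  shows "(\<integral>\<^sup>+ p. indicator (cball 0 r) p * hp_density q F ((x, y) + p) \<partial>lborel)
    \<le> Hp_pow q F * emeasure lborel (cball 0 r :: (real^'n) set)"
proof -
  let ?B = "cball 0 r :: ((real^'n) \<times> (real^'n)) set"
  let ?B' = "cball 0 r :: (real^'n) set"
  have V: "hp_density q F \<in> borel_measurable borel" by (rule borel_measurable_hp_density[OF F])
  have ind: "(indicator ?B :: _ \<Rightarrow> ennreal) \<in> borel_measurable borel"
    by (intro borel_measurable_indicator borel_closed closed_cball)
  have m: "(\<lambda>p. indicator ?B p * hp_density q F ((x, y) + p)) \<in> borel_measurable borel"
    by (intro borel_measurable_times_ennreal measurable_compose[OF _ V] ind
         borel_measurable_continuous_onI continuous_intros)
  have "(\<integral>\<^sup>+ p. indicator ?B p * hp_density q F ((x, y) + p) \<partial>lborel)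
     = (\<integral>\<^sup>+ v. (\<integral>\<^sup>+ u. indicator ?B (u, v) * hp_density q F ((x, y) + (u, v)) \<partial>lborel) \<partial>lborel)"
    by (rule nn_integral_lborel_pair_snd[OF m, symmetric])
  also have "\<dots> \<le> (\<integral>\<^sup>+ v. Hp_pow q F * indicator ?B' v \<partial>lborel)"
  proof (rule nn_integral_mono)
    fix v :: "real^'n"
    show "(\<integral>\<^sup>+ u. indicator ?B (u, v) * hp_density q F ((x, y) + (u, v)) \<partial>lborel) \<le> Hp_pow q F * indicator ?B' v"
    proof (cases "v \<in> ?B'")
      case True
      have "0 < (y + v) $ j" for j
        using component_le_norm_cart[of v j] True y[of j] by auto
      then have yv: "y + v \<in> Gamma_cone" by (simp add: Gamma_cone_def)
      have m: "(\<lambda>x. hp_density q F (x, y + v)) \<in> borel_measurable borel"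
        by (intro measurable_compose[OF _ V] borel_measurable_continuous_onI continuous_intros)
      have "(\<integral>\<^sup>+ u. indicator ?B (u, v) * hp_density q F ((x, y) + (u, v)) \<partial>lborel)
          \<le> (\<integral>\<^sup>+ u. hp_density q F (x + u, y + v) \<partial>lborel)"
        by (intro nn_integral_mono) (auto simp: indicator_def)
      also have "\<dots> = hp_int q F (y + v)"
        unfolding nn_integral_lborel_shift[OF m] hp_int_eq_density[OF yv] ..
      finally show ?thesis using True hp_int_le_Hp_pow[OF yv, of q F] by simp
    next
      case False
      then have "indicator ?B (u, v) = (0::ennreal)" for u
        using norm_snd_le[of v u] by (auto simp: indicator_def)
      then show ?thesis by simp
    qed
  qed
  also have "\<dots> = Hp_pow q F * emeasure lborel ?B'" by (subst nn_integral_cmult_indicator) auto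
  finally show ?thesis .
qed

text \<open>At distance d from the boundary |F|^q is at most its average over a ball of fixed
  radius, whose mass the quasi-norm controls. The radius is d / 3 because the volume mean needs 2r
  strictly below every coordinate.\<close>

lemma Hp_bounded_away_from_boundary:
  fixes F :: "complex^'n \<Rightarrow> complex"
  assumes F: "holo_on F tube_dom" and fin: "Hp_pow q F < \<infinity>" and q: "q > 0" and d: "d > 0"
  obtains B where "B \<ge> 0" "\<And>x y. (\<And>j. d \<le> y $ j) \<Longrightarrow> norm (F (tube_pt x y)) \<le> B"
proof -
  define r where "r = d / 3"
  have r: "r > 0" using d by (simp add: r_def)
  define C where "C = Hp_pow q F * emeasure lborel (cball 0 r :: (real^'n) set)
     / emeasure lborel (cball 0 r :: ((real^'n) \<times> (real^'n)) set)"
  have "C < \<infinity>"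
    unfolding C_def using fin emeasure_lborel_cball_pos[OF r, of "0 :: (real^'n) \<times> (real^'n)"]
      emeasure_lborel_cball_finite[of "0 :: real^'n" r]
    by (auto simp: ennreal_divide_eq_top_iff ennreal_mult_eq_top_iff less_top[symmetric])
  then obtain c where c: "C = ennreal c" "c \<ge> 0" by (cases C) auto
  show thesis
  proof
    show "0 \<le> c powr (1 / q)" by simp
    fix x y :: "real^'n" assume y: "\<And>j. d \<le> y $ j"
    have y2: "2 * r < y $ j" "r < y $ j" for j using y[of j] d by (auto simp: r_def)
    have yG: "y \<in> Gamma_cone" using y2(2) r by (auto simp: Gamma_cone_def intro: less_trans)
    have "hp_density q F (x, y) \<le> C"
      unfolding C_def
      by (rule order_trans[OF hp_density_le[OF F q y2(1) r]])
         (rule divide_right_mono_ennreal[OF nn_integral_hp_density_ball_pt[OF F y2(2)]])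
    then have "norm (F (tube_pt x y)) powr q \<le> c"
      using yG c by (simp add: hp_density_def)
    then have "(norm (F (tube_pt x y)) powr q) powr (1 / q) \<le> c powr (1 / q)"
      using q by (intro powr_mono2) auto
    then show "norm (F (tube_pt x y)) \<le> c powr (1 / q)" using q by (simp add: powr_powr)
  qed
qed

lemma borel_measurable_nn_integral_lborel:
  fixes f :: "'a::euclidean_space \<times> 'b::euclidean_space \<Rightarrow> ennreal"
  assumes "f \<in> borel_measurable borel"
  shows "(\<lambda>x. \<integral>\<^sup>+ y. f (x, y) \<partial>lborel) \<in> borel_measurable borel"
  using lborel.borel_measurable_nn_integral_fst[of f lborel] assms by (simp add: lborel_prod)

text \<open>Dominated convergence in x. The ball of radius r about (x, \<open>Z k\<close>) lies in
  the ball of radius 2r about (x, y), so the integral over the larger ball, divided by the volume of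
  the smaller, is a majorant \<open>D\<close> independent of k.\<close>

lemma hp_int_tendsto:
  fixes F :: "complex^'n \<Rightarrow> complex"
  assumes F: "holo_on F tube_dom" and fin: "Hp_pow q F < \<infinity>" and q: "q > 0"
    and y: "y \<in> Gamma_cone" and Y: "Y \<longlonglongrightarrow> y"
  shows "(\<lambda>k. hp_int q F (Y k)) \<longlonglongrightarrow> hp_int q F y"
proof -
  \<comment> \<open>With a quarter of the least coordinate, heights within r of y keep every
    coordinate above 2r, and the ball of radius 2r about y stays in the cone.\<close>
  define r where "r = Min (range (\<lambda>j. y $ j)) / 4"
  have ymin: "4 * r \<le> y $ j" for j unfolding r_def by auto
  have r: "r > 0" unfolding r_def using y by (auto simp: Gamma_cone_def)
  have "\<forall>\<^sub>F k in sequentially. dist (Y k) y < r" using Y r by (rule tendstoD)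
  then obtain K where K: "\<And>k. k \<ge> K \<Longrightarrow> dist (Y k) y < r" by (auto simp: eventually_sequentially)
  define Z where "Z k = Y (k + K)" for k
  have Zd: "dist (Z k) y < r" for k unfolding Z_def by (rule K) simp
  have ZG0: "2 * r < Z k $ j" for k j
    using component_le_norm_cart[of "Z k - y" j] Zd[of k] ymin[of j] r by (auto simp: dist_norm)
  have "0 < Z k $ j" for k j using ZG0[of k j] r by linarith
  then have ZG: "Z k \<in> Gamma_cone" for k by (simp add: Gamma_cone_def)
  have Zlim: "Z \<longlonglongrightarrow> y" unfolding Z_def using Y by (rule LIMSEQ_ignore_initial_segment)
  let ?c = "emeasure lborel (cball 0 r :: ((real^'n) \<times> (real^'n)) set)"
  define D where "D x = (\<integral>\<^sup>+ p. indicator (cball 0 (2 * r)) p * hp_density q F ((x, y) + p) \<partial>lborel) / ?c" for x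
  have V: "hp_density q F \<in> borel_measurable borel" by (rule borel_measurable_hp_density[OF F])
  have Vy: "(\<lambda>x. hp_density q F (x, y)) \<in> borel_measurable borel" for y
    by (intro measurable_compose[OF _ V] borel_measurable_continuous_onI continuous_intros)
  have bound: "hp_density q F (x, Z k) \<le> D x" for x k
  proof -
    define a where "a = (0 :: real^'n, Z k - y)"
    have na: "norm a \<le> r" using Zd[of k] by (simp add: a_def dist_norm)
    define K where "K p = indicator (cball 0 r) (p - a) * hp_density q F ((x, y) + p)" for p
    have ind: "(indicator (cball 0 r) :: (real^'n) \<times> (real^'n) \<Rightarrow> ennreal) \<in> borel_measurable borel"
    by (intro borel_measurable_indicator borel_closed closed_cball)
    have K: "K \<in> borel_measurable borel" unfolding K_def
      by (intro borel_measurable_times_ennreal measurable_compose[OF _ V] measurable_compose[OF _ ind]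
        borel_measurable_continuous_onI continuous_intros)
    have "(\<integral>\<^sup>+ p. indicator (cball 0 r) p * hp_density q F ((x, Z k) + p) \<partial>lborel) = (\<integral>\<^sup>+ p. K (a + p) \<partial>lborel)"
      by (intro nn_integral_cong) (auto simp: K_def a_def add.assoc[symmetric])
    also have "\<dots> = (\<integral>\<^sup>+ p. K p \<partial>lborel)" by (rule nn_integral_lborel_shift[OF K])
    also have "\<dots> \<le> (\<integral>\<^sup>+ p. indicator (cball 0 (2 * r)) p * hp_density q F ((x, y) + p) \<partial>lborel)"
    proof (rule nn_integral_mono)
      fix p :: "(real^'n) \<times> (real^'n)"
      have "norm p \<le> norm (p - a) + norm a" using norm_triangle_ineq[of "p - a" a] by simp
      then show "K p \<le> indicator (cball 0 (2 * r)) p * hp_density q F ((x, y) + p)"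
        unfolding K_def using na by (auto simp: indicator_def)
    qed
    finally show ?thesis unfolding D_def
      by (intro order_trans[OF hp_density_le[OF F q ZG0 r]] divide_right_mono_ennreal)
  qed
  have Im: "(\<lambda>x. \<integral>\<^sup>+ p. indicator (cball 0 (2 * r)) p * hp_density q F ((x, y) + p) \<partial>lborel)
      \<in> borel_measurable borel"
    using borel_measurable_nn_integral_lborel[OF borel_measurable_hp_density_shift[OF F, of "2 * r" q y]]
    by simp
  then have Dm: "D \<in> borel_measurable borel" unfolding D_def by measurable
  have "2 * r < y $ j" for j using ymin[of j] r by auto
  from nn_integral_hp_density_ball[OF F this, of q]
  have I: "(\<integral>\<^sup>+ x. (\<integral>\<^sup>+ p. indicator (cball 0 (2 * r)) p * hp_density q F ((x, y) + p) \<partial>lborel) \<partial>lborel) < \<infinity>"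
    using fin emeasure_lborel_cball_finite[of "0 :: (real^'n) \<times> (real^'n)" "2 * r"]
    by (auto simp: ennreal_mult_less_top elim: le_less_trans)
  have "(\<integral>\<^sup>+ x. D x \<partial>lborel) = (\<integral>\<^sup>+ x. (\<integral>\<^sup>+ p. indicator (cball 0 (2 * r)) p * hp_density q F ((x, y) + p) \<partial>lborel) \<partial>lborel) / ?c"
    unfolding D_def using Im by (intro nn_integral_divide) simp
  also have "\<dots> < \<infinity>"
    using I emeasure_lborel_cball_pos[OF r, of "0 :: (real^'n) \<times> (real^'n)"]
    by (auto simp: ennreal_divide_eq_top_iff less_top[symmetric])
  finally have Dfin: "(\<integral>\<^sup>+ x. D x \<partial>lborel) < \<infinity>" .
  have "(\<lambda>k. \<integral>\<^sup>+ x. hp_density q F (x, Z k) \<partial>lborel) \<longlonglongrightarrow> (\<integral>\<^sup>+ x. hp_density q F (x, y) \<partial>lborel)"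
  proof (rule nn_integral_dominated_convergence[where w=D])
    show "AE x in lborel. (\<lambda>k. hp_density q F (x, Z k)) \<longlonglongrightarrow> hp_density q F (x, y)"
    proof (rule AE_I2)
      fix x
      have "(\<lambda>k. F (tube_pt x (Z k))) \<longlonglongrightarrow> F (tube_pt x y)"
      proof (rule continuous_on_tendsto_compose[where s=Gamma_cone and f="\<lambda>y. F (tube_pt x y)"])
        show "continuous_on Gamma_cone (\<lambda>y. F (tube_pt x y))"
          by (rule continuous_on_compose2[OF holo_on_imp_continuous_on[OF F]])
            (auto intro!: continuous_intros simp: tube_pt_in_tube_dom)
      qed (use Zlim y ZG in auto)
      then have "(\<lambda>k. ennreal (norm (F (tube_pt x (Z k))) powr q)) \<longlonglongrightarrow> ennreal (norm (F (tube_pt x y)) powr q)"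
        using q by (intro tendsto_ennrealI tendsto_powr' tendsto_norm tendsto_const) auto
      then show "(\<lambda>k. hp_density q F (x, Z k)) \<longlonglongrightarrow> hp_density q F (x, y)"
        using ZG y by (simp add: hp_density_def)
    qed
  qed (use Vy Dm bound Dfin in auto)
  then have "(\<lambda>k. hp_int q F (Z k)) \<longlonglongrightarrow> hp_int q F y"
    by (simp add: hp_int_eq_density ZG y)
  then show ?thesis unfolding Z_def by (rule LIMSEQ_offset)
qed

section \<open>Monotonicity of the integral means\<close>

text \<open>For a purely real direction w the circle moves horizontally by cos * w and vertically by
  sin * w. Integration over x removes the horizontal motion by translation invariance, so the mean
  is taken along the heights alone.\<close>

lemma hp_int_circle_submean:
  fixes F :: "complex^'n \<Rightarrow> complex"
  assumes F: "holo_on F tube_dom" and q: "q > 0" and yw: "\<And>j. \<bar>w $ j\<bar> < y $ j"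
  shows "hp_int q F y \<le> (\<integral>\<^sup>+ s. indicator {0..1} s * hp_int q F (y + sin (2 * pi * s) *\<^sub>R w) \<partial>lborel)"
proof -
  let ?V = "hp_density q F"
  have V: "?V \<in> borel_measurable borel" by (rule borel_measurable_hp_density[OF F])
  have inG: "y + sin t *\<^sub>R w \<in> Gamma_cone" for t
  proof -
    have "0 < y $ j + sin t * w $ j" for j
    proof -
      have "\<bar>sin t * w $ j\<bar> \<le> 1 * \<bar>w $ j\<bar>" unfolding abs_mult by (intro mult_right_mono) auto
      then show ?thesis using yw[of j] by linarith
    qed
    then show ?thesis by (simp add: Gamma_cone_def)
  qed
  have yG: "y \<in> Gamma_cone" using inG[of 0] by simp
  define K where "K z = indicator {0..1} (snd z) *
    ?V (cos (2 * pi * snd z) *\<^sub>R w + fst z, y + sin (2 * pi * snd z) *\<^sub>R w)" for z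
  have ind: "(indicator {0..1} :: real \<Rightarrow> ennreal) \<in> borel_measurable borel" by simp
  have K: "K \<in> borel_measurable borel" unfolding K_def
    by (intro borel_measurable_times_ennreal measurable_compose[OF _ V] measurable_compose[OF _ ind]
        borel_measurable_continuous_onI continuous_intros)
  have "hp_int q F y = (\<integral>\<^sup>+ x. ?V (x, y) \<partial>lborel)" by (rule hp_int_eq_density[OF yG])
  also have "\<dots> \<le> (\<integral>\<^sup>+ x. (\<integral>\<^sup>+ s. K (x, s) \<partial>lborel) \<partial>lborel)"
  proof (rule nn_integral_mono)
    fix x
    have "?V (x, y) \<le> (\<integral>\<^sup>+ t. indicator {0..1} t * ?V ((x, y) + rot t (w, 0)) \<partial>lborel)"
      by (rule hp_density_circle_submean[OF F q]) (use yw in simp)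
    then show "?V (x, y) \<le> (\<integral>\<^sup>+ s. K (x, s) \<partial>lborel)" by (simp add: K_def rot_def add.commute)
  qed
  also have "\<dots> = (\<integral>\<^sup>+ s. (\<integral>\<^sup>+ x. K (x, s) \<partial>lborel) \<partial>lborel)"
    by (rule nn_integral_lborel_Fubini[OF K])
  also have "\<dots> = (\<integral>\<^sup>+ s. indicator {0..1} s * hp_int q F (y + sin (2 * pi * s) *\<^sub>R w) \<partial>lborel)"
  proof (intro nn_integral_cong)
    fix s :: real
    have m: "(\<lambda>x. ?V (x, y')) \<in> borel_measurable borel" for y'
      by (intro measurable_compose[OF _ V] borel_measurable_continuous_onI continuous_intros)
    have m': "(\<lambda>x. ?V (a + x, y')) \<in> borel_measurable borel" for a y'
      by (intro measurable_compose[OF _ V] borel_measurable_continuous_onI continuous_intros)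
    show "(\<integral>\<^sup>+ x. K (x, s) \<partial>lborel) = indicator {0..1} s * hp_int q F (y + sin (2 * pi * s) *\<^sub>R w)"
      unfolding K_def fst_conv snd_conv hp_int_eq_density[OF inG]
      using nn_integral_lborel_shift[OF m] m' by (simp add: nn_integral_cmult)
  qed
  finally show ?thesis .
qed

lemma has_integral_sin_2pi: "((\<lambda>s. sin (2 * pi * s)) has_integral 0) {0..1::real}"
proof -
  have "((\<lambda>s. sin (2 * pi * s)) has_integral (- cos (2 * pi * 1) / (2 * pi)) - (- cos (2 * pi * 0) / (2 * pi))) {0..1::real}"
    by (rule fundamental_theorem_of_calculus)
      (auto intro!: derivative_eq_intros simp: has_real_derivative_iff_has_vector_derivative[symmetric])
  then show ?thesis by simp
qed

text \<open>Subtracting a small linear function makes a violation of monotonicity an interior maximum,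
  which the mean value inequality over a circle reaching down to 0 excludes.\<close>

lemma nonincreasing_of_circle_submean:
  fixes \<phi> :: "real \<Rightarrow> real"
  assumes cont: "continuous_on {0..} \<phi>" and bd: "\<And>t. t \<ge> 0 \<Longrightarrow> \<phi> t \<le> M"
    and submean: "\<And>t. t \<ge> 0 \<Longrightarrow> \<phi> t \<le> integral {0..1} (\<lambda>s. \<phi> (t + t * sin (2 * pi * s)))"
  shows "\<phi> 1 \<le> \<phi> 0"
proof (rule ccontr)
  assume "\<not> ?thesis"
  then have less: "\<phi> 0 < \<phi> 1" by simp
  \<comment> \<open>Half the increment, so that \<open>\<psi> 1 > \<psi> 0\<close> survives the
    subtraction of the linear term.\<close>
  define \<kappa> where "\<kappa> = (\<phi> 1 - \<phi> 0) / 2"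
  have \<kappa>: "\<kappa> > 0" using less by (simp add: \<kappa>_def)
  define \<psi> where "\<psi> t = \<phi> t - \<kappa> * t" for t
  have \<psi>cont: "continuous_on {0..} \<psi>" unfolding \<psi>_def by (intro continuous_intros cont)
  have \<psi>1: "\<psi> 1 > \<psi> 0" using less by (simp add: \<psi>_def \<kappa>_def field_simps)
  \<comment> \<open>Beyond T the linear term outweighs the bound M, so a maximum of \<psi> over
    [0, T] is a maximum over the whole half-line.\<close>
  define T where "T = max 1 ((M - \<phi> 0) / \<kappa>)"
  have T1: "T \<ge> 1" by (simp add: T_def)
  have large: "\<psi> t \<le> \<psi> 0" if "t \<ge> T" for t
  proof -
    have "(M - \<phi> 0) / \<kappa> \<le> t" using that by (simp add: T_def)
    then have "M - \<phi> 0 \<le> \<kappa> * t" using \<kappa> by (simp add: field_simps)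
    moreover have "\<phi> t \<le> M" using that T1 by (intro bd) auto
    ultimately show ?thesis by (simp add: \<psi>_def)
  qed
  have "continuous_on {0..T} \<psi>" by (rule continuous_on_subset[OF \<psi>cont]) auto
  then obtain a where a: "a \<in> {0..T}" "\<And>t. t \<in> {0..T} \<Longrightarrow> \<psi> t \<le> \<psi> a"
    using continuous_attains_sup[of "{0..T}" \<psi>] T1 by auto
  have a1: "\<psi> 1 \<le> \<psi> a" using T1 by (intro a) auto
  have max: "\<psi> t \<le> \<psi> a" if "t \<ge> 0" for t
    using a(2)[of t] large[of t] that a1 \<psi>1 by (cases "t \<le> T") auto
  have a0: "a \<ge> 0" using a by simp
  have arg: "a + a * sin t \<ge> 0" for t
    using mult_left_mono[of "-1" "sin t" a] a0 by simp
  define g where "g s = \<psi> a - \<psi> (a + a * sin (2 * pi * s))" for s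
  have gcont: "continuous_on {0..1} g" unfolding g_def
    by (intro continuous_intros continuous_on_compose2[OF \<psi>cont]) (use arg in auto)
  have \<phi>int: "(\<lambda>s. \<phi> (a + a * sin (2 * pi * s))) integrable_on {0..1}"
    by (intro integrable_continuous_real continuous_on_compose2[OF cont] continuous_intros) (use arg in auto)
  have g0: "g s \<ge> 0" for s unfolding g_def using max[OF arg] by simp
  \<comment> \<open>The sine has mean zero, so the linear term does not affect the mean value
    inequality: g >= 0 has integral at most 0 and must vanish identically.\<close>
  have "((\<lambda>s. \<phi> a - \<phi> (a + a * sin (2 * pi * s)) + \<kappa> * a * sin (2 * pi * s)) has_integral
     (\<phi> a - integral {0..1} (\<lambda>s. \<phi> (a + a * sin (2 * pi * s)))) + \<kappa> * a * 0) {0..1}"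
    using has_integral_const_real[of "\<phi> a" 0 1]
    by (intro has_integral_add has_integral_diff has_integral_mult_right has_integral_sin_2pi
        integrable_integral[OF \<phi>int]) auto
  moreover have "g = (\<lambda>s. \<phi> a - \<phi> (a + a * sin (2 * pi * s)) + \<kappa> * a * sin (2 * pi * s))"
    by (auto simp: g_def \<psi>_def algebra_simps)
  ultimately have gI: "(g has_integral (\<phi> a - integral {0..1} (\<lambda>s. \<phi> (a + a * sin (2 * pi * s))))) {0..1}"
    by simp
  have "\<phi> a - integral {0..1} (\<lambda>s. \<phi> (a + a * sin (2 * pi * s))) \<ge> 0"
    using has_integral_nonneg[OF gI] g0 by auto
  with submean[OF a0] have "\<phi> a - integral {0..1} (\<lambda>s. \<phi> (a + a * sin (2 * pi * s))) = 0" by simp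
  with gI have "(g has_integral 0) (cbox 0 1)" by simp
  \<comment> \<open>At s = 3/4 the sine is -1, the point where the circle of radius a about a
    touches 0.\<close>
  from has_integral_0_cbox_imp_0[OF _ _ this, of "3/4"] gcont g0
  have "g (3/4) = 0" by auto
  moreover have "sin (2 * pi * (3/4)) = -1" using sin_3over2_pi by (simp add: mult_ac)
  ultimately have "\<psi> a = \<psi> 0" by (simp add: g_def)
  with a1 \<psi>1 show False by simp
qed

text \<open>Along the ray y + t w the circle with direction t w covers the heights from y to y + 2t
  w. It stays inside the cone even at its lowest point, because y is itself interior; so the
  one-variable argument is applicable with circles reaching 0.\<close>

lemma hp_int_add_le:
  fixes F :: "complex^'n \<Rightarrow> complex"
  assumes F: "holo_on F tube_dom" and fin: "Hp_pow q F < \<infinity>" and q: "q > 0"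
    and y: "y \<in> Gamma_cone" and w: "w \<in> Gamma_cone"
  shows "hp_int q F (y + w) \<le> hp_int q F y"
proof -
  have inG: "y + t *\<^sub>R w \<in> Gamma_cone" if "t \<ge> 0" for t
    using y w that by (auto simp: Gamma_cone_def less_imp_le intro!: add_pos_nonneg mult_nonneg_nonneg)
  have finy: "hp_int q F y' < \<infinity>" if "y' \<in> Gamma_cone" for y'
    using hp_int_le_Hp_pow[OF that] fin by (rule le_less_trans)
  define \<phi> where "\<phi> t = enn2real (hp_int q F (y + t *\<^sub>R w))" for t
  have \<phi>: "ennreal (\<phi> t) = hp_int q F (y + t *\<^sub>R w)" if "t \<ge> 0" for t
    using finy[OF inG[OF that]] by (simp add: \<phi>_def)
  have cont: "continuous_on {0..} \<phi>"
    unfolding continuous_on_sequentially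
  proof (intro ballI allI impI)
    fix X :: "nat \<Rightarrow> real" and t assume X: "t \<in> {0..}" "(\<forall>n. X n \<in> {0..}) \<and> X \<longlonglongrightarrow> t"
    then have "(\<lambda>n. y + X n *\<^sub>R w) \<longlonglongrightarrow> y + t *\<^sub>R w" by (intro tendsto_intros) auto
    from hp_int_tendsto[OF F fin q inG this] X
    have "(\<lambda>n. hp_int q F (y + X n *\<^sub>R w)) \<longlonglongrightarrow> hp_int q F (y + t *\<^sub>R w)" by simp
    then have "(\<lambda>n. hp_int q F (y + X n *\<^sub>R w)) \<longlonglongrightarrow> ennreal (\<phi> t)" using X \<phi> by simp
    then have "(\<lambda>n. enn2real (hp_int q F (y + X n *\<^sub>R w))) \<longlonglongrightarrow> \<phi> t"
      by (rule tendsto_enn2real) (simp add: \<phi>_def)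
    then show "(\<phi> \<circ> X) \<longlonglongrightarrow> \<phi> t" by (simp add: \<phi>_def o_def)
  qed
  have "\<phi> 1 \<le> \<phi> 0"
  proof (rule nonincreasing_of_circle_submean[OF cont])
    show "\<phi> t \<le> enn2real (Hp_pow q F)" if "t \<ge> 0" for t
      unfolding \<phi>_def using hp_int_le_Hp_pow[OF inG[OF that]] fin by (intro enn2real_mono) auto
    fix t :: real assume t: "t \<ge> 0"
    have arg: "t + t * sin s \<ge> 0" for s
      using mult_left_mono[of "-1" "sin s" t] t by simp
    have c: "continuous_on {0..1} (\<lambda>s. \<phi> (t + t * sin (2 * pi * s)))"
      by (intro continuous_on_compose2[OF cont] continuous_intros) (use arg in auto)
    have nn: "\<phi> s \<ge> 0" for s by (simp add: \<phi>_def)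
    have "ennreal (\<phi> t) = hp_int q F (y + t *\<^sub>R w)" by (rule \<phi>[OF t])
    also have "\<dots> \<le> (\<integral>\<^sup>+ s. indicator {0..1} s * hp_int q F ((y + t *\<^sub>R w) + sin (2 * pi * s) *\<^sub>R (t *\<^sub>R w)) \<partial>lborel)"
      by (rule hp_int_circle_submean[OF F q])
        (use y w t in \<open>auto simp: Gamma_cone_def abs_mult less_imp_le\<close>)
    also have "\<dots> = (\<integral>\<^sup>+ s. ennreal (indicator {0..1} s * \<phi> (t + t * sin (2 * pi * s))) \<partial>lborel)"
    proof (intro nn_integral_cong)
      fix s
      have eq: "(y + t *\<^sub>R w) + sin (2 * pi * s) *\<^sub>R (t *\<^sub>R w) = y + (t + t * sin (2 * pi * s)) *\<^sub>R w"
        by (simp add: algebra_simps)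
      show "indicator {0..1} s * hp_int q F ((y + t *\<^sub>R w) + sin (2 * pi * s) *\<^sub>R (t *\<^sub>R w))
          = ennreal (indicator {0..1} s * \<phi> (t + t * sin (2 * pi * s)))"
        unfolding eq \<phi>[OF arg, symmetric] using nn by (simp add: ennreal_mult' ennreal_indicator)
    qed
    also have "\<dots> = ennreal (integral {0..1} (\<lambda>s. \<phi> (t + t * sin (2 * pi * s))))"
      by (rule nn_integral_has_integral_lebesgue)
        (use nn c in \<open>auto intro!: integrable_integral integrable_continuous_real\<close>)
    finally show "\<phi> t \<le> integral {0..1} (\<lambda>s. \<phi> (t + t * sin (2 * pi * s)))"
      by (subst (asm) ennreal_le_iff) (auto intro!: integral_nonneg integrable_continuous_real c nn)
  qed
  then have "ennreal (\<phi> 1) \<le> ennreal (\<phi> 0)" by (rule ennreal_leI)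
  then show ?thesis using \<phi>[of 0] \<phi>[of 1] by simp
qed

lemma hp_int_antimono:
  fixes F :: "complex^'n \<Rightarrow> complex"
  assumes "holo_on F tube_dom" and "Hp_pow q F < \<infinity>" and "q > 0"
    and "y \<in> Gamma_cone" and "\<And>j. y $ j < y' $ j"
  shows "hp_int q F y' \<le> hp_int q F y"
  using hp_int_add_le[OF assms(1-4), of "y' - y"] assms(5) by (simp add: Gamma_cone_def)

section \<open>Convergence of shifts\<close>

text \<open>On the compact part of K where f >= 0 the function g is bounded away from 0, so max f /
  min g serves as C; on the rest every C >= 0 does.\<close>

lemma compact_bound_by_multiple:
  fixes f g :: "'a::metric_space \<Rightarrow> real"
  assumes K: "compact K" and f: "continuous_on K f" and g: "continuous_on K g"
    and g0: "\<And>x. x \<in> K \<Longrightarrow> g x \<ge> 0" and fg: "\<And>x. x \<in> K \<Longrightarrow> g x = 0 \<Longrightarrow> f x < 0"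
  obtains C where "C \<ge> 0" "\<And>x. x \<in> K \<Longrightarrow> f x \<le> C * g x"
proof -
  define K' where "K' = K \<inter> f -` {0..}"
  have "closed K'" unfolding K'_def
    by (rule continuous_closed_preimage[OF f compact_imp_closed[OF K]]) auto
  moreover have "K \<inter> K' = K'" by (auto simp: K'_def)
  ultimately have K': "compact K'" using compact_Int_closed[OF K, of K'] by simp
  have cf: "continuous_on K' f" and cg: "continuous_on K' g"
    using f g by (auto simp: K'_def intro: continuous_on_subset)
  show ?thesis
  proof (cases "K' = {}")
    case True
    then have "f x \<le> 0 * g x" if "x \<in> K" for x using that by (force simp: K'_def)
    then show ?thesis using that[of 0] by auto
  next
    case False
    obtain a where a: "a \<in> K'" "\<And>x. x \<in> K' \<Longrightarrow> f x \<le> f a"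
      using continuous_attains_sup[OF K' False cf] by auto
    obtain b where b: "b \<in> K'" "\<And>x. x \<in> K' \<Longrightarrow> g b \<le> g x"
      using continuous_attains_inf[OF K' False cg] by auto
    have gb: "g b > 0" using b(1) g0[of b] fg[of b] by (force simp: K'_def)
    have fa: "f a \<ge> 0" using a by (simp add: K'_def)
    show ?thesis
    proof (rule that)
      show "f a / g b \<ge> 0" using fa gb by simp
      fix x assume x: "x \<in> K"
      show "f x \<le> f a / g b * g x"
      proof (cases "x \<in> K'")
        case True
        have "f x \<le> f a / g b * g b" using a(2)[OF True] gb by simp
        also have "\<dots> \<le> f a / g b * g x" using fa gb b(2)[OF True] by (intro mult_left_mono) auto
        finally show ?thesis .
      next
        case False
        then have "f x \<le> 0" using x by (simp add: K'_def)
        also have "0 \<le> f a / g b * g x" using fa gb g0[OF x] by simp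
        finally show ?thesis .
      qed
    qed
  qed
qed

lemma powr_half_square: "(x powr (p / 2))\<^sup>2 = x powr p" for x :: real
  by (simp add: power2_eq_square powr_add[symmetric])

text \<open>The deficit in the inequality of arithmetic and geometric means is a square, so it
  vanishes just when the moduli agree.\<close>

lemma norm_mult_powr_half:
  fixes a b :: complex
  shows "(norm a powr p + norm b powr p) / 2 - norm (a * b) powr (p / 2)
     = (norm a powr (p / 2) - norm b powr (p / 2))\<^sup>2 / 2"
  by (simp add: norm_mult powr_mult power2_diff powr_half_square field_simps)

text \<open>
  By homogeneity and compactness it suffices that the two deficits
  \<open>(|a|\<^sup>p + |b|\<^sup>p)/2 - |ab|\<^bsup>p/2\<^esup>\<close> and \<open>(|a|\<^sup>p + |b|\<^sup>p)/2 - |(a + b)/2|\<^sup>p\<close> vanish together only for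
  \<open>a = b\<close>: the first forces \<open>|a| = |b|\<close>, and then the second forces \<open>a = b\<close>.
\<close>

lemma norm_diff_powr_le:
  fixes p \<eta> :: real
  assumes p: "p > 0" and \<eta>: "\<eta> > 0"
  obtains C1 C2 where "C1 \<ge> 0" "C2 \<ge> 0"
    "\<And>a b :: complex. norm (a - b) powr p + C1 * norm (a * b) powr (p / 2) + C2 * norm ((a + b) / 2) powr p
       \<le> (\<eta> + (C1 + C2) / 2) * (norm a powr p + norm b powr p)"
proof -
  define S where "S = sphere (0 :: complex \<times> complex) 1"
  define m where "m = (\<lambda>(a :: complex, b :: complex). norm a powr p + norm b powr p)"
  \<comment> \<open>One half of \<eta> makes \<open>e\<close> strictly negative at a = b, the other
    half provides strictness when the estimate is extended from K to the sphere S.\<close>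
  define e where "e = (\<lambda>(a :: complex, b :: complex). norm (a - b) powr p - \<eta> / 2 * m (a, b))"
  define f1 where "f1 = (\<lambda>(a :: complex, b :: complex). m (a, b) / 2 - norm (a * b) powr (p / 2))"
  define f2 where "f2 = (\<lambda>(a :: complex, b :: complex). m (a, b) / 2 - norm ((a + b) / 2) powr p)"
  have ce: "continuous_on A e" and c1: "continuous_on A f1" and c2: "continuous_on A f2" for A
    unfolding e_def f1_def f2_def m_def split_def using p
    by (auto intro!: continuous_intros continuous_on_powr')
  have f1_eq: "f1 (a, b) = (norm a powr (p / 2) - norm b powr (p / 2))\<^sup>2 / 2" for a b
    unfolding f1_def m_def using norm_mult_powr_half by simp
  have f1_0: "norm a = norm b" if "f1 (a, b) = 0" for a b
  proof -
    have "norm a powr (p / 2) = norm b powr (p / 2)" using that by (simp add: f1_eq)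
    then have "(norm a powr (p / 2)) powr (2 / p) = (norm b powr (p / 2)) powr (2 / p)" by simp
    then show ?thesis using p by (simp add: powr_powr)
  qed
  define K where "K = S \<inter> f1 -` {0}"
  have "closed K" unfolding K_def S_def
    by (rule continuous_closed_preimage[OF c1]) auto
  moreover have "S \<inter> K = K" by (auto simp: K_def)
  ultimately have "compact K" using compact_Int_closed[of S K] by (simp add: S_def)
  then have "\<exists>C2\<ge>0. \<forall>x\<in>K. e x \<le> C2 * f2 x"
  proof (rule compact_bound_by_multiple[OF _ ce c2])
    fix x assume x: "x \<in> K"
    obtain a b where ab: "x = (a, b)" by fastforce
    have n: "norm a = norm b" using x f1_0 by (auto simp: K_def ab)
    have le: "norm ((a + b) / 2) \<le> norm a" using norm_triangle_ineq[of a b] n by simp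
    have m: "m (a, b) / 2 = norm a powr p" by (simp add: m_def n)
    show "f2 x \<ge> 0" unfolding f2_def ab using m powr_mono2[OF _ _ le, of p] p by simp
    show "e x < 0" if "f2 x = 0"
    proof -
      have eq: "norm ((a + b) / 2) powr p = norm a powr p" using that m by (simp add: f2_def ab)
      have "norm ((a + b) / 2) = norm a"
      proof (rule ccontr)
        assume "\<not> ?thesis"
        with le have "norm ((a + b) / 2) < norm a" by simp
        from powr_less_mono2[OF p _ this] eq show False by simp
      qed
      then have "norm (a + b) = norm a + norm b" using n by simp
      then have "norm a *\<^sub>R b = norm b *\<^sub>R a" by (simp add: norm_triangle_eq)
      moreover have "norm a \<noteq> 0" using x n by (auto simp: K_def S_def ab)
      ultimately have "a = b" using n by (metis scaleR_cancel_left)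
      moreover have "norm a powr p > 0" using \<open>norm a \<noteq> 0\<close> by simp
      ultimately show ?thesis using \<eta> p by (simp add: e_def ab m_def)
    qed
  qed blast
  then obtain C2 where C2: "C2 \<ge> 0" "\<And>x. x \<in> K \<Longrightarrow> e x \<le> C2 * f2 x" by blast
  have cd: "continuous_on S (\<lambda>x. e x - C2 * f2 x)" by (intro continuous_intros ce c2)
  have e2: "e x - C2 * f2 x \<le> 0" if "x \<in> S" "f1 x = 0" for x
    using C2(2)[of x] that by (simp add: K_def)
  \<comment> \<open>C2 is now fixed: on the zero set of \<open>f1\<close> the left side is at most
    -\<eta> / 2 * m x < 0, which is what the compactness lemma requires.\<close>
  have "\<exists>C1\<ge>0. \<forall>x\<in>S. e x - C2 * f2 x - \<eta> / 2 * m x \<le> C1 * f1 x"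
  proof -
    have mpos: "m x > 0" if "x \<in> S" for x
    proof -
      obtain a b where x: "x = (a, b)" by fastforce
      then have "a \<noteq> 0 \<or> b \<noteq> 0" using that by (auto simp: S_def)
      then show ?thesis by (auto simp: x m_def intro: add_nonneg_pos add_pos_nonneg)
    qed
    have "continuous_on S (\<lambda>x. e x - C2 * f2 x - \<eta> / 2 * m x)"
      using cd p unfolding m_def split_def by (auto intro!: continuous_intros continuous_on_powr')
    then show ?thesis
    proof (rule compact_bound_by_multiple[rotated])
      show "compact S" by (simp add: S_def)
      show "f1 x \<ge> 0" for x by (cases x) (simp add: f1_eq)
      show "e x - C2 * f2 x - \<eta> / 2 * m x < 0" if "x \<in> S" "f1 x = 0" for x
        using e2[OF that] mult_pos_pos[OF half_gt_zero[OF \<eta>] mpos[OF that(1)]] by simp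
    qed (use c1 in auto)
  qed
  then obtain C1 where C1: "C1 \<ge> 0" "\<And>x. x \<in> S \<Longrightarrow> e x - C2 * f2 x - \<eta> / 2 * m x \<le> C1 * f1 x" by blast
  show thesis
  proof (rule that)
    show "C1 \<ge> 0" "C2 \<ge> 0" by fact+
    fix a b :: complex
    show "norm (a - b) powr p + C1 * norm (a * b) powr (p / 2) + C2 * norm ((a + b) / 2) powr p
       \<le> (\<eta> + (C1 + C2) / 2) * (norm a powr p + norm b powr p)"
    proof (cases "(a, b) = 0")
      case True
      then show ?thesis using p by (simp add: zero_prod_def)
    next
      case False
      define t where "t = norm (a, b)"
      have t: "t > 0" using False by (simp add: t_def)
      define u v where "u = a /\<^sub>R t" and "v = b /\<^sub>R t"
      have ab: "a = t *\<^sub>R u" "b = t *\<^sub>R v" using t by (auto simp: u_def v_def)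
      have uv: "(u, v) = (a, b) /\<^sub>R t" by (simp add: u_def v_def)
      have "norm (u, v) = 1" unfolding uv norm_scaleR using t by (simp flip: t_def)
      then have "(u, v) \<in> S" by (simp add: S_def)
      from C1(2)[OF this]
      have uv: "norm (u - v) powr p + C1 * norm (u * v) powr (p / 2) + C2 * norm ((u + v) / 2) powr p
         \<le> (\<eta> + (C1 + C2) / 2) * (norm u powr p + norm v powr p)"
        by (simp add: e_def f1_def f2_def m_def field_simps)
      have sc: "norm (t *\<^sub>R w) powr p = t powr p * norm w powr p" for w :: complex
        using t by (simp add: powr_mult)
      have "norm ((t *\<^sub>R u) * (t *\<^sub>R v)) powr (p / 2) = (t powr (p / 2))\<^sup>2 * norm (u * v) powr (p / 2)"
        using t by (simp add: norm_mult powr_mult power2_eq_square mult_ac)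
      then have sc2: "norm ((t *\<^sub>R u) * (t *\<^sub>R v)) powr (p / 2) = t powr p * norm (u * v) powr (p / 2)"
        by (simp only: powr_half_square)
      have "norm (a - b) powr p + C1 * norm (a * b) powr (p / 2) + C2 * norm ((a + b) / 2) powr p
        = t powr p * (norm (u - v) powr p + C1 * norm (u * v) powr (p / 2) + C2 * norm ((u + v) / 2) powr p)"
      proof -
        have e: "a - b = t *\<^sub>R (u - v)" "(a + b) / 2 = t *\<^sub>R ((u + v) / 2)" "a * b = (t *\<^sub>R u) * (t *\<^sub>R v)"
          by (simp_all add: ab scaleR_conv_of_real algebra_simps add_divide_distrib)
        show ?thesis unfolding e sc sc2 by (simp add: algebra_simps)
      qed
      also have "\<dots> \<le> t powr p * ((\<eta> + (C1 + C2) / 2) * (norm u powr p + norm v powr p))"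
        by (intro mult_left_mono uv) simp
      also have "\<dots> = (\<eta> + (C1 + C2) / 2) * (norm a powr p + norm b powr p)"
        unfolding ab sc by (simp add: algebra_simps)
      finally show ?thesis .
    qed
  qed
qed

section \<open>Closure properties of \<open>holo_on\<close>\<close>

lemma holo_on_const: "holo_on (\<lambda>_. c) S"
  unfolding holo_on_def by (auto intro!: exI[of _ "\<lambda>_. 0"])

lemma holo_on_add:
  assumes "holo_on F S" "holo_on G S"
  shows "holo_on (\<lambda>z. F z + G z) S"
  unfolding holo_on_def
proof
  fix z assume "z \<in> S"
  with assms obtain L L' where L: "(F has_derivative L) (at z)" "\<And>c v. L (c *s v) = c * L v"
    "(G has_derivative L') (at z)" "\<And>c v. L' (c *s v) = c * L' v"
    unfolding holo_on_def by blast
  then show "\<exists>L. ((\<lambda>z. F z + G z) has_derivative L) (at z) \<and> (\<forall>c v. L (c *s v) = c * L v)"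
    by (intro exI[of _ "\<lambda>v. L v + L' v"] conjI has_derivative_add) (auto simp: distrib_left)
qed

lemma holo_on_mult:
  assumes "holo_on F S" "holo_on G S"
  shows "holo_on (\<lambda>z. F z * G z) S"
  unfolding holo_on_def
proof
  fix z assume "z \<in> S"
  with assms obtain L L' where L: "(F has_derivative L) (at z)" "\<And>c v. L (c *s v) = c * L v"
    "(G has_derivative L') (at z)" "\<And>c v. L' (c *s v) = c * L' v"
    unfolding holo_on_def by blast
  then show "\<exists>L. ((\<lambda>z. F z * G z) has_derivative L) (at z) \<and> (\<forall>c v. L (c *s v) = c * L v)"
    by (intro exI[of _ "\<lambda>v. F z * L' v + L v * G z"] conjI has_derivative_mult) (auto simp: algebra_simps)
qed

lemma holo_on_diff:
  assumes "holo_on F S" "holo_on G S"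
  shows "holo_on (\<lambda>z. F z - G z) S"
  using holo_on_add[OF assms(1) holo_on_mult[OF holo_on_const[of "-1"] assms(2)]] by simp

lemma holo_on_prod: "(\<And>j. j \<in> J \<Longrightarrow> holo_on (f j) S) \<Longrightarrow> holo_on (\<lambda>z. \<Prod>j\<in>J. f j z) S"
  by (induction J rule: infinite_finite_induct) (auto intro: holo_on_const holo_on_mult)

lemma holo_on_sum: "(\<And>j. j \<in> J \<Longrightarrow> holo_on (f j) S) \<Longrightarrow> holo_on (\<lambda>z. \<Sum>j\<in>J. f j z) S"
  by (induction J rule: infinite_finite_induct) (auto intro: holo_on_const holo_on_add)

lemma holo_on_power: "holo_on f S \<Longrightarrow> holo_on (\<lambda>z. f z ^ k) S"
  by (induction k) (auto intro: holo_on_const holo_on_mult)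

lemma has_derivative_vec_lambda:
  fixes f :: "'a::euclidean_space \<Rightarrow> 'n::finite \<Rightarrow> 'b::real_normed_vector"
  assumes f: "\<And>j. ((\<lambda>x. f x j) has_derivative (\<lambda>h. f' h j)) (at x within S)"
  shows "((\<lambda>x. \<chi> j. f x j) has_derivative (\<lambda>h. \<chi> j. f' h j)) (at x within S)"
  unfolding has_derivative_def
proof
  have lin: "linear (\<lambda>h. f' h j)" for j
    using has_derivative_bounded_linear[OF f] by (rule bounded_linear.linear)
  have "linear (\<lambda>h. \<chi> j. f' h j)"
    by (rule linearI) (simp_all add: vec_eq_iff linear_add[OF lin] linear_cmul[OF lin])
  then show "bounded_linear (\<lambda>h. \<chi> j. f' h j)" by (simp add: linear_conv_bounded_linear)
  show "((\<lambda>y. ((\<chi> j. f y j) - (\<chi> j. f (Lim (at x within S) (\<lambda>x. x)) j) - (\<chi> j. f' (y - Lim (at x within S) (\<lambda>x. x)) j))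
      /\<^sub>R norm (y - Lim (at x within S) (\<lambda>x. x))) \<longlongrightarrow> 0) (at x within S)"
  proof (rule vec_tendstoI)
    fix j
    show "((\<lambda>y. (((\<chi> j. f y j) - (\<chi> j. f (Lim (at x within S) (\<lambda>x. x)) j) - (\<chi> j. f' (y - Lim (at x within S) (\<lambda>x. x)) j))
      /\<^sub>R norm (y - Lim (at x within S) (\<lambda>x. x))) $ j) \<longlongrightarrow> 0 $ j) (at x within S)"
      using f[of j] unfolding has_derivative_def by simp
  qed
qed

text \<open>The derivative of a coordinatewise holomorphic map is diagonal, hence complex linear.
  Both vertical shifts and the contraction \<open>contr\<close> are of this kind.\<close>

lemma holo_on_coordinatewise:
  fixes F :: "complex^'n \<Rightarrow> complex"
  assumes F: "holo_on F T" and T: "\<And>z. z \<in> S \<Longrightarrow> (\<chi> j. \<psi> j (z $ j)) \<in> T"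
    and \<psi>: "\<And>z j. z \<in> S \<Longrightarrow> \<psi> j field_differentiable at (z $ j)"
  shows "holo_on (\<lambda>z. F (\<chi> j. \<psi> j (z $ j))) S"
  unfolding holo_on_def
proof
  fix z assume z: "z \<in> S"
  obtain L where L: "(F has_derivative L) (at (\<chi> j. \<psi> j (z $ j)))" "\<And>c v. L (c *s v) = c * L v"
    using F T[OF z] unfolding holo_on_def by blast
  obtain D where D: "\<And>j. (\<psi> j has_field_derivative D j) (at (z $ j))"
    using \<psi>[OF z] unfolding field_differentiable_def by metis
  have "((\<lambda>z. \<psi> j (z $ j)) has_derivative (\<lambda>h. D j * h $ j)) (at z)" for j
    using has_derivative_compose[OF bounded_linear_imp_has_derivative[OF bounded_linear_vec_nth[of j]]
        D[of j, unfolded has_field_derivative_def]] .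
  then have "((\<lambda>z. \<chi> j. \<psi> j (z $ j)) has_derivative (\<lambda>h. \<chi> j. D j * h $ j)) (at z)"
    by (rule has_derivative_vec_lambda)
  from has_derivative_compose[OF this L(1)]
  have "((\<lambda>z. F (\<chi> j. \<psi> j (z $ j))) has_derivative (\<lambda>h. L (\<chi> j. D j * h $ j))) (at z)" .
  moreover have "L (\<chi> j. D j * (c *s v) $ j) = c * L (\<chi> j. D j * v $ j)" for c v
  proof -
    have "(\<chi> j. D j * (c *s v) $ j) = c *s (\<chi> j. D j * v $ j)"
      by (simp add: vec_eq_iff mult_ac)
    then show ?thesis by (simp add: L(2))
  qed
  ultimately show "\<exists>L. ((\<lambda>z. F (\<chi> j. \<psi> j (z $ j))) has_derivative L) (at z) \<and> (\<forall>c v. L (c *s v) = c * L v)"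
    by blast
qed

lemma holo_on_coordinate:
  fixes S :: "(complex^'n) set"
  assumes "\<And>z. z \<in> S \<Longrightarrow> \<psi> field_differentiable at (z $ j)"
  shows "holo_on (\<lambda>z. \<psi> (z $ j)) S"
  unfolding holo_on_def
proof
  fix z assume z: "z \<in> S"
  then obtain D where D: "(\<psi> has_field_derivative D) (at (z $ j))"
    using assms unfolding field_differentiable_def by metis
  have "((\<lambda>z. \<psi> (z $ j)) has_derivative (\<lambda>h. D * h $ j)) (at z)"
    using has_derivative_compose[OF bounded_linear_imp_has_derivative[OF bounded_linear_vec_nth[of j]]
        D[unfolded has_field_derivative_def]] .
  then show "\<exists>L. ((\<lambda>z. \<psi> (z $ j)) has_derivative L) (at z) \<and> (\<forall>c v. L (c *s v) = c * L v)"
    by (intro exI[of _ "\<lambda>h. D * h $ j"]) simp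
qed

section \<open>Vertical shifts and quasi-norm estimates for \<open>Hp_pow\<close>\<close>

definition shift :: "real \<Rightarrow> complex^'n \<Rightarrow> complex^'n" where
  "shift d z = (\<chi> j. z $ j + \<i> * of_real d)"

lemma shift_tube_pt: "shift d (tube_pt x y) = tube_pt x (y + vec d)"
  by (simp add: shift_def tube_pt_def vec_eq_iff complex_eq_iff)

lemma holo_on_shift:
  fixes F :: "complex^'n \<Rightarrow> complex"
  assumes "holo_on F tube_dom" "d \<ge> 0"
  shows "holo_on (\<lambda>z. F (shift d z)) tube_dom"
  unfolding shift_def
  by (rule holo_on_coordinatewise[OF assms(1)])
    (use assms(2) in \<open>auto simp: tube_dom_def intro!: derivative_intros add_pos_nonneg\<close>)

lemma hp_int_shift: "hp_int q (\<lambda>z. F (shift d z)) y = hp_int q F (y + vec d)"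
  by (simp add: hp_int_def shift_tube_pt)

lemma Gamma_cone_add_vec: "y \<in> Gamma_cone \<Longrightarrow> d \<ge> 0 \<Longrightarrow> y + vec d \<in> Gamma_cone"
  by (simp add: Gamma_cone_def add_pos_nonneg)

lemma Hp_pow_shift_le: "d \<ge> 0 \<Longrightarrow> Hp_pow q (\<lambda>z. F (shift d z)) \<le> Hp_pow q F"
  unfolding Hp_pow_eq[of q "\<lambda>z. F (shift d z)"] hp_int_shift
  by (intro SUP_least hp_int_le_Hp_pow Gamma_cone_add_vec)

text \<open>Comparison with twice the larger modulus gives a single constant for all q > 0, on both
  sides of q = 1.\<close>

lemma norm_add_powr_le:
  fixes a b :: complex
  assumes "q > 0"
  shows "norm (a + b) powr q \<le> 2 powr q * (norm a powr q + norm b powr q)"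
proof -
  have "norm (a + b) \<le> 2 * max (norm a) (norm b)"
    using norm_triangle_ineq[of a b] by linarith
  then have "norm (a + b) powr q \<le> (2 * max (norm a) (norm b)) powr q"
    using assms by (intro powr_mono2) auto
  also have "\<dots> = 2 powr q * max (norm a) (norm b) powr q" by (simp add: powr_mult)
  also have "max (norm a) (norm b) powr q \<le> norm a powr q + norm b powr q" by (simp add: max_def)
  finally show ?thesis by simp
qed

lemma hp_int_add:
  assumes F: "holo_on F tube_dom" and G: "holo_on G tube_dom" and q: "q > 0" and y: "y \<in> Gamma_cone"
  shows "hp_int q (\<lambda>z. F z + G z) y \<le> 2 powr q * (hp_int q F y + hp_int q G y)"
proof -
  have [measurable]: "(\<lambda>x. F (tube_pt x y)) \<in> borel_measurable borel"
    "(\<lambda>x. G (tube_pt x y)) \<in> borel_measurable borel"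
    using borel_measurable_slice F G y by blast+
  have "hp_int q (\<lambda>z. F z + G z) y
      \<le> (\<integral>\<^sup>+ x. ennreal (2 powr q) * (ennreal (norm (F (tube_pt x y)) powr q) + ennreal (norm (G (tube_pt x y)) powr q)) \<partial>lborel)"
    unfolding hp_int_def
    by (intro nn_integral_mono) (simp add: norm_add_powr_le[OF q] ennreal_leI flip: ennreal_plus ennreal_mult)
  also have "\<dots> = 2 powr q * (hp_int q F y + hp_int q G y)"
    unfolding hp_int_def by (simp add: nn_integral_cmult nn_integral_add)
  finally show ?thesis .
qed

lemma Hp_pow_add:
  assumes F: "holo_on F tube_dom" and G: "holo_on G tube_dom" and q: "q > 0"
  shows "Hp_pow q (\<lambda>z. F z + G z) \<le> 2 powr q * (Hp_pow q F + Hp_pow q G)"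
  unfolding Hp_pow_eq[of q "\<lambda>z. F z + G z"]
  by (intro SUP_least order_trans[OF hp_int_add[OF F G q]] mult_left_mono add_mono hp_int_le_Hp_pow) auto

lemma Hp_pow_dominated:
  assumes G: "holo_on G tube_dom" and le: "\<And>z. z \<in> tube_dom \<Longrightarrow> norm (F z) \<le> c * norm (G z)"
    and c: "c \<ge> 0" and q: "q > 0"
  shows "Hp_pow q F \<le> ennreal (c powr q) * Hp_pow q G"
  unfolding Hp_pow_eq[of q F]
proof (rule SUP_least)
  fix y :: "real^'a" assume y: "y \<in> Gamma_cone"
  have [measurable]: "(\<lambda>x. G (tube_pt x y)) \<in> borel_measurable borel"
    using borel_measurable_slice[OF G y] .
  have "hp_int q F y \<le> (\<integral>\<^sup>+ x. ennreal (c powr q) * ennreal (norm (G (tube_pt x y)) powr q) \<partial>lborel)"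
    unfolding hp_int_def
  proof (rule nn_integral_mono)
    fix x
    have "norm (F (tube_pt x y)) powr q \<le> (c * norm (G (tube_pt x y))) powr q"
      using q le y by (intro powr_mono2) (auto simp: tube_pt_in_tube_dom)
    then show "ennreal (norm (F (tube_pt x y)) powr q) \<le> ennreal (c powr q) * ennreal (norm (G (tube_pt x y)) powr q)"
      using c by (simp add: powr_mult ennreal_leI flip: ennreal_mult)
  qed
  also have "\<dots> = ennreal (c powr q) * hp_int q G y" unfolding hp_int_def by (simp add: nn_integral_cmult)
  also have "\<dots> \<le> ennreal (c powr q) * Hp_pow q G" by (intro mult_left_mono hp_int_le_Hp_pow y) auto
  finally show "hp_int q F y \<le> ennreal (c powr q) * Hp_pow q G" .
qed

lemma Hp_pow_dominated_finite:
  assumes "holo_on G tube_dom" "\<And>z. z \<in> tube_dom \<Longrightarrow> norm (F z) \<le> c * norm (G z)"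
    and "c \<ge> 0" "q > 0" "Hp_pow q G < \<infinity>"
  shows "Hp_pow q F < \<infinity>"
proof -
  have "Hp_pow q F \<le> ennreal (c powr q) * Hp_pow q G"
    by (rule Hp_pow_dominated) (use assms in auto)
  also have "\<dots> < \<infinity>" using assms(5) by (simp add: ennreal_mult_less_top)
  finally show ?thesis .
qed

lemma Hp_pow_cong: "(\<And>z. z \<in> tube_dom \<Longrightarrow> norm (F z) = norm (G z)) \<Longrightarrow> Hp_pow q F = Hp_pow q G"
  unfolding Hp_pow_def by (intro SUP_cong refl nn_integral_cong) (simp add: tube_pt_in_tube_dom)

lemma Hp_pow_diff:
  assumes F: "holo_on F tube_dom" and G: "holo_on G tube_dom" and q: "q > 0"
  shows "Hp_pow q (\<lambda>z. F z - G z) \<le> 2 powr q * (Hp_pow q F + Hp_pow q G)"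
  using Hp_pow_add[OF F holo_on_mult[OF holo_on_const[of "-1"] G] q]
    Hp_pow_cong[of G "\<lambda>z. -1 * G z" q] by (simp add: norm_mult)

lemma Hp_pow_add_finite:
  assumes "holo_on F tube_dom" "holo_on G tube_dom" "q > 0" "Hp_pow q F < \<infinity>" "Hp_pow q G < \<infinity>"
  shows "Hp_pow q (\<lambda>z. F z + G z) < \<infinity>"
  using Hp_pow_add[OF assms(1-3)] by (rule le_less_trans) (use assms in \<open>simp add: ennreal_mult_less_top\<close>)

lemma Hp_pow_diff_finite:
  assumes "holo_on F tube_dom" "holo_on G tube_dom" "q > 0" "Hp_pow q F < \<infinity>" "Hp_pow q G < \<infinity>"
  shows "Hp_pow q (\<lambda>z. F z - G z) < \<infinity>"
  using Hp_pow_diff[OF assms(1-3)] by (rule le_less_trans) (use assms in \<open>simp add: ennreal_mult_less_top\<close>)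

text \<open>The pointwise inequality of arithmetic and geometric means takes the place of
  Cauchy-Schwarz.\<close>

lemma Hp_pow_mult_finite:
  fixes F :: "complex^'n \<Rightarrow> complex"
  assumes F: "holo_on F tube_dom" and G: "holo_on G tube_dom"
    and "Hp_pow p F < \<infinity>" "Hp_pow p G < \<infinity>"
  shows "Hp_pow (p / 2) (\<lambda>z. F z * G z) < \<infinity>"
proof -
  have "hp_int (p / 2) (\<lambda>z. F z * G z) y \<le> Hp_pow p F + Hp_pow p G" if y: "y \<in> Gamma_cone" for y
  proof -
    have [measurable]: "(\<lambda>x. F (tube_pt x y)) \<in> borel_measurable borel"
      "(\<lambda>x. G (tube_pt x y)) \<in> borel_measurable borel"
      using borel_measurable_slice F G y by blast+
    have le: "norm (a * b) powr (p / 2) \<le> norm a powr p + norm b powr p" for a b :: complex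
    proof -
      have "norm (a * b) powr (p / 2) \<le> (norm a powr p + norm b powr p) / 2"
        using norm_mult_powr_half[where a=a and b=b and p=p] zero_le_power2[of "norm a powr (p / 2) - norm b powr (p / 2)"] by linarith
      also have "\<dots> \<le> norm a powr p + norm b powr p" by simp
      finally show ?thesis .
    qed
    have "hp_int (p / 2) (\<lambda>z. F z * G z) y
      \<le> (\<integral>\<^sup>+ x. ennreal (norm (F (tube_pt x y)) powr p) + ennreal (norm (G (tube_pt x y)) powr p) \<partial>lborel)"
      unfolding hp_int_def by (intro nn_integral_mono) (simp add: le ennreal_leI flip: ennreal_plus)
    also have "\<dots> = hp_int p F y + hp_int p G y" unfolding hp_int_def by (simp add: nn_integral_add)
    also have "\<dots> \<le> Hp_pow p F + Hp_pow p G" using y by (intro add_mono hp_int_le_Hp_pow)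
    finally show ?thesis .
  qed
  then have "Hp_pow (p / 2) (\<lambda>z. F z * G z) \<le> Hp_pow p F + Hp_pow p G"
    unfolding Hp_pow_eq[of "p / 2"] by (rule SUP_least)
  also have "\<dots> < \<infinity>" using assms by simp
  finally show ?thesis .
qed

text \<open>
  The means of \<open>|F F\<^sub>\<delta>|\<^bsup>p/2\<^esup>\<close> and \<open>|(F + F\<^sub>\<delta>)/2|\<^sup>p\<close> decrease in the height, so near the
  boundary they are at least their values at a fixed height, which Fatou's lemma bounds from below
  by almost the full norm of \<open>F\<close>. By \<open>norm_diff_powr_le\<close> this leaves no room for \<open>F - F\<^sub>\<delta>\<close>.
\<close>

lemma Hp_shift_tendsto:
  fixes F :: "complex^'n \<Rightarrow> complex"
  assumes F: "holo_on F tube_dom" and fin: "Hp_pow p F < \<infinity>" and p: "p > 0" and \<epsilon>: "\<epsilon> > 0"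
  obtains d where "0 < d" "d \<le> 1" "Hp_pow p (\<lambda>z. F z - F (shift d z)) < ennreal \<epsilon>"
proof (cases "Hp_pow p F = 0")
  case True
  have "Hp_pow p (\<lambda>z. F (shift 1 z)) \<le> Hp_pow p F" by (rule Hp_pow_shift_le) simp
  with True have "Hp_pow p (\<lambda>z. F (shift 1 z)) = 0" by simp
  with Hp_pow_diff[OF F holo_on_shift[OF F, of 1] p] True
  have "Hp_pow p (\<lambda>z. F z - F (shift 1 z)) = 0" by simp
  then show ?thesis using that[of 1] \<epsilon> by simp
next
  case False
  obtain M where M: "Hp_pow p F = ennreal M" "M \<ge> 0" using fin by (cases "Hp_pow p F") auto
  have Mpos: "M > 0" using False M by (cases "M = 0") auto
  \<comment> \<open>Chosen so that 2 * \<eta> * M = \<epsilon> / 4; the case of norm zero was split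
    off because of this division.\<close>
  define \<eta> where "\<eta> = \<epsilon> / (8 * M)"
  have \<eta>: "\<eta> > 0" using \<epsilon> Mpos by (simp add: \<eta>_def)
  obtain C1 C2 where C: "C1 \<ge> 0" "C2 \<ge> 0"
    "\<And>a b :: complex. norm (a - b) powr p + C1 * norm (a * b) powr (p / 2) + C2 * norm ((a + b) / 2) powr p
       \<le> (\<eta> + (C1 + C2) / 2) * (norm a powr p + norm b powr p)"
    using norm_diff_powr_le[OF p \<eta>] by metis
  \<comment> \<open>Makes (C1 + C2) * \<zeta> at most \<epsilon> / 4; the added 1 avoids division by
    zero.\<close>
  define \<zeta> where "\<zeta> = \<epsilon> / 4 / (C1 + C2 + 1)"
  have \<zeta>: "\<zeta> > 0" using \<epsilon> C by (simp add: \<zeta>_def)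
  \<comment> \<open>Truncated at 0 because \<open>ennreal\<close> collapses negative numbers; L
    remains strictly below M.\<close>
  define L where "L = max 0 (M - \<zeta>)"
  have L: "0 \<le> L" "L < M" "M - \<zeta> \<le> L" using Mpos \<zeta> by (auto simp: L_def)
  have "ennreal L < (SUP y\<in>Gamma_cone. hp_int p F y)"
    unfolding Hp_pow_eq[symmetric] M using L by (simp add: ennreal_less_iff)
  then obtain t where t: "t \<in> Gamma_cone" "ennreal L < hp_int p F t" by (auto simp: less_SUP_iff)
  define \<delta> where "\<delta> k = 1 / (real k + 1)" for k
  have \<delta>: "0 < \<delta> k" "\<delta> k \<le> 1" for k by (auto simp: \<delta>_def)
  have \<delta>lim: "\<delta> \<longlonglongrightarrow> 0" unfolding \<delta>_def by real_asymp
  define P where "P k z = F z * F (shift (\<delta> k) z)" for k z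
  define S where "S k z = (F z + F (shift (\<delta> k) z)) / 2" for k z
  have Fs: "holo_on (\<lambda>z. F (shift (\<delta> k) z)) tube_dom" for k
    using holo_on_shift[OF F] \<delta>(1)[of k] by simp
  have fins: "Hp_pow p (\<lambda>z. F (shift (\<delta> k) z)) < \<infinity>" for k
    using Hp_pow_shift_le[of "\<delta> k" p F] \<delta>(1)[of k] fin by (auto elim: le_less_trans)
  have P: "holo_on (P k) tube_dom" "Hp_pow (p / 2) (P k) < \<infinity>" for k
    unfolding P_def using holo_on_mult[OF F Fs] Hp_pow_mult_finite[OF F Fs fin fins] by auto
  have S: "holo_on (S k) tube_dom" "Hp_pow p (S k) < \<infinity>" for k
  proof -
    have h: "holo_on (\<lambda>z. F z + F (shift (\<delta> k) z)) tube_dom" by (rule holo_on_add[OF F Fs])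
    have S_eq: "S k = (\<lambda>z. (1/2) * (F z + F (shift (\<delta> k) z)))" by (simp add: S_def fun_eq_iff)
    show "holo_on (S k) tube_dom" unfolding S_eq by (rule holo_on_mult[OF holo_on_const h])
    have "Hp_pow p (\<lambda>z. F z + F (shift (\<delta> k) z)) < \<infinity>"
      by (rule Hp_pow_add_finite[OF F Fs p fin fins])
    moreover have "norm (S k z) \<le> 1/2 * norm (F z + F (shift (\<delta> k) z))" for z
      unfolding S_eq norm_mult by simp
    ultimately show "Hp_pow p (S k) < \<infinity>"
      using Hp_pow_dominated_finite[where F="S k" and c="1/2", OF h _ _ p] by simp
  qed
  have Flim: "(\<lambda>k. F (shift (\<delta> k) (tube_pt x t))) \<longlonglongrightarrow> F (tube_pt x t)" for x
  proof -
    have "(\<lambda>k. F (tube_pt x (t + \<delta> k *\<^sub>R vec 1))) \<longlonglongrightarrow> F (tube_pt x (t + 0 *\<^sub>R vec 1))"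
    proof (rule continuous_on_tendsto_compose[where s="{0..}" and f="\<lambda>d. F (tube_pt x (t + d *\<^sub>R vec 1))"])
      show "continuous_on {0..} (\<lambda>d. F (tube_pt x (t + d *\<^sub>R vec 1)))"
        by (rule continuous_on_compose2[OF holo_on_imp_continuous_on[OF F]])
          (use t in \<open>auto intro!: continuous_intros add_pos_nonneg simp: tube_pt_in_tube_dom Gamma_cone_def\<close>)
    qed (use \<delta>lim \<delta> less_imp_le in \<open>auto intro!: always_eventually\<close>)
    moreover have "\<delta> k *\<^sub>R vec 1 = (vec (\<delta> k) :: real^'n)" for k by (simp add: vec_eq_iff)
    ultimately show ?thesis by (simp add: shift_tube_pt)
  qed
  have fatou: "\<forall>\<^sub>F k in sequentially. ennreal L < hp_int r (H k) t"
    if H: "\<And>k. holo_on (H k) tube_dom"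
      and lim: "\<And>x. (\<lambda>k. norm (H k (tube_pt x t)) powr r) \<longlonglongrightarrow> norm (F (tube_pt x t)) powr p" for H r
  proof -
    have "hp_int p F t = (\<integral>\<^sup>+ x. liminf (\<lambda>k. ennreal (norm (H k (tube_pt x t)) powr r)) \<partial>lborel)"
      unfolding hp_int_def
      by (intro nn_integral_cong lim_imp_Liminf[symmetric] tendsto_ennrealI lim) simp
    also have "\<dots> \<le> liminf (\<lambda>k. hp_int r (H k) t)"
      unfolding hp_int_def using borel_measurable_slice[OF H t(1)]
      by (intro nn_integral_liminf) simp
    finally have "ennreal L < liminf (\<lambda>k. hp_int r (H k) t)" using t(2) by (rule less_le_trans[rotated])
    then show ?thesis by (rule less_LiminfD)
  qed
  have "\<forall>\<^sub>F k in sequentially. ennreal L < hp_int (p / 2) (P k) t"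
  proof (rule fatou[OF P(1)])
    fix x
    have "(\<lambda>k. norm (P k (tube_pt x t)) powr (p / 2)) \<longlonglongrightarrow> norm (F (tube_pt x t) * F (tube_pt x t)) powr (p / 2)"
      unfolding P_def using p by (intro tendsto_powr' tendsto_intros Flim) auto
    also have "norm (F (tube_pt x t) * F (tube_pt x t)) powr (p / 2) = norm (F (tube_pt x t)) powr p"
      by (simp add: norm_mult powr_mult powr_add[symmetric])
    finally show "(\<lambda>k. norm (P k (tube_pt x t)) powr (p / 2)) \<longlonglongrightarrow> norm (F (tube_pt x t)) powr p" .
  qed
  moreover have "\<forall>\<^sub>F k in sequentially. ennreal L < hp_int p (S k) t"
  proof (rule fatou[OF S(1)])
    fix x
    have "(\<lambda>k. norm (S k (tube_pt x t)) powr p) \<longlonglongrightarrow> norm ((F (tube_pt x t) + F (tube_pt x t)) / 2) powr p"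
      unfolding S_def using p by (intro tendsto_powr' tendsto_intros Flim) auto
    then show "(\<lambda>k. norm (S k (tube_pt x t)) powr p) \<longlonglongrightarrow> norm (F (tube_pt x t)) powr p" by simp
  qed
  ultimately have "\<forall>\<^sub>F k in sequentially. ennreal L < hp_int (p / 2) (P k) t \<and> ennreal L < hp_int p (S k) t"
    by eventually_elim auto
  then obtain k where k: "ennreal L < hp_int (p / 2) (P k) t" "ennreal L < hp_int p (S k) t"
    using eventually_happens[of _ sequentially] by auto
  define D where "D z = F z - F (shift (\<delta> k) z)" for z
  have Dh: "holo_on D tube_dom" unfolding D_def by (rule holo_on_diff[OF F Fs])
  have Dfin: "Hp_pow p D < \<infinity>"
    unfolding D_def by (rule Hp_pow_diff_finite[OF F Fs p fin fins])
  \<comment> \<open>Below t both comparison means exceed L, and the total available is about (C1 +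
    C2) * M, so the mean of \<open>D\<close> is at most 2 * \<eta> * M + (C1 + C2) * (M -
    L).\<close>
  have low: "hp_int p D y \<le> ennreal (\<epsilon> / 2)" if y: "y \<in> Gamma_cone" and yt: "\<And>j. y $ j < t $ j" for y
  proof -
    have [measurable]: "(\<lambda>x. F (tube_pt x y)) \<in> borel_measurable borel"
      "(\<lambda>x. F (shift (\<delta> k) (tube_pt x y))) \<in> borel_measurable borel"
      using borel_measurable_slice F Fs y by blast+
    have "hp_int (p / 2) (P k) t \<le> hp_int (p / 2) (P k) y"
      by (rule hp_int_antimono[OF P _ y yt]) (use p in simp)
    with k(1) have "ennreal L \<le> hp_int (p / 2) (P k) y" by simp
    moreover have "ennreal L \<le> hp_int p (S k) y"
      using less_le_trans[OF k(2) hp_int_antimono[OF S p y yt]] by simp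
    ultimately have "hp_int p D y + ennreal C1 * ennreal L + ennreal C2 * ennreal L
      \<le> hp_int p D y + ennreal C1 * hp_int (p / 2) (P k) y + ennreal C2 * hp_int p (S k) y"
      by (intro add_mono mult_left_mono) auto
    also have "\<dots> = (\<integral>\<^sup>+ x. ennreal (norm (F (tube_pt x y) - F (shift (\<delta> k) (tube_pt x y))) powr p)
        + ennreal C1 * ennreal (norm (F (tube_pt x y) * F (shift (\<delta> k) (tube_pt x y))) powr (p / 2))
        + ennreal C2 * ennreal (norm ((F (tube_pt x y) + F (shift (\<delta> k) (tube_pt x y))) / 2) powr p) \<partial>lborel)"
      unfolding hp_int_def P_def S_def D_def
      by (simp add: nn_integral_add nn_integral_cmult)
    also have "\<dots> \<le> (\<integral>\<^sup>+ x. ennreal (\<eta> + (C1 + C2) / 2) * (ennreal (norm (F (tube_pt x y)) powr p)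
        + ennreal (norm (F (shift (\<delta> k) (tube_pt x y))) powr p)) \<partial>lborel)"
      by (intro nn_integral_mono) (use C \<eta> in \<open>simp add: ennreal_leI flip: ennreal_plus ennreal_mult\<close>)
    also have "\<dots> = ennreal (\<eta> + (C1 + C2) / 2) * (hp_int p F y + hp_int p (\<lambda>z. F (shift (\<delta> k) z)) y)"
      unfolding hp_int_def by (subst nn_integral_cmult, simp, subst nn_integral_add) auto
    also have "\<dots> \<le> ennreal (\<eta> + (C1 + C2) / 2) * (ennreal M + ennreal M)"
      unfolding hp_int_shift M(1)[symmetric] using y less_imp_le[OF \<delta>(1)]
      by (intro mult_left_mono add_mono hp_int_le_Hp_pow Gamma_cone_add_vec) auto
    finally have *: "hp_int p D y + ennreal C1 * ennreal L + ennreal C2 * ennreal L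
       \<le> ennreal (\<eta> + (C1 + C2) / 2) * (ennreal M + ennreal M)" .
    have "hp_int p D y < \<infinity>" using hp_int_le_Hp_pow[OF y] Dfin by (rule le_less_trans)
    then obtain h where h: "hp_int p D y = ennreal h" "h \<ge> 0" by (cases "hp_int p D y") auto
    have "hp_int p D y + ennreal C1 * ennreal L + ennreal C2 * ennreal L = ennreal (h + C1 * L + C2 * L)"
      using C(1,2) L(1) h by (simp add: ennreal_plus ennreal_mult)
    moreover have "ennreal (\<eta> + (C1 + C2) / 2) * (ennreal M + ennreal M) = ennreal ((\<eta> + (C1 + C2) / 2) * (M + M))"
    proof -
      have "ennreal M + ennreal M = ennreal (M + M)" using M(2) by (simp only: ennreal_plus)
      moreover have "0 \<le> \<eta> + (C1 + C2) / 2" "0 \<le> M + M" using C(1,2) M(2) \<eta> by auto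
      ultimately show ?thesis by (simp only: ennreal_mult)
    qed
    ultimately have "ennreal (h + C1 * L + C2 * L) \<le> ennreal ((\<eta> + (C1 + C2) / 2) * (M + M))"
      using * by simp
    then have "h + C1 * L + C2 * L \<le> (\<eta> + (C1 + C2) / 2) * (M + M)"
      using C M \<eta> by (subst (asm) ennreal_le_iff) auto
    then have "h \<le> 2 * \<eta> * M + (C1 + C2) * (M - L)" by (simp add: field_simps)
    also have "\<dots> \<le> 2 * \<eta> * M + (C1 + C2) * \<zeta>"
      using C L by (intro add_left_mono mult_left_mono) auto
    also have "2 * \<eta> * M = \<epsilon> / 4" using Mpos by (simp add: \<eta>_def)
    also have "(C1 + C2) * \<zeta> \<le> \<epsilon> / 4"
    proof -
      have "(C1 + C2) * \<zeta> \<le> (C1 + C2 + 1) * \<zeta>" using \<zeta> by (intro mult_right_mono) auto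
      also have "\<dots> = \<epsilon> / 4"
      proof -
        have cancel: "s * (\<epsilon> / 4 / s) = \<epsilon> / 4" if "s > 0" for s :: real using that by simp
        show ?thesis unfolding \<zeta>_def by (rule cancel) (use C(1,2) in simp)
      qed
      finally show ?thesis .
    qed
    finally show ?thesis using h by (simp add: ennreal_leI)
  qed
  have "hp_int p D y \<le> ennreal (\<epsilon> / 2)" if y: "y \<in> Gamma_cone" for y
  proof -
    \<comment> \<open>A height below both y and t: monotonicity of the means of \<open>D\<close>
      itself passes from y' to an arbitrary y.\<close>
    define y' where "y' = (\<chi> j. min (y $ j) (t $ j) / 2)"
    have "0 < min a b / 2 \<and> min a b / 2 < a \<and> min a b / 2 < b" if "0 < a" "0 < b" for a b :: real
      using that by (auto simp: min_def)
    then have y': "y' \<in> Gamma_cone" "\<And>j. y' $ j < y $ j" "\<And>j. y' $ j < t $ j"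
      using y t(1) by (auto simp: y'_def Gamma_cone_def)
    have "hp_int p D y \<le> hp_int p D y'" by (rule hp_int_antimono[OF Dh Dfin p y'(1,2)])
    also have "\<dots> \<le> ennreal (\<epsilon> / 2)" by (rule low[OF y'(1,3)])
    finally show ?thesis .
  qed
  then have "Hp_pow p D \<le> ennreal (\<epsilon> / 2)" unfolding Hp_pow_eq by (rule SUP_least)
  also have "\<dots> < ennreal \<epsilon>" using \<epsilon> by (simp add: ennreal_less_iff)
  finally show ?thesis using that[of "\<delta> k"] \<delta> by (simp add: D_def[abs_def])
qed

section \<open>Rational approximation\<close>

text \<open>Every height of the shifted function lies strictly above \<open>vec d\<close>, so by
  monotonicity one integral controls the whole supremum.\<close>

lemma Hp_pow_shift_le_hp_int:
  fixes E :: "complex^'n \<Rightarrow> complex"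
  assumes "holo_on E tube_dom" "Hp_pow q E < \<infinity>" "q > 0" "d > 0"
  shows "Hp_pow q (\<lambda>z. E (shift d z)) \<le> hp_int q E (vec d)"
  unfolding Hp_pow_eq[of q "\<lambda>z. E (shift d z)"] hp_int_shift
  by (intro SUP_least hp_int_antimono assms) (use assms in \<open>auto simp: Gamma_cone_def\<close>)

text \<open>Pointwise convergence is needed on the plane of height d alone, where |G|^p is the
  integrable majorant. The domination on the whole tube keeps each \<open>E k\<close> in H^p, as
  monotonicity demands.\<close>

lemma Hp_shift_dominated_tendsto:
  fixes G :: "complex^'n \<Rightarrow> complex"
  assumes E: "\<And>k. holo_on (E k) tube_dom" and G: "holo_on G tube_dom" "Hp_pow p G < \<infinity>"
    and le: "\<And>k z. z \<in> tube_dom \<Longrightarrow> norm (E k z) \<le> c * norm (G z)"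
    and c: "c \<ge> 0" and p: "p > 0" and d: "d > 0"
    and lim: "\<And>x. (\<lambda>k. E k (tube_pt x (vec d))) \<longlonglongrightarrow> 0"
  shows "(\<lambda>k. Hp_pow p (\<lambda>z. E k (shift d z))) \<longlonglongrightarrow> 0"
proof -
  have dG: "vec d \<in> (Gamma_cone :: (real^'n) set)" using d by (simp add: Gamma_cone_def)
  have [measurable]: "(\<lambda>x. E k (tube_pt x (vec d))) \<in> borel_measurable borel" for k
    by (rule borel_measurable_slice[OF E dG])
  have [measurable]: "(\<lambda>x. G (tube_pt x (vec d))) \<in> borel_measurable borel"
    by (rule borel_measurable_slice[OF G(1) dG])
  have fin: "Hp_pow p (E k) < \<infinity>" for k
    using Hp_pow_dominated_finite[where F="E k" and c=c, OF G(1) _ c p G(2)] le by blast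
  have "(\<lambda>k. \<integral>\<^sup>+ x. ennreal (norm (E k (tube_pt x (vec d))) powr p) \<partial>lborel)
      \<longlonglongrightarrow> (\<integral>\<^sup>+ x. 0 \<partial>(lborel :: (real^'n) measure))"
  proof (rule nn_integral_dominated_convergence[where w="\<lambda>x. ennreal (c powr p) * ennreal (norm (G (tube_pt x (vec d))) powr p)"])
    show "AE x in lborel. ennreal (norm (E k (tube_pt x (vec d))) powr p)
        \<le> ennreal (c powr p) * ennreal (norm (G (tube_pt x (vec d))) powr p)" for k
    proof (rule AE_I2)
      fix x :: "real^'n"
      have "norm (E k (tube_pt x (vec d))) powr p \<le> (c * norm (G (tube_pt x (vec d)))) powr p"
        using p by (intro powr_mono2 le) (auto simp: tube_pt_in_tube_dom dG)
      then show "ennreal (norm (E k (tube_pt x (vec d))) powr p)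
          \<le> ennreal (c powr p) * ennreal (norm (G (tube_pt x (vec d))) powr p)"
        using c by (simp add: powr_mult ennreal_leI flip: ennreal_mult)
    qed
    have "hp_int p G (vec d) < \<infinity>" using hp_int_le_Hp_pow[OF dG] G(2) by (rule le_less_trans)
    then show "(\<integral>\<^sup>+ x. ennreal (c powr p) * ennreal (norm (G (tube_pt x (vec d))) powr p) \<partial>lborel) < \<infinity>"
      by (simp add: nn_integral_cmult hp_int_def ennreal_mult_less_top)
    show "AE x in lborel. (\<lambda>k. ennreal (norm (E k (tube_pt x (vec d))) powr p)) \<longlonglongrightarrow> 0"
    proof (rule AE_I2)
      fix x
      have "(\<lambda>k. ennreal (norm (E k (tube_pt x (vec d))) powr p)) \<longlonglongrightarrow> ennreal (norm (0::complex) powr p)"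
        using p by (intro tendsto_ennrealI tendsto_powr' tendsto_norm lim tendsto_const) auto
      then show "(\<lambda>k. ennreal (norm (E k (tube_pt x (vec d))) powr p)) \<longlonglongrightarrow> 0" by simp
    qed
  qed auto
  then have "(\<lambda>k. hp_int p (E k) (vec d)) \<longlonglongrightarrow> 0" by (simp add: hp_int_def)
  then show ?thesis
    by (rule tendsto_sandwich[OF _ _ tendsto_const, rotated 2])
      (use Hp_pow_shift_le_hp_int[OF E fin p d] in auto)
qed

section \<open>Integrability of the weight\<close>

lemma nn_integral_powr_tail:
  fixes a c :: real
  assumes a: "a > 1" and c: "c > 0"
  shows "(\<integral>\<^sup>+ x. ennreal ((\<bar>x\<bar> + c) powr (- a)) \<partial>lborel) < \<infinity>"
proof -
  define F where "F x = - ((x + c) powr (1 - a)) / (a - 1)" for x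
  define f where "f x = (\<bar>x\<bar> + c) powr (- a)" for x
  have f [measurable]: "f \<in> borel_measurable borel" unfolding f_def by measurable
  have "(\<integral>\<^sup>+ x. ennreal (f x) * indicator {0..} x \<partial>lborel) = ennreal (0 - F 0)"
  proof (rule nn_integral_FTC_atLeast)
    fix x :: real assume x: "0 \<le> x"
    show "(F has_real_derivative f x) (at x)"
    proof -
      have "((\<lambda>x. (x + c) powr (1 - a)) has_real_derivative (1 - a) * (x + c) powr (- a)) (at x)"
        using x c by (auto intro!: derivative_eq_intros)
      from DERIV_cdivide[OF DERIV_minus[OF this], of "a - 1"]
      have "(F has_real_derivative - ((1 - a) * (x + c) powr (- a)) / (a - 1)) (at x)"
        by (simp add: F_def[abs_def])
      moreover have "- ((1 - a) * (x + c) powr (- a)) / (a - 1) = f x"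
        using a x by (simp add: f_def field_simps)
      ultimately show ?thesis by simp
    qed
    show "0 \<le> f x" by (simp add: f_def)
  next
    have "filterlim (\<lambda>x. x + c) at_top at_top" by real_asymp
    then have "((\<lambda>x. (x + c) powr (1 - a)) \<longlongrightarrow> 0) at_top"
      by (rule tendsto_neg_powr[rotated]) (use a in simp)
    from tendsto_divide[OF tendsto_minus[OF this] tendsto_const[of "a - 1"]] a
    show "(F \<longlongrightarrow> 0) at_top" by (simp add: F_def[abs_def])
  qed measurable
  then have pos: "(\<integral>\<^sup>+ x. ennreal (f x) * indicator {0..} x \<partial>lborel) < \<infinity>" by simp
  have "(\<integral>\<^sup>+ x. ennreal (f x) * indicator {0..} x \<partial>lborel) = (\<integral>\<^sup>+ x. ennreal (f (- x)) * indicator {0..} (- x) \<partial>lborel)"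
    using nn_integral_real_affine[of "\<lambda>x. ennreal (f x) * indicator {0..} x" "-1" 0] by simp
  also have "\<dots> = (\<integral>\<^sup>+ x. ennreal (f x) * indicator {..0} x \<partial>lborel)"
    by (intro nn_integral_cong) (auto simp: f_def indicator_def)
  finally have neg: "(\<integral>\<^sup>+ x. ennreal (f x) * indicator {..0} x \<partial>lborel) < \<infinity>" using pos by simp
  have "(\<integral>\<^sup>+ x. ennreal (f x) \<partial>lborel)
      \<le> (\<integral>\<^sup>+ x. ennreal (f x) * indicator {0..} x + ennreal (f x) * indicator {..0} x \<partial>lborel)"
    by (intro nn_integral_mono) (auto simp: indicator_def)
  also have "\<dots> = (\<integral>\<^sup>+ x. ennreal (f x) * indicator {0..} x \<partial>lborel) + (\<integral>\<^sup>+ x. ennreal (f x) * indicator {..0} x \<partial>lborel)"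
    by (rule nn_integral_add) auto
  also have "\<dots> < \<infinity>" using pos neg by simp
  finally show ?thesis by (simp add: f_def)
qed

lemma nn_integral_prod_components:
  fixes h :: "real \<Rightarrow> ennreal"
  assumes "h \<in> borel_measurable borel"
  shows "(\<integral>\<^sup>+ x. (\<Prod>j\<in>UNIV. h (x $ j)) \<partial>(lborel :: (real^'n) measure)) = (\<integral>\<^sup>+ x. h x \<partial>lborel) ^ CARD('n)"
proof -
  have B: "(Basis :: (real^'n) set) = range (\<lambda>j. axis j 1)" by (auto simp: Basis_vec_def)
  have inj: "inj (\<lambda>j :: 'n. axis j (1::real))" by (auto simp: inj_on_def axis_eq_axis)
  have "(\<Prod>b\<in>Basis. h (x \<bullet> b)) = (\<Prod>j\<in>UNIV. h (x $ j))" for x :: "real^'n"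
    unfolding B by (subst prod.reindex[OF inj]) (simp add: inner_axis)
  then have "(\<integral>\<^sup>+ x. (\<Prod>j\<in>UNIV. h (x $ j)) \<partial>(lborel :: (real^'n) measure))
      = (\<integral>\<^sup>+ x. (\<Prod>b\<in>Basis. h (x \<bullet> b)) \<partial>(lborel :: (real^'n) measure))" by simp
  also have "\<dots> = (\<Prod>b\<in>(Basis :: (real^'n) set). \<integral>\<^sup>+ x. h x \<partial>lborel)"
    by (rule nn_integral_lborel_prod) (use assms in auto)
  also have "\<dots> = (\<integral>\<^sup>+ x. h x \<partial>lborel) ^ CARD('n)" by simp
  finally show ?thesis .
qed

definition weight :: "nat \<Rightarrow> complex^'n \<Rightarrow> complex" where
  "weight N z = (\<Prod>j\<in>UNIV. inverse (z $ j + \<i>) ^ (N + 1))"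

text \<open>For d <= 1/2 the imaginary parts y_j - d + 1 exceed 1/2, whence |z_j + i - id| >= (|x_j|
  + 1/2) / 2 independently of y. The product of the resulting one-dimensional integrals is finite
  because (N + 1) p > 1. W serves all E, B and d, so B may be chosen afterwards.\<close>

lemma weight_Hp_bound:
  fixes p :: real
  assumes p: "p > 0" and N: "real (N + 1) * p > 1"
  obtains W where "W \<ge> 0"
    "\<And>(E :: complex^'n \<Rightarrow> complex) B d. B \<ge> 0 \<Longrightarrow> d \<le> 1/2 \<Longrightarrow>
      (\<And>z. z \<in> tube_dom \<Longrightarrow> norm (E z) \<le> B * norm (weight N (shift (- d) z))) \<Longrightarrow>
      Hp_pow p E \<le> ennreal (B powr p * W)"
proof -
  define a where "a = real (N + 1) * p"
  define h where "h x = 2 powr a * (\<bar>x\<bar> + 1/2) powr (- a)" for x :: real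
  have hm [measurable]: "h \<in> borel_measurable borel" unfolding h_def by measurable
  have h0: "h x \<ge> 0" for x by (simp add: h_def)
  have "(\<integral>\<^sup>+ x. ennreal (h x) \<partial>lborel) = ennreal (2 powr a) * (\<integral>\<^sup>+ x. ennreal ((\<bar>x\<bar> + 1/2) powr (- a)) \<partial>lborel)"
    unfolding h_def by (subst nn_integral_cmult[symmetric]) (auto simp: ennreal_mult)
  also have "\<dots> < \<infinity>"
    using nn_integral_powr_tail[of a "1/2"] N by (simp add: a_def ennreal_mult_less_top)
  finally obtain I where I: "(\<integral>\<^sup>+ x. ennreal (h x) \<partial>lborel) = ennreal I" "I \<ge> 0"
    by (cases "\<integral>\<^sup>+ x. ennreal (h x) \<partial>lborel") auto
  have comp: "norm (inverse (Complex x t)) powr a \<le> h x" if "t \<ge> 1/2" for x t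
  proof -
    have "\<bar>x\<bar> \<le> norm (Complex x t)" "t \<le> norm (Complex x t)"
      using abs_Re_le_cmod[of "Complex x t"] abs_Im_le_cmod[of "Complex x t"] by auto
    then have le: "(\<bar>x\<bar> + 1/2) / 2 \<le> norm (Complex x t)" using that by (simp add: field_simps)
    have "norm (inverse (Complex x t)) powr a = norm (Complex x t) powr (- a)"
      by (simp add: norm_inverse powr_minus inverse_powr)
    also have "\<dots> \<le> ((\<bar>x\<bar> + 1/2) / 2) powr (- a)"
      using le N p by (intro powr_mono2') (auto simp: a_def)
    also have "\<dots> = h x"
    proof -
      have "(u / 2) powr (- a) = 2 powr a * u powr (- a)" if "u > 0" for u :: real
        using that by (simp add: powr_divide powr_minus field_simps)
      then show ?thesis unfolding h_def by simp
    qed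
    finally show ?thesis .
  qed
  show thesis
  proof (rule that)
    show "I ^ CARD('n) \<ge> 0" using I by simp
    fix E :: "complex^'n \<Rightarrow> complex" and B d :: real
    assume B: "B \<ge> 0" and d: "d \<le> 1/2"
      and E: "\<And>z. z \<in> tube_dom \<Longrightarrow> norm (E z) \<le> B * norm (weight N (shift (- d) z))"
    have "hp_int p E y \<le> ennreal (B powr p * I ^ CARD('n))" if y: "y \<in> Gamma_cone" for y
    proof -
      have "hp_int p E y \<le> (\<integral>\<^sup>+ x. ennreal (B powr p) * (\<Prod>j\<in>UNIV. ennreal (h (x $ j))) \<partial>(lborel :: (real^'n) measure))"
        unfolding hp_int_def
      proof (rule nn_integral_mono)
        fix x :: "real^'n"
        have "norm (weight N (shift (- d) (tube_pt x y))) powr p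
            = (\<Prod>j\<in>UNIV. norm (inverse (Complex (x $ j) (y $ j - d + 1))) powr a)"
        proof -
          have c1: "tube_pt x (y + vec (- d)) $ j + \<i> = Complex (x $ j) (y $ j - d + 1)" for j
            by (simp add: tube_pt_def complex_eq_iff)
          have c2: "(norm w ^ (N + 1)) powr p = norm w powr a" for w :: complex
          proof (cases "w = 0")
            case False
            then show ?thesis unfolding a_def powr_powr[symmetric] by (subst powr_realpow) auto
          qed (use p in \<open>simp add: a_def\<close>)
          show ?thesis
            unfolding weight_def shift_tube_pt c1 prod_norm[symmetric] norm_power
            unfolding prod_powr_distrib c2 ..
        qed
        also have "\<dots> \<le> (\<Prod>j\<in>UNIV. h (x $ j))"
        proof (rule prod_mono)
          fix j
          have "y $ j > 0" using y by (simp add: Gamma_cone_def)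
          then show "0 \<le> norm (inverse (Complex (x $ j) (y $ j - d + 1))) powr a \<and>
              norm (inverse (Complex (x $ j) (y $ j - d + 1))) powr a \<le> h (x $ j)"
            using d by (intro conjI comp) auto
        qed
        finally have w: "norm (weight N (shift (- d) (tube_pt x y))) powr p \<le> (\<Prod>j\<in>UNIV. h (x $ j))" .
        have "norm (E (tube_pt x y)) powr p \<le> (B * norm (weight N (shift (- d) (tube_pt x y)))) powr p"
          using p y by (intro powr_mono2 E) (auto simp: tube_pt_in_tube_dom)
        also have "\<dots> \<le> B powr p * (\<Prod>j\<in>UNIV. h (x $ j))"
          using B w by (simp add: powr_mult mult_left_mono)
        finally show "ennreal (norm (E (tube_pt x y)) powr p) \<le> ennreal (B powr p) * (\<Prod>j\<in>UNIV. ennreal (h (x $ j)))"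
          using h0 by (simp add: prod_ennreal prod_nonneg ennreal_leI flip: ennreal_mult)
      qed
      also have "\<dots> = ennreal (B powr p) * ennreal I ^ CARD('n)"
        using nn_integral_prod_components[of "\<lambda>x. ennreal (h x)", where 'n='n]
        by (subst nn_integral_cmult) (simp_all add: I)
      also have "\<dots> = ennreal (B powr p * I ^ CARD('n))"
        using I by (simp add: ennreal_mult ennreal_power)
      finally show ?thesis .
    qed
    then show "Hp_pow p E \<le> ennreal (B powr p * I ^ CARD('n))" unfolding Hp_pow_eq by (rule SUP_least)
  qed
qed

section \<open>Polynomials in the inverses of \<open>z $ j + \<alpha> $ j\<close>\<close>

definition uvar_monom :: "complex^'n \<Rightarrow> ('n \<Rightarrow> nat) \<Rightarrow> complex^'n \<Rightarrow> complex" where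
  "uvar_monom \<alpha> k z = (\<Prod>j\<in>UNIV. inverse (z $ j + \<alpha> $ j) ^ k j)"

definition upoly :: "complex^'n \<Rightarrow> (complex^'n \<Rightarrow> complex) set" where
  "upoly \<alpha> = {Q. \<exists>K c. finite K \<and> Q = (\<lambda>z. \<Sum>k\<in>K. c k * uvar_monom \<alpha> k z)}"

lemma upoly_const: "(\<lambda>_. a) \<in> upoly \<alpha>"
  unfolding upoly_def
  by (intro CollectI exI[of _ "{\<lambda>_. 0}"] exI[of _ "\<lambda>_. a"]) (simp add: uvar_monom_def)

lemma upoly_add:
  assumes "P \<in> upoly \<alpha>" "Q \<in> upoly \<alpha>"
  shows "(\<lambda>z. P z + Q z) \<in> upoly \<alpha>"
proof -
  obtain K c where P: "finite K" "P = (\<lambda>z. \<Sum>k\<in>K. c k * uvar_monom \<alpha> k z)"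
    using assms unfolding upoly_def by blast
  obtain L e where Q: "finite L" "Q = (\<lambda>z. \<Sum>k\<in>L. e k * uvar_monom \<alpha> k z)"
    using assms unfolding upoly_def by blast
  define g where "g k = (if k \<in> K then c k else 0) + (if k \<in> L then e k else 0)" for k
  have "P z + Q z = (\<Sum>k\<in>K \<union> L. g k * uvar_monom \<alpha> k z)" for z
  proof -
    have "P z = (\<Sum>k\<in>K \<union> L. (if k \<in> K then c k else 0) * uvar_monom \<alpha> k z)"
      unfolding P(2) by (rule sum.mono_neutral_cong_left) (use P Q in auto)
    moreover have "Q z = (\<Sum>k\<in>K \<union> L. (if k \<in> L then e k else 0) * uvar_monom \<alpha> k z)"
      unfolding Q(2) by (rule sum.mono_neutral_cong_left) (use P Q in auto)
    ultimately show ?thesis by (simp add: g_def distrib_right sum.distrib)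
  qed
  then show ?thesis unfolding upoly_def using P(1) Q(1)
    by (intro CollectI exI[of _ "K \<union> L"] exI[of _ g]) auto
qed

lemma upoly_cmult_uvar:
  assumes "P \<in> upoly \<alpha>"
  shows "(\<lambda>z. a * inverse (z $ j + \<alpha> $ j) * P z) \<in> upoly \<alpha>"
proof -
  obtain K c where P: "finite K" "P = (\<lambda>z. \<Sum>k\<in>K. c k * uvar_monom \<alpha> k z)"
    using assms unfolding upoly_def by blast
  define s where "s k = k(j := Suc (k j))" for k :: "'a \<Rightarrow> nat"
  define r where "r k = k(j := k j - 1)" for k :: "'a \<Rightarrow> nat"
  have rs: "r (s k) = k" for k by (auto simp: r_def s_def)
  then have inj: "inj_on s K" by (metis inj_onI)
  have mon: "uvar_monom \<alpha> (s k) z = inverse (z $ j + \<alpha> $ j) * uvar_monom \<alpha> k z" for k z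
  proof -
    have "uvar_monom \<alpha> (s k) z = inverse (z $ j + \<alpha> $ j) ^ Suc (k j) *
        (\<Prod>i\<in>UNIV - {j}. inverse (z $ i + \<alpha> $ i) ^ k i)"
      unfolding uvar_monom_def by (subst prod.remove[of _ j]) (auto simp: s_def intro!: prod.cong)
    also have "\<dots> = inverse (z $ j + \<alpha> $ j) * uvar_monom \<alpha> k z"
      unfolding uvar_monom_def by (subst (2) prod.remove[of _ j]) auto
    finally show ?thesis .
  qed
  have "a * inverse (z $ j + \<alpha> $ j) * P z = (\<Sum>k\<in>s ` K. (a * c (r k)) * uvar_monom \<alpha> k z)" for z
    unfolding P(2) sum.reindex[OF inj] by (simp add: rs mon sum_distrib_left mult_ac)
  then show ?thesis unfolding upoly_def using P(1)
    by (intro CollectI exI[of _ "s ` K"] exI[of _ "\<lambda>k. a * c (r k)"]) auto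
qed

text \<open>For \<alpha> = i and a = -2i the substituted quantity is the Cayley coordinate (z - i) /
  (z + i) = 1 - 2i / (z + i), so polynomials in it become polynomials in the inverses.\<close>

lemma upoly_mpoly_fun:
  assumes "P \<in> mpoly_fun"
  shows "(\<lambda>z. P (\<lambda>j. 1 + a * inverse (z $ j + \<alpha> $ j))) \<in> upoly \<alpha>"
  using assms
proof (induction rule: mpoly_fun.induct)
  case (const c)
  show ?case by (rule upoly_const)
next
  case (add P Q)
  then show ?case by (intro upoly_add)
next
  case (coord P j)
  from upoly_add[OF coord.IH upoly_cmult_uvar[OF coord.IH, of a j]]
  show ?case by (simp add: algebra_simps)
qed

lemma RN_eq:
  "RN N \<alpha> = {f. \<exists>Q\<in>upoly \<alpha>. f = (\<lambda>z. (\<Prod>j\<in>UNIV. inverse (z $ j + \<alpha> $ j) ^ (N + 1)) * Q z)}"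
  (is "_ = ?R")
proof (intro equalityI subsetI)
  fix f assume "f \<in> RN N \<alpha>"
  then obtain c where c: "finite {k. c k \<noteq> 0}"
    "f = (\<lambda>z. (\<Prod>j\<in>UNIV. inverse (z $ j + \<alpha> $ j) ^ (N + 1)) *
               (\<Sum>k\<in>{k. c k \<noteq> 0}. c k * uvar_monom \<alpha> k z))"
    by (auto simp: RN_def uvar_monom_def)
  then have "(\<lambda>z. \<Sum>k\<in>{k. c k \<noteq> 0}. c k * uvar_monom \<alpha> k z) \<in> upoly \<alpha>"
    unfolding upoly_def by auto
  with c(2) show "f \<in> ?R" by auto
next
  fix f assume "f \<in> ?R"
  then obtain K c where K: "finite K"
    "f = (\<lambda>z. (\<Prod>j\<in>UNIV. inverse (z $ j + \<alpha> $ j) ^ (N + 1)) * (\<Sum>k\<in>K. c k * uvar_monom \<alpha> k z))"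
    by (auto simp: upoly_def)
  define e where "e k = (if k \<in> K then c k else 0)" for k
  have sub: "{k. e k \<noteq> 0} \<subseteq> K" by (auto simp: e_def)
  have "(\<Sum>k\<in>K. c k * uvar_monom \<alpha> k z) = (\<Sum>k\<in>{k. e k \<noteq> 0}. e k * uvar_monom \<alpha> k z)" for z
    by (rule sum.mono_neutral_cong_right) (use K sub in \<open>auto simp: e_def\<close>)
  then show "f \<in> RN N \<alpha>"
    unfolding RN_def uvar_monom_def[symmetric] K(2) using finite_subset[OF sub K(1)]
    by (intro CollectI exI[of _ e]) simp
qed

section \<open>The Cayley coordinate and its contraction\<close>

lemma Im_cayley_inverse_pos:
  assumes "norm \<omega> < 1"
  shows "Im (\<i> * (1 + \<omega>) / (1 - \<omega>)) > 0"
proof -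
  have ne: "1 - \<omega> \<noteq> 0" using assms by auto
  define n where "n = (norm (1 - \<omega>))\<^sup>2"
  have n: "n > 0" using ne by (simp add: n_def)
  have "\<i> * (1 + \<omega>) / (1 - \<omega>) = \<i> * (1 + \<omega>) * cnj (1 - \<omega>) / of_real n"
    unfolding n_def by (simp only: complex_div_cnj[of "\<i> * (1 + \<omega>)"] of_real_power)
  then have "Im (\<i> * (1 + \<omega>) / (1 - \<omega>)) = (1 - ((Re \<omega>)\<^sup>2 + (Im \<omega>)\<^sup>2)) / n"
    by (simp add: algebra_simps power2_eq_square)
  moreover have "(norm \<omega>)\<^sup>2 < 1" using assms by (simp add: abs_square_less_1)
  ultimately show ?thesis using n by (simp add: cmod_power2)
qed

lemma norm_cayley_le:
  assumes "Im z > 0"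
  shows "norm (1 + (- 2 * \<i>) * inverse (z + \<i>)) \<le> 1"
proof -
  have ne: "z + \<i> \<noteq> 0" using assms by (auto simp: complex_eq_iff)
  have "1 + (- 2 * \<i>) * inverse (z + \<i>) = (z - \<i>) / (z + \<i>)" using ne by (simp add: field_simps)
  moreover have "norm (z - \<i>) \<le> norm (z + \<i>)"
    using assms by (auto simp: cmod_def power2_eq_square algebra_simps)
  ultimately show ?thesis using ne by (simp add: norm_divide)
qed

text \<open>
  In the Cayley coordinate \<open>w = (z - i)/(z + i)\<close> this is \<open>w \<mapsto> rw\<close> with \<open>r = (1 - s)/(1 + s)\<close>.
\<close>

definition contr :: "real \<Rightarrow> complex \<Rightarrow> complex" where
  "contr s z = (z + \<i> * s) / (1 - \<i> * s * z)"

lemma contr_eq_cayley: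
  assumes s: "0 < s" "s < 1" and z: "Im z > 0"
  shows "contr s z = \<i> * (1 + of_real ((1 - s) / (1 + s)) * (1 + (- 2 * \<i>) * inverse (z + \<i>)))
     / (1 - of_real ((1 - s) / (1 + s)) * (1 + (- 2 * \<i>) * inverse (z + \<i>)))"
proof -
  have ne: "z + \<i> \<noteq> 0" using z by (auto simp: complex_eq_iff)
  have s1: "(1 + of_real s :: complex) \<noteq> 0" using s by (auto simp: complex_eq_iff)
  have "s * Im z > 0" using s z by simp
  then have d: "1 - \<i> * s * z \<noteq> 0" by (auto simp: complex_eq_iff)
  have w: "1 + (- 2 * \<i>) * inverse (z + \<i>) = (z - \<i>) / (z + \<i>)" using ne by (simp add: field_simps)
  define D where "D = (1 + of_real s) * (z + \<i>)"
  have D: "D \<noteq> 0" using ne s1 by (simp add: D_def)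
  have n: "1 + of_real ((1 - s) / (1 + s)) * ((z - \<i>) / (z + \<i>)) = 2 * (z + \<i> * s) / D"
    using ne s1 unfolding D_def by (simp add: divide_simps) (simp add: algebra_simps)
  have m: "1 - of_real ((1 - s) / (1 + s)) * ((z - \<i>) / (z + \<i>)) = 2 * \<i> * (1 - \<i> * s * z) / D"
    using ne s1 unfolding D_def by (simp add: divide_simps) (simp add: algebra_simps)
  show ?thesis unfolding contr_def w n m using D d by (simp add: divide_simps) (simp add: algebra_simps)
qed

text \<open>Slightly below the real axis \<open>contr\<close> may lower the height, but by a bounded
  factor: the numerator of the imaginary part is at least -d / 8 and the squared modulus of the
  denominator at least 1/4, so heights above -d / 16 end at or above -d / 2.\<close>

lemma Im_contr_gt:
  assumes s: "0 < s" "s \<le> 1" and d: "0 < d" "d \<le> 1/2" and z: "Im z > - d / 16"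
  shows "Im (contr s z) > - d"
proof -
  define x y where "x = Re z" and "y = Im z"
  have zz: "z = Complex x y" by (simp add: x_def y_def)
  define n where "n = (norm (1 - \<i> * s * z))\<^sup>2"
  have n: "n = (1 + s * y)\<^sup>2 + (s * x)\<^sup>2"
    by (simp add: n_def zz cmod_power2)
  have sy: "s * y \<ge> - 1/2"
  proof (cases "y \<ge> 0")
    case False
    then have "s * y \<ge> 1 * y" using s by (intro mult_right_mono_neg) auto
    then show ?thesis using z d by (simp add: y_def)
  qed (use s in \<open>simp add: order_trans[OF _ mult_nonneg_nonneg]\<close>)
  have "(1 + s * y)\<^sup>2 \<ge> (1/2)\<^sup>2" using sy by (intro power_mono) auto
  then have "(1 + s * y)\<^sup>2 \<ge> 1/4" by (simp add: power_divide)
  then have n4: "n \<ge> 1/4" unfolding n using zero_le_power2[of "s * x"] by linarith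
  have "contr s z = (z + \<i> * s) * cnj (1 - \<i> * s * z) / of_real n"
    unfolding contr_def n_def by (simp only: complex_div_cnj[of "z + \<i> * s"] of_real_power)
  then have "Im (contr s z) = (y * (1 + s * s) + s * (1 + x * x + y * y)) / n"
    by (simp add: zz algebra_simps)
  also have "\<dots> \<ge> (- d / 8) / n"
  proof (rule divide_right_mono)
    have "y * (1 + s * s) \<ge> - d / 8"
    proof (cases "y \<ge> 0")
      case False
      have "s * s \<le> 1" using s by (simp add: mult_le_one)
      then have "y * (1 + s * s) \<ge> y * 2" using False by (intro mult_left_mono_neg) auto
      then show ?thesis using z by (simp add: y_def)
    next
      case True
      then have "0 \<le> y * (1 + s * s)" by simp
      then show ?thesis using d by simp
    qed
    moreover have "s * (1 + x * x + y * y) \<ge> 0" using s by simp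
    ultimately show "- d / 8 \<le> y * (1 + s * s) + s * (1 + x * x + y * y)" by simp
  qed (use n4 in simp)
  finally have 1: "Im (contr s z) \<ge> (- d / 8) / n" .
  have "d / 8 / n \<le> d / 8 / (1/4)" using n4 d by (intro divide_left_mono) auto
  then show ?thesis using 1 d by simp
qed

section \<open>Holomorphy and bounds of the approximants\<close>

lemma shift_shift: "shift a (shift b z) = shift (a + b) z"
  by (simp add: shift_def vec_eq_iff algebra_simps)

lemma shift_0 [simp]: "shift 0 z = z"
  by (simp add: shift_def vec_eq_iff)

lemma shift_nth [simp]: "shift d z $ j = z $ j + \<i> * of_real d"
  by (simp add: shift_def)

lemma holo_on_subset: "holo_on F S \<Longrightarrow> T \<subseteq> S \<Longrightarrow> holo_on F T"
  by (auto simp: holo_on_def)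

lemma holo_on_weight_shift:
  assumes "d < 1"
  shows "holo_on (\<lambda>z :: complex^'n. weight N (shift (- d) z)) tube_dom"
  unfolding weight_def shift_nth
proof (intro holo_on_prod holo_on_power)
  fix j :: 'n
  show "holo_on (\<lambda>z :: complex^'n. inverse (z $ j + \<i> * complex_of_real (- d) + \<i>)) tube_dom"
  proof (rule holo_on_coordinate[where \<psi>="\<lambda>w. inverse (w + \<i> * complex_of_real (- d) + \<i>)"])
    fix z :: "complex^'n" assume "z \<in> tube_dom"
    then have "0 < Im (z $ j)" by (simp add: tube_dom_def)
    then have "z $ j + \<i> * complex_of_real (- d) + \<i> \<noteq> 0" using assms by (auto simp: complex_eq_iff)
    then show "(\<lambda>w. inverse (w + \<i> * complex_of_real (- d) + \<i>)) field_differentiable at (z $ j)"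
      by (auto intro!: derivative_intros)
  qed
qed

lemma holo_on_weight: "holo_on (weight N) tube_dom"
  using holo_on_weight_shift[of 0 N] by simp

lemma uvar_holo:
  shows "holo_on (\<lambda>z :: complex^'n. inverse (z $ j + \<i>)) tube_dom"
proof (rule holo_on_coordinate[where \<psi>="\<lambda>w. inverse (w + \<i>)"])
  fix z :: "complex^'n" assume "z \<in> tube_dom"
  then have "z $ j + \<i> \<noteq> 0" by (auto simp: tube_dom_def complex_eq_iff) (smt (verit))
  then show "(\<lambda>w. inverse (w + \<i>)) field_differentiable at (z $ j)"
    by (auto intro!: derivative_intros)
qed

lemma upoly_holo:
  assumes "Q \<in> upoly (\<chi> j. \<i>)"
  shows "holo_on Q tube_dom"
proof -
  obtain K c where Q: "Q = (\<lambda>z. \<Sum>k\<in>K. c k * uvar_monom (\<chi> j. \<i>) k z)"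
    using assms by (auto simp: upoly_def)
  show ?thesis unfolding Q uvar_monom_def
    by (intro holo_on_sum holo_on_mult holo_on_const holo_on_prod holo_on_power) (simp add: uvar_holo)
qed

lemma norm_uvar_le: "z \<in> tube_dom \<Longrightarrow> norm (inverse (z $ j + \<i>)) \<le> 1"
proof -
  assume "z \<in> tube_dom"
  then have "1 \<le> \<bar>Im (z $ j + \<i>)\<bar>" by (auto simp: tube_dom_def less_imp_le)
  also have "\<dots> \<le> norm (z $ j + \<i>)" by (rule abs_Im_le_cmod)
  finally show ?thesis by (simp add: norm_inverse inverse_le_1_iff)
qed

lemma upoly_bounded:
  fixes Q :: "complex^'n \<Rightarrow> complex"
  assumes "Q \<in> upoly (\<chi> j. \<i>)"
  obtains C where "C \<ge> 0" "\<And>z. z \<in> tube_dom \<Longrightarrow> norm (Q z) \<le> C"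
proof -
  obtain K c where Q: "Q = (\<lambda>z. \<Sum>k\<in>K. c k * uvar_monom (\<chi> j. \<i>) k z)"
    using assms by (auto simp: upoly_def)
  show thesis
  proof (rule that[of "\<Sum>k\<in>K. norm (c k)"])
    show "(\<Sum>k\<in>K. norm (c k)) \<ge> 0" by (simp add: sum_nonneg)
    fix z :: "complex^'n" assume z: "z \<in> tube_dom"
    show "norm (Q z) \<le> (\<Sum>k\<in>K. norm (c k))"
      unfolding Q
    proof (rule sum_norm_le)
      fix k
      have "norm (uvar_monom (\<chi> j. \<i>) k z) \<le> 1"
        unfolding uvar_monom_def prod_norm[symmetric]
        by (rule prod_le_1) (use norm_uvar_le[OF z] in \<open>auto simp: norm_power power_le_one\<close>)
      then show "norm (c k * uvar_monom (\<chi> j. \<i>) k z) \<le> norm (c k)"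
        by (simp add: norm_mult mult_left_le)
    qed
  qed
qed

lemma RN_subset_Hp_space:
  assumes p: "p > 0" and N: "real (N + 1) * p > 1"
  shows "RN N (\<chi> j. \<i>) \<subseteq> (Hp_space p :: (complex^'n \<Rightarrow> complex) set)"
proof
  fix f :: "complex^'n \<Rightarrow> complex" assume "f \<in> RN N (\<chi> j. \<i>)"
  then obtain Q where Q: "Q \<in> upoly (\<chi> j. \<i>)" "f = (\<lambda>z. weight N z * Q z)"
    by (auto simp: RN_eq weight_def)
  obtain C where C: "C \<ge> 0" "\<And>z. z \<in> tube_dom \<Longrightarrow> norm (Q z) \<le> C"
    using upoly_bounded[OF Q(1)] by blast
  obtain W where W: "W \<ge> 0"
    "\<And>(E :: complex^'n \<Rightarrow> complex) B d. B \<ge> 0 \<Longrightarrow> d \<le> 1/2 \<Longrightarrow>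
      (\<And>z. z \<in> tube_dom \<Longrightarrow> norm (E z) \<le> B * norm (weight N (shift (- d) z))) \<Longrightarrow>
      Hp_pow p E \<le> ennreal (B powr p * W)"
    using weight_Hp_bound[OF p N] by blast
  have "Hp_pow p f \<le> ennreal (C powr p * W)"
  proof (rule W(2)[OF C(1), of 0])
    fix z :: "complex^'n" assume "z \<in> tube_dom"
    then show "norm (f z) \<le> C * norm (weight N (shift (- 0) z))"
      using C(2)[of z] by (simp add: Q(2) norm_mult mult.commute mult_right_mono)
  qed simp
  then have "Hp_pow p f < \<infinity>" by (rule le_less_trans) simp
  moreover have "holo_on f tube_dom"
    unfolding Q(2) by (rule holo_on_mult[OF holo_on_weight upoly_holo[OF Q(1)]])
  ultimately show "f \<in> Hp_space p" by (simp add: Hp_space_def)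
qed

text \<open>The order N + 1 matches \<open>weight N\<close>, so for fixed \<epsilon> > 0 the
  quotient of the two stays bounded. For 0 < \<epsilon> <= 1 the poles lie at -i / \<epsilon>, of
  imaginary part at most -1, which leaves a strip below the real axis where the factor is bounded
  uniformly in \<epsilon>.\<close>

definition damp :: "nat \<Rightarrow> real \<Rightarrow> complex^'n \<Rightarrow> complex" where
  "damp N \<epsilon> z = (\<Prod>j\<in>UNIV. inverse (1 - \<i> * \<epsilon> * z $ j) ^ (N + 1))"

lemma norm_one_minus_ge:
  fixes w :: complex and \<epsilon> :: real
  assumes "0 \<le> \<epsilon>" "\<epsilon> \<le> 1" "Im w \<ge> - 1/2"
  shows "norm (1 - \<i> * \<epsilon> * w) \<ge> 1/2"
proof -
  have "\<epsilon> * Im w \<ge> - 1/2"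
  proof (cases "Im w \<ge> 0")
    case True
    then have "0 \<le> \<epsilon> * Im w" using assms by simp
    then show ?thesis by simp
  next
    case False
    then have "\<epsilon> * Im w \<ge> 1 * Im w" using assms by (intro mult_right_mono_neg) auto
    then show ?thesis using assms by simp
  qed
  then have "1/2 \<le> Re (1 - \<i> * \<epsilon> * w)" by simp
  then show ?thesis using complex_Re_le_cmod order_trans by blast
qed

lemma holo_on_damp_shift:
  assumes "0 \<le> \<epsilon>" "\<epsilon> \<le> 1" "d \<le> 1/2"
  shows "holo_on (\<lambda>z :: complex^'n. damp N \<epsilon> (shift (- d) z)) tube_dom"
  unfolding damp_def shift_nth
proof (intro holo_on_prod holo_on_power)
  fix j :: 'n
  show "holo_on (\<lambda>z :: complex^'n. inverse (1 - \<i> * \<epsilon> * (z $ j + \<i> * complex_of_real (- d)))) tube_dom"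
  proof (rule holo_on_coordinate[where \<psi>="\<lambda>w. inverse (1 - \<i> * \<epsilon> * (w + \<i> * complex_of_real (- d)))"])
    fix z :: "complex^'n" assume "z \<in> tube_dom"
    then have "0 < Im (z $ j)" by (simp add: tube_dom_def)
    then have "norm (1 - \<i> * \<epsilon> * (z $ j + \<i> * complex_of_real (- d))) \<ge> 1/2"
      using assms by (intro norm_one_minus_ge) auto
    then have "1 - \<i> * \<epsilon> * (z $ j + \<i> * complex_of_real (- d)) \<noteq> 0"
      by (metis norm_zero not_less_iff_gr_or_eq half_gt_zero zero_less_one order_less_le_trans less_irrefl)
    then show "(\<lambda>w. inverse (1 - \<i> * \<epsilon> * (w + \<i> * complex_of_real (- d)))) field_differentiable at (z $ j)"
      by (auto intro!: derivative_intros)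
  qed
qed

lemma norm_damp_le:
  fixes z :: "complex^'n"
  assumes "0 \<le> \<epsilon>" "\<epsilon> \<le> 1" "\<And>j. Im (z $ j) \<ge> - 1/2"
  shows "norm (damp N \<epsilon> z) \<le> (2 ^ (N + 1)) ^ CARD('n)"
proof -
  have "norm (damp N \<epsilon> z) \<le> (\<Prod>j\<in>(UNIV :: 'n set). 2 ^ (N + 1))"
    unfolding damp_def prod_norm[symmetric]
  proof (rule prod_mono)
    fix j
    have "inverse (norm (1 - \<i> * \<epsilon> * z $ j)) \<le> inverse (1/2)"
      using norm_one_minus_ge[OF assms(1,2) assms(3)[of j]] by (intro le_imp_inverse_le) auto
    then have "inverse (norm (1 - \<i> * \<epsilon> * z $ j)) ^ (N + 1) \<le> 2 ^ (N + 1)"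
      by (intro power_mono) auto
    then show "0 \<le> norm (inverse (1 - \<i> * \<epsilon> * z $ j) ^ (N + 1)) \<and>
        norm (inverse (1 - \<i> * \<epsilon> * z $ j) ^ (N + 1)) \<le> 2 ^ (N + 1)"
      by (simp only: norm_power norm_inverse) simp
  qed
  then show ?thesis by simp
qed

lemma damp_approx:
  fixes G :: "complex^'n \<Rightarrow> complex"
  assumes G: "holo_on G tube_dom" "Hp_pow p G < \<infinity>" and p: "p > 0" and d: "0 < d" "d \<le> 1/2" and e: "e > 0"
  obtains \<epsilon> where "0 < \<epsilon>" "\<epsilon> \<le> 1" "Hp_pow p (\<lambda>z. G (shift d z) * (1 - damp N \<epsilon> z)) < ennreal e"
proof -
  define \<epsilon> where "\<epsilon> k = 1 / (real k + 1)" for k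
  have \<epsilon>: "0 < \<epsilon> k" "\<epsilon> k \<le> 1" for k by (auto simp: \<epsilon>_def)
  have \<epsilon>lim: "\<epsilon> \<longlonglongrightarrow> 0" unfolding \<epsilon>_def by real_asymp
  \<comment> \<open>The damping factor is lowered by d so that \<open>E k\<close>, shifted up by d,
    is the difference to be estimated.\<close>
  define E where "E k z = G z * (1 - damp N (\<epsilon> k) (shift (- d) z))" for k z
  define c :: real where "c = 1 + (2 ^ (N + 1)) ^ CARD('n)"
  have "(\<lambda>k. Hp_pow p (\<lambda>z. E k (shift d z))) \<longlonglongrightarrow> 0"
  proof (rule Hp_shift_dominated_tendsto[OF _ G _ _ p d(1)])
    show "holo_on (E k) tube_dom" for k
      unfolding E_def using \<epsilon>[of k] d
      by (intro holo_on_mult holo_on_diff holo_on_const holo_on_damp_shift G) auto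
    show "c \<ge> 0" by (simp add: c_def)
    show "norm (E k z) \<le> c * norm (G z)" if z: "z \<in> tube_dom" for k z
    proof -
      have "Im (shift (- d) z $ j) \<ge> - 1/2" for j
      proof -
        have "0 < Im (z $ j)" using z by (simp add: tube_dom_def)
        then show ?thesis using d by simp
      qed
      then have "norm (damp N (\<epsilon> k) (shift (- d) z)) \<le> (2 ^ (N + 1)) ^ CARD('n)"
        using \<epsilon>[of k] by (intro norm_damp_le) auto
      then have "norm (1 - damp N (\<epsilon> k) (shift (- d) z)) \<le> c"
        using norm_triangle_ineq4[of 1 "damp N (\<epsilon> k) (shift (- d) z)"] by (simp add: c_def)
      then show ?thesis unfolding E_def norm_mult by (subst mult.commute) (intro mult_right_mono; simp)
    qed
    show "(\<lambda>k. E k (tube_pt x (vec d))) \<longlonglongrightarrow> 0" for x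
    proof -
      have "(\<lambda>k. damp N (\<epsilon> k) w) \<longlonglongrightarrow> (\<Prod>j\<in>UNIV. inverse (1 - \<i> * of_real 0 * w $ j) ^ (N + 1))" for w :: "complex^'n"
        unfolding damp_def by (intro tendsto_intros \<epsilon>lim) auto
      then have "(\<lambda>k. E k (tube_pt x (vec d))) \<longlonglongrightarrow> G (tube_pt x (vec d)) * (1 - 1)"
        unfolding E_def by (intro tendsto_intros) simp
      then show ?thesis by simp
    qed
  qed
  then have "\<forall>\<^sub>F k in sequentially. Hp_pow p (\<lambda>z. E k (shift d z)) < ennreal e"
    by (rule order_tendstoD) (use e in simp)
  then obtain k where "Hp_pow p (\<lambda>z. E k (shift d z)) < ennreal e"
    using eventually_happens[of _ sequentially] by auto
  then show thesis using that[of "\<epsilon> k"] \<epsilon>[of k] by (simp add: E_def shift_shift)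
qed

lemma contr_differentiable:
  assumes "0 \<le> s" "s \<le> 1" "Im w \<ge> - 1/2"
  shows "contr s field_differentiable at w"
proof -
  have "norm (1 - \<i> * s * w) \<ge> 1/2" using assms by (rule norm_one_minus_ge)
  then have "1 - \<i> * s * w \<noteq> 0" by (metis norm_zero half_gt_zero zero_less_one order_less_le_trans less_irrefl)
  then show ?thesis unfolding contr_def by (auto intro!: derivative_intros)
qed

lemma holo_on_coordinate_holomorphic:
  fixes g :: "complex^'n \<Rightarrow> complex"
  assumes g: "holo_on g S" and q: "q holomorphic_on A"
    and S: "\<And>t. t \<in> A \<Longrightarrow> (\<chi> i. if i = j then q t else v $ i) \<in> S"
  shows "(\<lambda>t. g (\<chi> i. if i = j then q t else v $ i)) holomorphic_on A"
proof -
  define z where "z = (\<chi> i. if i = j then 0 else v $ i)"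
  have eq: "(\<chi> i. if i = j then l else v $ i) = z + l *s axis j 1" for l
    by (simp add: vec_eq_iff z_def axis_def)
  have "(\<lambda>l. g (z + l *s axis j 1)) holomorphic_on q ` A"
    by (rule holo_on_line[OF g]) (use S eq in auto)
  from holomorphic_on_compose[OF q this] show ?thesis by (simp add: eq o_def)
qed

text \<open>Two errors are kept apart. Replacing g by its contraction is not uniformly small, as
  convergence fails to be uniform near infinity; against the weight, dominated convergence makes it
  small in H^p, which uses the room below the boundary. The contracted g is uniformly close to a
  polynomial in the Cayley coordinates, and a uniform error times the weight is small in
  H^p.\<close>

lemma approx_bounded:
  fixes g :: "complex^'n \<Rightarrow> complex"
  assumes g: "holo_on g {z. \<forall>j. - d < Im (z $ j)}"
    and B: "\<And>z. (\<And>j. - d < Im (z $ j)) \<Longrightarrow> norm (g z) \<le> B"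
    and d: "0 < d" "d \<le> 1/2" and p: "p > 0" and N: "real (N + 1) * p > 1" and e: "e > 0"
  obtains f where "f \<in> RN N (\<chi> j. \<i>)" "Hp_pow p (\<lambda>z. weight N z * g z - f z) < ennreal e"
proof -
  let ?D = "{z :: complex^'n. \<forall>j. - d < Im (z $ j)}"
  have "norm (g 0) \<le> B" using d(1) by (intro B) simp
  then have B0: "B \<ge> 0" by (rule order_trans[OF norm_ge_zero])
  obtain W where W: "W \<ge> 0"
    "\<And>(E :: complex^'n \<Rightarrow> complex) B d. B \<ge> 0 \<Longrightarrow> d \<le> 1/2 \<Longrightarrow>
      (\<And>z. z \<in> tube_dom \<Longrightarrow> norm (E z) \<le> B * norm (weight N (shift (- d) z))) \<Longrightarrow>
      Hp_pow p E \<le> ennreal (B powr p * W)"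
    using weight_Hp_bound[OF p N] by blast
  \<comment> \<open>Two such errors cost 2 powr p * (e' + e') = e / 2 in the quasi-triangle
    inequality.\<close>
  define e' where "e' = e / (4 * 2 powr p)"
  have e': "e' > 0" using e by (simp add: e'_def)
  \<comment> \<open>The margin that \<open>Im_contr_gt\<close> needs for the contracted point to
    remain in \<open>?D\<close>.\<close>
  define d' where "d' = d / 16"
  have d': "0 < d'" "d' \<le> 1/2" "d' < 1" using d by (auto simp: d'_def)
  define s where "s k = 1 / (real k + 2)" for k
  have s: "0 < s k" "s k < 1" for k by (auto simp: s_def)
  have slim: "s \<longlonglongrightarrow> 0" unfolding s_def by real_asymp
  have Dcontr: "(\<chi> j. contr (s k) (z $ j + \<i> * of_real (- d'))) \<in> ?D" if "z \<in> tube_dom" for k and z :: "complex^'n"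
  proof -
    have "- d < Im (contr (s k) (z $ j + \<i> * of_real (- d')))" for j
      using that s[of k] d by (intro Im_contr_gt) (auto simp: tube_dom_def d'_def)
    then show ?thesis by simp
  qed
  define E where "E k z = weight N (shift (- d') z) *
    (g (shift (- d') z) - g (\<chi> j. contr (s k) (z $ j + \<i> * of_real (- d'))))" for k z
  have wH: "Hp_pow p (\<lambda>z :: complex^'n. weight N (shift (- d') z)) < \<infinity>"
    by (rule le_less_trans[OF W(2)[of 1 d']]) (use d' in auto)
  have shiftD: "shift (- d') z \<in> ?D" if "z \<in> tube_dom" for z
  proof -
    have "- d < Im (z $ j) - d'" for j using that d d' by (auto simp: tube_dom_def d'_def intro: less_trans[of _ "- d'"])
    then show ?thesis by simp
  qed
  have Eholo: "holo_on (E k) tube_dom" for k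
    unfolding E_def
  proof (intro holo_on_mult holo_on_diff holo_on_weight_shift d')
    show "holo_on (\<lambda>z. g (shift (- d') z)) tube_dom"
      unfolding shift_def by (rule holo_on_coordinatewise[OF g]) (use shiftD in \<open>auto simp: shift_def intro!: derivative_intros\<close>)
    show "holo_on (\<lambda>z. g (\<chi> j. contr (s k) (z $ j + \<i> * of_real (- d')))) tube_dom"
    proof (rule holo_on_coordinatewise[where \<psi>="\<lambda>j w. contr (s k) (w + \<i> * of_real (- d'))", OF g Dcontr])
      fix z :: "complex^'n" and j assume "z \<in> tube_dom"
      then have "0 < Im (z $ j)" by (simp add: tube_dom_def)
      then have "contr (s k) field_differentiable at (z $ j + \<i> * of_real (- d'))"
        using s[of k] d' by (intro contr_differentiable) auto
      from field_differentiable_compose[OF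
          field_differentiable_add[OF field_differentiable_ident field_differentiable_const] this]
      show "(\<lambda>w. contr (s k) (w + \<i> * of_real (- d'))) field_differentiable at (z $ j)"
        by (simp add: o_def)
    qed
  qed
  have "(\<lambda>k. Hp_pow p (\<lambda>z. E k (shift d' z))) \<longlonglongrightarrow> 0"
  proof (rule Hp_shift_dominated_tendsto[OF Eholo holo_on_weight_shift[OF d'(3)] wH _ _ p d'(1)])
    show "0 \<le> 2 * B" using B0 by simp
    show "norm (E k z) \<le> 2 * B * norm (weight N (shift (- d') z))" if z: "z \<in> tube_dom" for k z
    proof -
      have "norm (g (shift (- d') z)) \<le> B" by (rule B) (use shiftD[OF z] in blast)
      moreover have "norm (g (\<chi> j. contr (s k) (z $ j + \<i> * of_real (- d')))) \<le> B"
        by (rule B) (use Dcontr[OF z, of k] in blast)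
      ultimately have "norm (g (shift (- d') z) - g (\<chi> j. contr (s k) (z $ j + \<i> * of_real (- d')))) \<le> 2 * B"
        using norm_triangle_ineq4[of "g (shift (- d') z)" "g (\<chi> j. contr (s k) (z $ j + \<i> * of_real (- d')))"] by linarith
      then show ?thesis unfolding E_def norm_mult by (subst mult.commute) (rule mult_right_mono, auto)
    qed
    fix x :: "real^'n"
    define z0 where "z0 = (tube_pt x (vec d') :: complex^'n)"
    have z0: "z0 \<in> tube_dom" using d' by (simp add: z0_def tube_pt_in_tube_dom Gamma_cone_def)
    have "(\<lambda>k. (\<chi> j. contr (s k) (z0 $ j + \<i> * of_real (- d')))) \<longlonglongrightarrow> shift (- d') z0"
    proof (rule vec_tendstoI)
      fix j
      have "(\<lambda>k. (w + \<i> * of_real (s k)) / (1 - \<i> * of_real (s k) * w)) \<longlonglongrightarrow> (w + \<i> * of_real 0) / (1 - \<i> * of_real 0 * w)" for w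
        by (intro tendsto_intros slim) auto
      then show "(\<lambda>k. (\<chi> j. contr (s k) (z0 $ j + \<i> * of_real (- d'))) $ j) \<longlonglongrightarrow> shift (- d') z0 $ j"
        by (simp add: contr_def)
    qed
    then have "(\<lambda>k. g (\<chi> j. contr (s k) (z0 $ j + \<i> * of_real (- d')))) \<longlonglongrightarrow> g (shift (- d') z0)"
      by (rule continuous_on_tendsto_compose[OF holo_on_imp_continuous_on[OF g]])
        (use shiftD[OF z0] Dcontr[OF z0] in \<open>auto intro!: always_eventually\<close>)
    from tendsto_mult[OF tendsto_const[of "weight N (shift (- d') z0)"] tendsto_diff[OF tendsto_const[of "g (shift (- d') z0)"] this]]
    show "(\<lambda>k. E k (tube_pt x (vec d'))) \<longlonglongrightarrow> 0" by (simp add: E_def z0_def)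
  qed
  then have "\<forall>\<^sub>F k in sequentially. Hp_pow p (\<lambda>z. E k (shift d' z)) < ennreal e'"
    by (rule order_tendstoD) (use e' in simp)
  then obtain k where k: "Hp_pow p (\<lambda>z. E k (shift d' z)) < ennreal e'"
    using eventually_happens[of _ sequentially] by auto
  have Ek: "E k (shift d' z) = weight N z * (g z - g (\<chi> j. contr (s k) (z $ j)))" for z
    by (simp add: E_def shift_shift)
  define r where "r = (1 - s k) / (1 + s k)"
  have r: "0 < r" "r < 1" using s[of k] by (auto simp: r_def)
  \<comment> \<open>The inverse Cayley transform of r * w: on the unit disc it expresses
    \<open>contr (s k)\<close>, and it keeps its values in the upper half-plane up to |w| < 1 /
    r.\<close>
  define q where "q w = \<i> * (1 + of_real r * w) / (1 - of_real r * w)" for w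
  have rw: "norm (of_real r * w :: complex) < 1" if "norm w < 1 / r" for w :: complex
    using that r by (simp add: norm_mult field_simps)
  have qpos: "Im (q w) > 0" if "norm w < 1 / r" for w
    unfolding q_def by (rule Im_cayley_inverse_pos[OF rw[OF that]])
  have qhol: "q holomorphic_on ball 0 (1 / r)"
    unfolding q_def
  proof (intro holomorphic_intros)
    fix w :: complex assume "w \<in> ball 0 (1 / r)"
    then have "norm (of_real r * w) < 1" by (intro rw) simp
    then show "1 - of_real r * w \<noteq> 0" by auto
  qed
  define h where "h w = g (\<chi> j. q (w j))" for w
  \<comment> \<open>Solves \<eta> powr p * (W + 1) = e'; W alone might be 0.\<close>
  define \<eta> where "\<eta> = (e' / (W + 1)) powr (1 / p)"
  have \<eta>: "\<eta> > 0" using e' W by (simp add: \<eta>_def)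
  have \<eta>p: "\<eta> powr p * W \<le> e'"
  proof -
    have "\<eta> powr p = e' / (W + 1)" using e' W(1) p by (simp add: \<eta>_def powr_powr)
    moreover have "e' / (W + 1) * W \<le> e'" using e' W(1) by (simp add: pos_divide_le_eq)
    ultimately show ?thesis by simp
  qed
  obtain P where P: "P \<in> mpoly_fun" "\<And>w. (\<And>i. norm (w i) \<le> 1) \<Longrightarrow> norm (h w - P w) \<le> \<eta>"
  proof (rule polydisc_approx[where R="1 / r" and h=h and B=B and \<epsilon>=\<eta>])
    show "1 < 1 / r" using r by simp
    fix w :: "'n \<Rightarrow> complex" assume w: "\<And>i. norm (w i) < 1 / r"
    have qd: "- d < Im (q t)" if "norm t < 1 / r" for t using qpos[OF that] d by simp
    show "norm (h w) \<le> B" unfolding h_def by (rule B) (use qd w in simp)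
    fix j
    have eq: "(\<chi> i. q ((w(j := t)) i)) = (\<chi> i. if i = j then q t else (\<chi> i. q (w i)) $ i)" for t
      by (simp add: vec_eq_iff)
    show "(\<lambda>t. h (w(j := t))) holomorphic_on ball 0 (1 / r)"
      unfolding h_def eq by (rule holo_on_coordinate_holomorphic[OF g qhol]) (use qd w in auto)
  qed (use \<eta> in auto)
  define f where "f z = weight N z * P (\<lambda>j. 1 + (- 2 * \<i>) * inverse (z $ j + \<i>))" for z :: "complex^'n"
  have "(\<lambda>z :: complex^'n. P (\<lambda>j. 1 + (- 2 * \<i>) * inverse (z $ j + (\<chi> j. \<i>) $ j))) \<in> upoly (\<chi> j. \<i>)"
    by (rule upoly_mpoly_fun[OF P(1)])
  then have f: "f \<in> RN N (\<chi> j. \<i>)"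
    unfolding RN_eq f_def weight_def by (auto simp: fun_eq_iff)
  then have fholo: "holo_on f tube_dom"
    using RN_subset_Hp_space[OF p N] by (auto simp: Hp_space_def)
  define H where "H z = weight N z * g (\<chi> j. contr (s k) (z $ j)) - f z" for z
  have "Hp_pow p H \<le> ennreal (\<eta> powr p * W)"
  proof (rule W(2)[of \<eta> 0])
    fix z :: "complex^'n" assume z: "z \<in> tube_dom"
    have zj: "Im (z $ j) > 0" for j using z by (simp add: tube_dom_def)
    define w where "w j = 1 + (- 2 * \<i>) * inverse (z $ j + \<i>)" for j
    have "contr (s k) (z $ j) = q (w j)" for j
      unfolding q_def w_def r_def by (rule contr_eq_cayley[OF s zj])
    then have "H z = weight N z * (h w - P w)"
      unfolding H_def f_def h_def w_def[symmetric] by (simp add: algebra_simps)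
    moreover have "norm (h w - P w) \<le> \<eta>"
      by (rule P(2)) (simp add: w_def norm_cayley_le[OF zj, simplified])
    ultimately show "norm (H z) \<le> \<eta> * norm (weight N (shift (- 0) z))"
      by (simp add: norm_mult mult.commute[of \<eta>] mult_left_mono)
  qed (use \<eta> in auto)
  also have "\<dots> \<le> ennreal e'" using \<eta>p by (rule ennreal_leI)
  finally have HH: "Hp_pow p H \<le> ennreal e'" .
  have Hholo: "holo_on H tube_dom"
    unfolding H_def
  proof (intro holo_on_diff holo_on_mult holo_on_weight fholo)
    show "holo_on (\<lambda>z. g (\<chi> j. contr (s k) (z $ j))) tube_dom"
    proof (rule holo_on_coordinatewise[where \<psi>="\<lambda>j. contr (s k)", OF g])
      fix z :: "complex^'n" assume z: "z \<in> tube_dom"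
      have zj: "Im (z $ j) > 0" for j using z by (simp add: tube_dom_def)
      show "contr (s k) field_differentiable at (z $ j)" for j
        using s[of k] zj[of j] by (intro contr_differentiable) auto
      have "- d < Im (contr (s k) (z $ j))" for j
        using s[of k] zj[of j] d by (intro Im_contr_gt) auto
      then show "(\<chi> j. contr (s k) (z $ j)) \<in> ?D" by simp
    qed
  qed
  have "Hp_pow p (\<lambda>z. weight N z * g z - f z) = Hp_pow p (\<lambda>z. E k (shift d' z) + H z)"
    by (intro arg_cong[where f="Hp_pow p"] ext) (simp add: Ek H_def algebra_simps)
  also have "\<dots> \<le> ennreal (2 powr p) * (Hp_pow p (\<lambda>z. E k (shift d' z)) + Hp_pow p H)"
    using d' by (intro Hp_pow_add Hholo p holo_on_shift Eholo) auto
  also have "\<dots> \<le> ennreal (2 powr p) * (ennreal e' + ennreal e')"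
    using k HH by (intro mult_left_mono add_mono) auto
  also have "\<dots> = ennreal (2 powr p * (e' + e'))"
    using less_imp_le[OF e'] by (simp only: ennreal_mult ennreal_plus add_nonneg_nonneg powr_ge_zero)
  also have "2 powr p * (e' + e') = e / 2" by (simp add: e'_def)
  also have "ennreal (e / 2) < ennreal e" using e by (simp add: ennreal_less_iff)
  finally show thesis using that[OF f] by blast
qed

text \<open>\<open>Hp_pow\<close> is the p-th power of the quasi-norm, hence the tolerance
  \<open>\<epsilon> powr p\<close>.\<close>

theorem theorem4p2:
  fixes N :: nat and p :: real
  assumes "N > 0" and "0 < p" and "real N * p > 1"
  shows "RN N (\<chi> j. \<i>) \<subseteq> (Hp_space p :: (complex^'n \<Rightarrow> complex) set)
     \<and> (\<forall>F \<in> (Hp_space p :: (complex^'n \<Rightarrow> complex) set). \<forall>\<epsilon>>0.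
          \<exists>f \<in> RN N (\<chi> j. \<i>). Hp_pow p (\<lambda>z. F z - f z) < ennreal (\<epsilon> powr p))"
proof (intro conjI ballI allI impI)
  note p = assms(2)
  have N: "real (N + 1) * p > 1" using assms by (simp add: distrib_right)
  show RN: "RN N (\<chi> j. \<i>) \<subseteq> (Hp_space p :: (complex^'n \<Rightarrow> complex) set)"
    by (rule RN_subset_Hp_space[OF p N])
  fix F :: "complex^'n \<Rightarrow> complex" and \<epsilon> :: real
  assume "F \<in> Hp_space p" and \<epsilon>: "\<epsilon> > 0"
  then have F: "holo_on F tube_dom" "Hp_pow p F < \<infinity>" by (auto simp: Hp_space_def)
  \<comment> \<open>Three errors are combined by two uses of the quasi-triangle inequality; together
    they amount to at most 3/4 of \<open>\<epsilon> powr p\<close>.\<close>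
  define e where "e = \<epsilon> powr p / (2 powr p * 2 powr p * 4)"
  have e: "e > 0" using \<epsilon> by (simp add: e_def)
  obtain \<delta> where \<delta>: "0 < \<delta>" "\<delta> \<le> 1" "Hp_pow p (\<lambda>z. F z - F (shift \<delta> z)) < ennreal e"
    using Hp_shift_tendsto[OF F p e] by blast
  \<comment> \<open>The first half of the shift makes \<open>G\<close> bounded on the tube, the
    second lets z go down to height -d.\<close>
  define d where "d = \<delta> / 2"
  have d: "0 < d" "d \<le> 1/2" "d \<ge> 0" using \<delta> by (auto simp: d_def)
  define G where "G z = F (shift d z)" for z
  have G: "holo_on G tube_dom" "Hp_pow p G < \<infinity>"
    unfolding G_def using holo_on_shift[OF F(1) d(3)] Hp_pow_shift_le[OF d(3), of p F] F(2)
    by (auto elim: le_less_trans)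
  obtain B0 where B0: "B0 \<ge> 0" "\<And>x y. (\<And>j. d \<le> y $ j) \<Longrightarrow> norm (F (tube_pt x y)) \<le> B0"
    using Hp_bounded_away_from_boundary[OF F p d(1)] by blast
  have GB: "norm (G z) \<le> B0" if "z \<in> tube_dom" for z
  proof -
    have "shift d z = tube_pt (\<chi> j. Re (z $ j)) (\<chi> j. Im (z $ j) + d)"
      by (simp add: tube_pt_def vec_eq_iff complex_eq_iff)
    then show ?thesis unfolding G_def using that by (auto intro!: B0(2) simp: tube_dom_def less_imp_le)
  qed
  obtain \<kappa> where \<kappa>: "0 < \<kappa>" "\<kappa> \<le> 1" "Hp_pow p (\<lambda>z. G (shift d z) * (1 - damp N \<kappa> z)) < ennreal e"
    using damp_approx[OF G p d(1,2) e] by blast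
  \<comment> \<open>The damped function divided by \<open>weight N\<close>.\<close>
  define g where "g z = G (shift d z) * (\<Prod>j\<in>UNIV. ((z $ j + \<i>) * inverse (1 - \<i> * \<kappa> * z $ j)) ^ (N + 1))" for z
  define b where "b = 3 / \<kappa> + 2"
  have b: "norm ((w + \<i>) * inverse (1 - \<i> * \<kappa> * w)) \<le> b" if "Im w \<ge> - 1/2" for w
  proof -
    define u where "u = 1 - \<i> * \<kappa> * w"
    have u: "norm u \<ge> 1/2" unfolding u_def using \<kappa> that by (intro norm_one_minus_ge) auto
    then have u0: "u \<noteq> 0" by auto
    \<comment> \<open>The numerator is an affine function of the denominator u, and |u| >= 1/2
      absorbs the constant: \<kappa> |w + i| <= |u| + 1 <= 3 |u|.\<close>
    have "of_real \<kappa> * (w + \<i>) = \<i> * (u - 1 + \<kappa>)" by (simp add: u_def algebra_simps)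
    then have "\<kappa> * norm (w + \<i>) = norm (u + of_real (\<kappa> - 1))"
      using \<kappa> by (metis norm_mult norm_of_real abs_of_pos norm_ii mult_1 add_diff_eq add.commute diff_add_eq of_real_diff of_real_1)
    also have "\<dots> \<le> norm u + norm (of_real (\<kappa> - 1) :: complex)" by (rule norm_triangle_ineq)
    also have "norm (of_real (\<kappa> - 1) :: complex) = 1 - \<kappa>" unfolding norm_of_real using \<kappa> by simp
    also have "norm u + (1 - \<kappa>) \<le> norm u + 1" using \<kappa> by simp
    also have "\<dots> \<le> 3 * norm u" using u by linarith
    finally have "norm (w + \<i>) \<le> 3 / \<kappa> * norm u" using \<kappa> by (simp add: field_simps)
    then have "norm (w + \<i>) / norm u \<le> 3 / \<kappa>" using u0 by (simp add: pos_divide_le_eq)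
    then show ?thesis by (simp add: norm_mult norm_inverse divide_inverse b_def flip: u_def)
  qed
  let ?D = "{z :: complex^'n. \<forall>j. - d < Im (z $ j)}"
  have sD: "shift d z \<in> tube_dom" if "z \<in> ?D" for z
  proof -
    have "0 < Im (z $ j) + d" for j
    proof -
      have "- d < Im (z $ j)" using that by simp
      then show ?thesis by linarith
    qed
    then show ?thesis by (simp add: tube_dom_def)
  qed
  have gholo: "holo_on g ?D"
    unfolding g_def
  proof (intro holo_on_mult holo_on_prod holo_on_power)
    show "holo_on (\<lambda>z. G (shift d z)) ?D"
      unfolding shift_def by (rule holo_on_coordinatewise[OF G(1)]) (use sD in \<open>auto simp: shift_def intro!: derivative_intros\<close>)
    show "holo_on (\<lambda>z. z $ j + \<i>) ?D" for j
      by (rule holo_on_coordinate) (auto intro!: derivative_intros)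
    show "holo_on (\<lambda>z. inverse (1 - \<i> * \<kappa> * z $ j)) ?D" for j
    proof (rule holo_on_coordinate[where \<psi>="\<lambda>w. inverse (1 - \<i> * \<kappa> * w)"])
      fix z assume "z \<in> ?D"
      then have "- d < Im (z $ j)" by simp
      then have "norm (1 - \<i> * \<kappa> * z $ j) \<ge> 1/2" using \<kappa> d by (intro norm_one_minus_ge) auto
      then have "1 - \<i> * \<kappa> * z $ j \<noteq> 0" by auto
      then show "(\<lambda>w. inverse (1 - \<i> * \<kappa> * w)) field_differentiable at (z $ j)"
        by (auto intro!: derivative_intros)
    qed
  qed
  have gB: "norm (g z) \<le> B0 * (b ^ (N + 1)) ^ CARD('n)" if z: "\<And>j. - d < Im (z $ j)" for z
  proof -
    have "norm (\<Prod>j\<in>UNIV. ((z $ j + \<i>) * inverse (1 - \<i> * \<kappa> * z $ j)) ^ (N + 1)) \<le> (\<Prod>j\<in>(UNIV :: 'n set). b ^ (N + 1))"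
      unfolding prod_norm[symmetric]
    proof (rule prod_mono)
      fix j
      have "norm ((z $ j + \<i>) * inverse (1 - \<i> * \<kappa> * z $ j)) \<le> b"
        by (rule b) (use z[of j] d in auto)
      then show "0 \<le> norm (((z $ j + \<i>) * inverse (1 - \<i> * \<kappa> * z $ j)) ^ (N + 1)) \<and>
        norm (((z $ j + \<i>) * inverse (1 - \<i> * \<kappa> * z $ j)) ^ (N + 1)) \<le> b ^ (N + 1)"
        unfolding norm_power by (intro conjI power_mono) auto
    qed
    moreover have "norm (G (shift d z)) \<le> B0" by (rule GB[OF sD]) (use z in blast)
    ultimately show ?thesis unfolding g_def norm_mult using B0(1) by (intro mult_mono) auto
  qed
  obtain f where f: "f \<in> RN N (\<chi> j. \<i>)" "Hp_pow p (\<lambda>z. weight N z * g z - f z) < ennreal e"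
    using approx_bounded[OF gholo gB d(1,2) p N e] by blast
  have fholo: "holo_on f tube_dom" using f(1) RN by (auto simp: Hp_space_def)
  have Dsub: "tube_dom \<subseteq> ?D" using d by (auto simp: tube_dom_def intro: less_trans[of _ 0])
  have wg: "weight N z * g z = G (shift d z) * damp N \<kappa> z" if z: "z \<in> tube_dom" for z
  proof -
    have "z $ j + \<i> \<noteq> 0" for j
    proof -
      have "0 < Im (z $ j)" using z by (simp add: tube_dom_def)
      then show ?thesis by (auto simp: complex_eq_iff)
    qed
    then have eq: "inverse (z $ j + \<i>) ^ (N + 1) * ((z $ j + \<i>) * inverse (1 - \<i> * \<kappa> * z $ j)) ^ (N + 1)
        = inverse (1 - \<i> * \<kappa> * z $ j) ^ (N + 1)" for j
      by (simp only: power_mult_distrib[symmetric] mult.assoc[symmetric]) simp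
    have "weight N z * (\<Prod>j\<in>UNIV. ((z $ j + \<i>) * inverse (1 - \<i> * \<kappa> * z $ j)) ^ (N + 1)) = damp N \<kappa> z"
      unfolding weight_def damp_def prod.distrib[symmetric] eq ..
    then show ?thesis by (simp only: g_def mult.left_commute[of "weight N z"])
  qed
  have GG: "G (shift d z) = F (shift \<delta> z)" for z
    by (simp add: G_def shift_shift d_def)
  \<comment> \<open>On the tube F - f telescopes into three errors: \<open>A1\<close> from shifting,
    \<open>A2\<close> from damping, \<open>A3\<close> from rational approximation.\<close>
  define A1 where "A1 z = F z - F (shift \<delta> z)" for z
  define A2 where "A2 z = G (shift d z) * (1 - damp N \<kappa> z)" for z
  define A3 where "A3 z = weight N z * g z - f z" for z
  have h1: "holo_on A1 tube_dom"
    unfolding A1_def using \<delta> by (intro holo_on_diff F holo_on_shift) auto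
  have h2: "holo_on A2 tube_dom"
    unfolding A2_def using d \<kappa> holo_on_damp_shift[of \<kappa> 0 N]
    by (intro holo_on_mult holo_on_diff holo_on_const holo_on_shift G) auto
  have h3: "holo_on A3 tube_dom"
    unfolding A3_def by (intro holo_on_diff holo_on_mult holo_on_weight fholo holo_on_subset[OF gholo Dsub])
  have "Hp_pow p (\<lambda>z. F z - f z) = Hp_pow p (\<lambda>z. A1 z + (A2 z + A3 z))"
  proof (rule Hp_pow_cong)
    fix z :: "complex^'n" assume "z \<in> tube_dom"
    then show "norm (F z - f z) = norm (A1 z + (A2 z + A3 z))"
      unfolding A1_def A2_def A3_def by (subst wg) (simp_all add: GG algebra_simps)
  qed
  also have "\<dots> \<le> ennreal (2 powr p) * (Hp_pow p A1 + Hp_pow p (\<lambda>z. A2 z + A3 z))"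
    by (intro Hp_pow_add h1 holo_on_add h2 h3 p)
  also have "\<dots> \<le> ennreal (2 powr p) * (Hp_pow p A1 + ennreal (2 powr p) * (Hp_pow p A2 + Hp_pow p A3))"
    by (intro mult_left_mono add_left_mono Hp_pow_add h2 h3 p) auto
  also have "\<dots> \<le> ennreal (2 powr p) * (ennreal e + ennreal (2 powr p) * (ennreal e + ennreal e))"
    using \<delta>(3) \<kappa>(3) f(2) by (intro mult_left_mono add_mono) (auto simp: A1_def[abs_def] A2_def[abs_def] A3_def[abs_def])
  also have "\<dots> = ennreal (2 powr p * (e + 2 powr p * (e + e)))"
    using less_imp_le[OF e]
    by (simp only: ennreal_mult ennreal_plus add_nonneg_nonneg mult_nonneg_nonneg powr_ge_zero)
  also have "\<dots> < ennreal (\<epsilon> powr p)"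
  proof (rule ennreal_lessI)
    show "0 < \<epsilon> powr p" using \<epsilon> by simp
    have t: "2 powr p \<ge> 1" using p by (simp add: ge_one_powr_ge_zero)
    have "e \<le> 2 powr p * e" using t e by simp
    then have "2 powr p * (e + 2 powr p * (e + e)) \<le> 2 powr p * (2 powr p * e + 2 powr p * (e + e))"
      by (intro mult_left_mono add_right_mono) auto
    also have "\<dots> = 3 / 4 * \<epsilon> powr p" by (simp add: e_def)
    also have "\<dots> < \<epsilon> powr p" using \<epsilon> by simp
    finally show "2 powr p * (e + 2 powr p * (e + e)) < \<epsilon> powr p" .
  qed
  finally show "\<exists>f \<in> RN N (\<chi> j. \<i>). Hp_pow p (\<lambda>z. F z - f z) < ennreal (\<epsilon> powr p)"
    using f(1) by blast
qed

end
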